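(* Let $\beta>1$ be a finitary Pisot unit of degree $m$ with minimal polynomial $x^m-k_1x^{m-1}-\dots-k_m$, let $T$ be the automorphism of $\mathbb{T}^m=\mathbb{R}^m/\mathbb{Z}^m$ given by the companion matrix, let $\xi_0=1/g'(\beta)$ where $g$ is the minimal polynomial of $\beta$, and define $\phi_0,\phi:X_\beta\to\mathbb{T}^m$ by $$\phi_0(\varepsilon)=\lim_{N\to\infty}\Big(\sum_{k=-N}^{\infty}\varepsilon_k\beta^{-k}\Big)(\xi_0,\xi_0\beta^{-1},\dots,\xi_0\beta^{-m+1})\bmod\mathbb{Z}^m,\quad \phi(\varepsilon)=\lim_{N\to\infty}\Big(\sum_{k=-N}^{\infty}\varepsilon_k\beta^{-k}\Big)(1,\beta^{-1},\dots,\beta^{-m+1})\bmod\mathbb{Z}^m.$$ Let $X'_\beta=X_\beta/\!\sim$ where $\varepsilon\sim\varepsilon'$ iff $\phi_0(\varepsilon)=\phi_0(\varepsilon')$, made into a group by $[\varepsilon]\pm[\varepsilon']=\phi_0^{-1}(\phi_0(\varepsilon)\pm\phi_0(\varepsilon'))$. Then: (1) $\phi$ is well defined on $X'_\beta$, i.e. $\phi_0(\varepsilon)=\phi_0(\varepsilon')$ implies $\phi(\varepsilon)=\phi(\varepsilon')$; (2) the induced map $\phi:X'_\beta\to\mathbb{T}^m$ is a group homomorphism whose kernel is $\mathfrak{A}_\beta$, i.e. $\phi(\varepsilon)=0$ holds exactly for the sequences $\varepsilon$ belonging to $g([\xi])$ for some $[\xi]\in\mathcal{A}_\beta$.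
   Context: A Pisot unit is a real algebraic integer $\beta>1$ whose other conjugates have modulus $<1$ and whose minimal polynomial has constant term $\pm1$. The companion matrix is the $m\times m$ matrix with first row $(k_1,k_2,\dots,k_m)$, ones on the subdiagonal and zeros elsewhere. $\beta$-expansions (greedy), the two-sided $\beta$-compactum $X_\beta=\{(\varepsilon_n)_{n\in\mathbb{Z}}:(\varepsilon_n,\varepsilon_{n+1},\dots)\prec(d_1,d_2,\dots)\ \forall n\}$ (lexicographic order, where $(d_k)$ is the greedy expansion of $1$, replaced by the periodic sequence with period $(d'_1,\dots,d'_{k_0-1},d'_{k_0}-1)$ if the greedy expansion $(d'_k)$ of $1$ is finite with last nonzero digit at $k_0$), and finitary ($\{x\in[0,1):\text{finite }\beta\text{-expansion}\}=\mathbb{Z}[\beta]\cap[0,1)$) are as usual; expansions of $x\ge0$ are obtained by scaling by powers of $\beta$. The limits defining $\phi_0,\phi$ exist mod $\mathbb{Z}^m$, and $\phi_0$ is continuous and onto. $\mathcal{P}_\beta=\{\xi\in\mathbb{R}:\|\xi\beta^n\|\to0\}$ ($\|\cdot\|$ distance to nearest integer), $\mathcal{A}_\beta=\mathcal{P}_\beta/\mathbb{Z}[\beta]$; for $[\xi]\in\mathcal{A}_\beta$, $g([\xi])$ is the (finite) set of purely periodic two-sided sequences in $X_\beta$ obtained by extending to the left the periodic tails of the (ultimately periodic) $\beta$-expansions of all nonnegative $\xi'\in\xi+\mathbb{Z}[\beta]$, and $\mathfrak{A}_\beta=\{g([\xi]):[\xi]\in\mathcal{A}_\beta\}$. *)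

theory Defs
  imports
    Complex_Main
    "HOL-Library.Fun_Lexorder"
    "HOL-Computational_Algebra.Polynomial"
    "HOL-Algebra.Coset"
    "Jordan_Normal_Form.Matrix"
begin

section \<open>Pisot units\<close>

definition min_poly :: "real \<Rightarrow> rat poly" where
  "min_poly x = (THE p. lead_coeff p = 1 \<and> poly (map_poly of_rat p) x = 0 \<and>
     (\<forall>q. q \<noteq> 0 \<and> poly (map_poly of_rat q) x = 0 \<longrightarrow> degree p \<le> degree q))"

definition pisot_unit :: "real \<Rightarrow> bool" where
  "pisot_unit \<beta> \<longleftrightarrow> algebraic_int \<beta> \<and> \<beta> > 1 \<and>
     (\<forall>z::complex. poly (map_poly of_rat (min_poly \<beta>)) z = 0 \<and> z \<noteq> of_real \<beta> \<longrightarrow> cmod z < 1) \<and>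
     coeff (min_poly \<beta>) 0 \<in> {1, -1}"

text \<open>The polynomial \<open>x^m - k_1 x^(m-1) - \<dots> - k_m\<close>.\<close>

definition recurrence_poly :: "nat \<Rightarrow> (nat \<Rightarrow> int) \<Rightarrow> rat poly" where
  "recurrence_poly m k = monom 1 m - (\<Sum>j=1..m. monom (of_int (k j)) (m - j))"

definition xi0 :: "real \<Rightarrow> real" where
  "xi0 \<beta> = 1 / poly (pderiv (map_poly of_rat (min_poly \<beta>))) \<beta>"

definition int_ring_ext :: "real \<Rightarrow> real set" where
  "int_ring_ext \<beta> = range (\<lambda>p::int poly. poly (map_poly of_int p) \<beta>)"


section \<open>Greedy expansions and the two-sided compactum\<close>

text \<open>
  One-sided digit sequences are indexed from 0: \<open>beta_digit \<beta> x i\<close> is the coefficient of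
  \<open>\<beta>^-(i+1)\<close> in the greedy expansion of \<open>x \<in> [0,1]\<close>. For \<open>x = 1\<close> this is the sequence
  written \<open>d'\<close> in the literature, with first digit \<open>\<lfloor>\<beta>\<rfloor>\<close>.
\<close>

definition beta_digit :: "real \<Rightarrow> real \<Rightarrow> nat \<Rightarrow> nat" where
  "beta_digit \<beta> x i = nat \<lfloor>\<beta> * ((\<lambda>y. frac (\<beta> * y)) ^^ i) x\<rfloor>"

definition finite_expansion :: "real \<Rightarrow> real \<Rightarrow> bool" where
  "finite_expansion \<beta> x \<longleftrightarrow> finite {i. beta_digit \<beta> x i \<noteq> 0}"

definition finitary :: "real \<Rightarrow> bool" where
  "finitary \<beta> \<longleftrightarrow> {x \<in> {0..<1}. finite_expansion \<beta> x} = int_ring_ext \<beta> \<inter> {0..<1}"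

text \<open>The sequence \<open>(d_1, d_2, \<dots>)\<close>, again with \<open>d_(i+1)\<close> at index \<open>i\<close>.\<close>

definition unit_expansion :: "real \<Rightarrow> nat \<Rightarrow> nat" where
  "unit_expansion \<beta> i =
     (if finite_expansion \<beta> 1
      then let k0 = Suc (Max {j. beta_digit \<beta> 1 j \<noteq> 0}); r = i mod k0
           in if r = k0 - 1 then beta_digit \<beta> 1 r - 1 else beta_digit \<beta> 1 r
      else beta_digit \<beta> 1 i)"

text \<open>
  The order is the strict lexicographic one. With the non-strict order the two-sided periodic
  extension of \<open>d\<close> would also be admitted in the finitary case; it is identified with the
  zero sequence by \<open>\<phi>\<^sub>0\<close> but is the tail of no greedy expansion.
\<close>

definition beta_compactum :: "real \<Rightarrow> (int \<Rightarrow> nat) set" where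
  "beta_compactum \<beta> = {\<epsilon>. \<forall>n. less_fun (\<lambda>i. \<epsilon> (n + int i)) (unit_expansion \<beta>)}"

text \<open>
  The expansion of \<open>x \<ge> 0\<close> as a two-sided sequence, position \<open>n\<close> carrying \<open>\<beta>^-n\<close>.
\<close>

definition beta_expansion :: "real \<Rightarrow> real \<Rightarrow> int \<Rightarrow> nat" where
  "beta_expansion \<beta> x n =
     (let j = (LEAST j. x < \<beta> ^ j)
      in if n + int j \<ge> 1 then beta_digit \<beta> (x / \<beta> ^ j) (nat (n + int j - 1)) else 0)"


section \<open>The torus\<close>

abbreviation vec_group :: "nat \<Rightarrow> real vec monoid" where
  "vec_group m \<equiv> monoid_vec TYPE(real) m"

definition int_lattice :: "nat \<Rightarrow> real vec set" where
  "int_lattice m = {v \<in> carrier_vec m. \<forall>i<m. v $ i \<in> \<int>}"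

definition torus :: "nat \<Rightarrow> real vec set monoid" where
  "torus m = vec_group m Mod int_lattice m"

definition torus_proj :: "nat \<Rightarrow> real vec \<Rightarrow> real vec set" where
  "torus_proj m x = int_lattice m #>\<^bsub>vec_group m\<^esub> x"

definition dist_nearest_int :: "real \<Rightarrow> real" where
  "dist_nearest_int x = \<bar>x - of_int (round x)\<bar>"

text \<open>
  Limit in the quotient topology of the torus: the coordinates converge modulo 1 to those of a
  representative. The choice of representative is immaterial, and the limit is unique.
\<close>

definition torus_lim :: "nat \<Rightarrow> (nat \<Rightarrow> real vec) \<Rightarrow> real vec set" where
  "torus_lim m u = (THE L. L \<in> carrier (torus m) \<and>
     (\<exists>x\<in>L. \<forall>i<m. (\<lambda>N. dist_nearest_int (u N $ i - x $ i)) \<longlonglongrightarrow> 0))"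

definition companion_mat :: "nat \<Rightarrow> (nat \<Rightarrow> int) \<Rightarrow> real mat" where
  "companion_mat m k = mat m m (\<lambda>(i, j).
     if i = 0 then of_int (k (j + 1)) else if i = j + 1 then 1 else 0)"

definition companion_torus_map :: "nat \<Rightarrow> (nat \<Rightarrow> int) \<Rightarrow> real vec set \<Rightarrow> real vec set" where
  "companion_torus_map m k C = the_elem ((\<lambda>x. torus_proj m (companion_mat m k *\<^sub>v x)) ` C)"


section \<open>The arithmetic codings\<close>

text \<open>\<open>partial_value \<beta> \<epsilon> N\<close> is the sum of \<open>\<epsilon>_k \<beta>^-k\<close> over \<open>k \<ge> -N\<close>.\<close>

definition partial_value :: "real \<Rightarrow> (int \<Rightarrow> nat) \<Rightarrow> nat \<Rightarrow> real" where
  "partial_value \<beta> \<epsilon> N = (\<Sum>j. real (\<epsilon> (int j - int N)) * \<beta> powi (int N - int j))"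

definition phi0 :: "nat \<Rightarrow> real \<Rightarrow> (int \<Rightarrow> nat) \<Rightarrow> real vec set" where
  "phi0 m \<beta> \<epsilon> =
     torus_lim m (\<lambda>N. partial_value \<beta> \<epsilon> N \<cdot>\<^sub>v vec m (\<lambda>i. xi0 \<beta> * \<beta> powi (- int i)))"

definition phi :: "nat \<Rightarrow> real \<Rightarrow> (int \<Rightarrow> nat) \<Rightarrow> real vec set" where
  "phi m \<beta> \<epsilon> =
     torus_lim m (\<lambda>N. partial_value \<beta> \<epsilon> N \<cdot>\<^sub>v vec m (\<lambda>i. \<beta> powi (- int i)))"

definition phi0_rel :: "nat \<Rightarrow> real \<Rightarrow> (int \<Rightarrow> nat) rel" where
  "phi0_rel m \<beta> = {(\<epsilon>, \<epsilon>'). \<epsilon> \<in> beta_compactum \<beta> \<and> \<epsilon>' \<in> beta_compactum \<beta> \<and>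
     phi0 m \<beta> \<epsilon> = phi0 m \<beta> \<epsilon>'}"

text \<open>The quotient \<open>X'\<close> with the group operation pulled back along \<open>\<phi>\<^sub>0\<close>.\<close>

definition quotient_compactum :: "nat \<Rightarrow> real \<Rightarrow> (int \<Rightarrow> nat) set monoid" where
  "quotient_compactum m \<beta> = \<lparr>
     carrier = beta_compactum \<beta> // phi0_rel m \<beta>,
     mult = (\<lambda>A B. {\<epsilon> \<in> beta_compactum \<beta>.
        \<exists>a\<in>A. \<exists>b\<in>B. phi0 m \<beta> \<epsilon> = phi0 m \<beta> a \<otimes>\<^bsub>torus m\<^esub> phi0 m \<beta> b}),
     one = {\<epsilon> \<in> beta_compactum \<beta>. phi0 m \<beta> \<epsilon> = \<one>\<^bsub>torus m\<^esub>}\<rparr>"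

definition phi_induced :: "nat \<Rightarrow> real \<Rightarrow> (int \<Rightarrow> nat) set \<Rightarrow> real vec set" where
  "phi_induced m \<beta> A = the_elem (phi m \<beta> ` A)"


section \<open>The kernel\<close>

definition pisot_set :: "real \<Rightarrow> real set" where
  "pisot_set \<beta> = {\<xi>. (\<lambda>n. dist_nearest_int (\<xi> * \<beta> ^ n)) \<longlonglongrightarrow> 0}"

definition pisot_classes :: "real \<Rightarrow> real set set" where
  "pisot_classes \<beta> = (\<lambda>\<xi>. (+) \<xi> ` int_ring_ext \<beta>) ` pisot_set \<beta>"

text \<open>
  Here \<open>C\<close> is a coset \<open>\<xi> + \<int>[\<beta>]\<close>. A purely periodic sequence extends the periodic tail
  of an expansion to the left iff it agrees with that expansion from some position on.
\<close>

definition periodic_tails :: "real \<Rightarrow> real set \<Rightarrow> (int \<Rightarrow> nat) set" where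
  "periodic_tails \<beta> C = {\<epsilon> \<in> beta_compactum \<beta>.
     (\<exists>p>0. \<forall>n. \<epsilon> (n + int p) = \<epsilon> n) \<and>
     (\<exists>\<xi>'\<in>C. \<xi>' \<ge> 0 \<and> (\<exists>n0. \<forall>n\<ge>n0. \<epsilon> n = beta_expansion \<beta> \<xi>' n))}"

definition tail_classes :: "real \<Rightarrow> (int \<Rightarrow> nat) set set" where
  "tail_classes \<beta> = periodic_tails \<beta> ` pisot_classes \<beta>"

end

theory Submission
  imports Defs "HOL-Computational_Algebra.Fundamental_Theorem_Algebra"
    "HOL-Library.Diagonal_Subsequence" "HOL-Library.Nat_Bijection"
begin

text \<open>
  Let \<open>g = (x - \<beta>) h\<close> be the minimal polynomial and consider two-sided real sequences annihilated by \<open>g\<close>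
  acting through the shift. As the constant term of \<open>g\<close> is \<open>\<plusminus>1\<close>, such a sequence is integral as soon as it is
  so on \<open>m\<close> consecutive places; its part annihilated by \<open>h\<close> is summable to the right, because all roots of
  \<open>h\<close> lie in the open unit disc. The coordinates of \<open>\<phi>\<^sub>0(\<epsilon>)\<close> lift to a sequence \<open>W\<close> of this kind, with
  equality in the torus becoming integrality of the difference of lifts, and \<open>\<phi>(\<epsilon>)\<close> lifts to \<open>g'(shift) W\<close>.
  Hence \<open>\<phi>\<close> is the composition of \<open>\<phi>\<^sub>0\<close> with an endomorphism of the torus.

  If \<open>\<phi>(\<epsilon>) = 0\<close>, every right tail of \<open>\<epsilon>\<close> has a value approximated by a bounded integral recurrent sequence.
  There are finitely many such values, each tail value determines the next, and so \<open>\<epsilon>\<close> is periodic. The same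
  finiteness shows that expansions of elements of the Pisot set are ultimately periodic. Two
  periodic sequences have the same \<open>\<phi>\<^sub>0\<close> iff their tail values differ by an element of \<open>\<int>[\<beta>]\<close>.
\<close>

section \<open>Polynomials in the shift\<close>

text \<open>The series over all of \<int> diverges to the left, so \<open>W\<close> is not a plain
  sum of digits. It converges after correction: \<beta>^n / g'(\<beta>) differs from an
  integer-valued recurrent sequence by a summable error, and dropping the integers leaves an
  absolutely convergent series. The same recipe with 1 in place of 1 / g'(\<beta>) lifts \<phi>. The
  origin of this series is a free parameter. Moving it shifts the lift and changes it by integers,
  so integrality at one origin yields an integral approximation of the remainder at every place,
  with a bound that does not depend on the place.

  The obstacle is the group structure of the quotient: a product of two classes is a class because
  \<open>\<phi>\<^sub>0\<close> is onto. Surjectivity comes from compactness, but the strict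
  lexicographic condition is not closed. Limits are therefore taken in a larger set that admits the
  remainder 1, and a carry leads back. Both sets are described by remainders instead of digits; the
  finite expansion of 1, supplied by finitariness, turns the lexicographic condition into an
  interval condition on remainders.\<close>

definition shift_op :: "'a::comm_ring_1 poly \<Rightarrow> (int \<Rightarrow> 'a) \<Rightarrow> int \<Rightarrow> 'a" where
  "shift_op p u n = (\<Sum>i\<le>Polynomial.degree p. coeff p i * u (n + int i))"

lemma shift_op_eq_sum:
  assumes "Polynomial.degree p \<le> d"
  shows "shift_op p u n = (\<Sum>i\<le>d. coeff p i * u (n + int i))"
  unfolding shift_op_def
  by (rule sum.mono_neutral_left) (use assms in \<open>auto simp: coeff_eq_0\<close>)

lemma shift_op_0 [simp]: "shift_op 0 u n = 0"
  by (simp add: shift_op_def)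

lemma shift_op_const [simp]: "shift_op [:c:] u n = c * u n"
  by (simp add: shift_op_def)

lemma shift_op_pCons: "shift_op (pCons c p) u n = c * u n + shift_op p u (n + 1)"
proof -
  have "shift_op (pCons c p) u n
      = (\<Sum>i\<le>Suc (Polynomial.degree p). coeff (pCons c p) i * u (n + int i))"
    by (rule shift_op_eq_sum) (rule degree_pCons_le)
  also have "\<dots> = c * u n + (\<Sum>i\<le>Polynomial.degree p. coeff p i * u (n + 1 + int i))"
    by (subst sum.atMost_Suc_shift) (simp add: add.assoc add.left_commute)
  finally show ?thesis
    by (simp add: shift_op_def)
qed

lemma shift_op_add: "shift_op (p + q) u n = shift_op p u n + shift_op q u n"
proof -
  let ?d = "max (Polynomial.degree p) (Polynomial.degree q)"
  have "shift_op (p + q) u n = (\<Sum>i\<le>?d. coeff (p + q) i * u (n + int i))"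
    by (rule shift_op_eq_sum) (rule degree_add_le_max)
  then show ?thesis
    by (simp add: shift_op_eq_sum[of p ?d] shift_op_eq_sum[of q ?d] distrib_right sum.distrib)
qed

lemma shift_op_smult: "shift_op (Polynomial.smult c p) u n = c * shift_op p u n"
  by (subst shift_op_eq_sum[OF degree_smult_le])
     (simp add: shift_op_def sum_distrib_left mult.assoc)

lemma shift_op_mult: "shift_op (p * q) u n = shift_op p (shift_op q u) n"
proof (induction p arbitrary: n)
  case (pCons c p)
  then show ?case
    by (simp add: shift_op_add shift_op_smult shift_op_pCons)
qed simp

lemma shift_op_translate: "shift_op p (\<lambda>n. u (n + a)) n = shift_op p u (n + a)"
  by (simp add: shift_op_def algebra_simps)

lemma shift_op_plus: "shift_op p (\<lambda>n. u n + w n) n = shift_op p u n + shift_op p w n"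
  by (simp add: shift_op_def distrib_left sum.distrib)

lemma shift_op_minus: "shift_op p (\<lambda>n. u n - w n) n = shift_op p u n - shift_op p w n"
  by (simp add: shift_op_def right_diff_distrib sum_subtractf)

lemma shift_op_cmult: "shift_op p (\<lambda>n. c * u n) n = c * shift_op p u n"
  by (simp add: shift_op_def sum_distrib_left algebra_simps)

lemma shift_op_sum:
  "shift_op p (\<lambda>n. \<Sum>l\<in>A. u l n) n = (\<Sum>l\<in>A. shift_op p (u l) n)"
  unfolding shift_op_def by (subst sum.swap) (simp add: sum_distrib_left)

lemma shift_op_powi:
  fixes x :: "'a::field"
  assumes "x \<noteq> 0"
  shows "shift_op p (\<lambda>n. x powi n) n = poly p x * x powi n"
  using assms by (simp add: shift_op_def poly_altdef sum_distrib_left power_int_add mult_ac)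

lemma shift_op_suminf:
  fixes u :: "nat \<Rightarrow> int \<Rightarrow> real"
  assumes "\<And>n. summable (\<lambda>j. u j n)"
  shows "shift_op p (\<lambda>n. \<Sum>j. u j n) n = (\<Sum>j. shift_op p (u j) n)"
  unfolding shift_op_def
  by (subst suminf_sum) (auto intro!: sum.cong summable_mult suminf_mult assms simp: suminf_mult[OF assms])

lemma shift_op_Ints:
  fixes u :: "int \<Rightarrow> real"
  assumes "\<And>n. u n \<in> \<int>"
  shows "shift_op (map_poly of_int p) u n \<in> \<int>"
  using assms by (auto simp: shift_op_def coeff_map_poly intro!: Ints_sum Ints_mult)

lemma shift_op_of_real:
  "shift_op (map_poly of_real p) (\<lambda>n. of_real (u n)) n
     = (of_real (shift_op p u n) :: complex)"
proof -
  have "Polynomial.degree (map_poly of_real p :: complex poly) \<le> Polynomial.degree p"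
    by (simp add: degree_map_poly)
  then show ?thesis
    by (simp add: shift_op_eq_sum) (simp add: shift_op_def coeff_map_poly)
qed

lemma shift_op_tendsto_0:
  fixes u :: "int \<Rightarrow> real"
  assumes "(\<lambda>n. u (int n)) \<longlonglongrightarrow> 0"
  shows "(\<lambda>n. shift_op p u (int n)) \<longlonglongrightarrow> 0"
proof -
  have "(\<lambda>n. u (int n + int i)) \<longlonglongrightarrow> 0" for i
    using LIMSEQ_ignore_initial_segment[OF assms, of i] by simp
  then have "(\<lambda>n. coeff p i * u (int n + int i)) \<longlonglongrightarrow> 0" for i
    using tendsto_mult_right_zero by blast
  then show ?thesis
    unfolding shift_op_def by (intro tendsto_null_sum)
qed

section \<open>Summability to the right when all roots lie in the open unit disc\<close>

lemma summable_of_summable_diff_mult: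
  fixes u :: "nat \<Rightarrow> complex"
  assumes "cmod z < 1" and s: "summable (\<lambda>n. cmod (u (Suc n) - z * u n))"
  shows "summable (\<lambda>n. cmod (u n))"
proof -
  define W where "W = (\<Sum>n. cmod (u (Suc n) - z * u n))"
  have "(\<Sum>n<N. cmod (u n)) \<le> (cmod (u 0) + W) / (1 - cmod z)" for N
  proof -
    have "(\<Sum>n<N. cmod (u n)) \<le> (\<Sum>n<Suc N. cmod (u n))"
      by simp
    also have "\<dots> = cmod (u 0) + (\<Sum>n<N. cmod (u (Suc n)))"
      by (rule sum.lessThan_Suc_shift)
    also have "(\<Sum>n<N. cmod (u (Suc n)))
        \<le> (\<Sum>n<N. cmod (u (Suc n) - z * u n) + cmod z * cmod (u n))"
      by (rule sum_mono) (metis add.commute norm_mult norm_triangle_sub)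
    also have "\<dots> \<le> W + cmod z * (\<Sum>n<N. cmod (u n))"
      unfolding W_def
      by (simp add: sum.distrib sum_distrib_left sum_le_suminf s)
    \<comment> \<open>The same partial sum occurs on both sides, on the right with the factor
      \<open>cmod z < 1\<close>, so the inequality can be solved for it.\<close>
    finally have "(\<Sum>n<N. cmod (u n)) * (1 - cmod z) \<le> cmod (u 0) + W"
      by (simp add: algebra_simps)
    then show ?thesis
      using \<open>cmod z < 1\<close> by (simp add: pos_le_divide_eq)
  qed
  then show ?thesis
    by (intro bounded_imp_summable[where B = "(cmod (u 0) + W) / (1 - cmod z)"])
       (simp_all only: lessThan_Suc_atMost[symmetric] norm_ge_zero)
qed

text \<open>Roots are split off one at a time: for p = q (x - z) the induction applies to
  \<open>q\<close> and the sequence u(n + 1) - z u(n), and the first-order lemma recovers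
  \<open>u\<close>. Multiple roots need no separate treatment.\<close>

lemma summable_of_shift_op_stable:
  fixes p :: "complex poly" and u :: "int \<Rightarrow> complex"
  assumes "p \<noteq> 0" and "\<And>z. poly p z = 0 \<Longrightarrow> cmod z < 1"
    and "summable (\<lambda>n. cmod (shift_op p u (int n)))"
  shows "summable (\<lambda>n. cmod (u (int n)))"
  using assms
proof (induction "Polynomial.degree p" arbitrary: p u)
  case 0
  then obtain c where c: "p = [:c:]" "c \<noteq> 0"
    by (metis degree_eq_zeroE pCons_0_0)
  then show ?case
    using 0(4) by (simp add: norm_mult summable_cmult_iff)
next
  case (Suc d)
  then have "\<not> constant (poly p)"
    by (simp add: constant_degree)
  then obtain z where z: "poly p z = 0"
    using fundamental_theorem_of_algebra by blast
  then obtain q where q: "p = q * [:- z, 1:]"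
    by (metis dvdE mult.commute poly_eq_0_iff_dvd)
  have "q \<noteq> 0"
    using Suc.prems(1) q by auto
  then have "d = Polynomial.degree q"
    using Suc.hyps(2) unfolding q by (subst (asm) degree_mult_eq) auto
  moreover have "cmod x < 1" if "poly q x = 0" for x
    using Suc.prems(2)[of x] that by (simp add: q)
  moreover have "summable (\<lambda>n. cmod (shift_op q (shift_op [:- z, 1:] u) (int n)))"
    using Suc.prems(3) unfolding q shift_op_mult .
  ultimately have "summable (\<lambda>n. cmod (shift_op [:- z, 1:] u (int n)))"
    using Suc.hyps(1) \<open>q \<noteq> 0\<close> by blast
  then have "summable (\<lambda>n. cmod (u (int (Suc n)) - z * u (int n)))"
    by (simp add: shift_op_pCons add.commute)
  then show ?case
    using summable_of_summable_diff_mult[OF Suc.prems(2)[OF z], of "\<lambda>n. u (int n)"] by simp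
qed

section \<open>Integer-valued recurrences\<close>

lemma int_induct_bidirectional:
  fixes n :: int
  assumes "P a" and up: "\<And>i. P i \<Longrightarrow> P (i + 1)" and down: "\<And>i. P i \<Longrightarrow> P (i - 1)"
  shows "P n"
  by (rule int_induct[of P a]) (use assms in auto)

text \<open>\<open>unit_coeff\<close> lets recurrences run backwards over the integers,
  \<open>simple_root\<close> makes \<open>\<xi>\<close> meaningful and keeps \<open>\<beta>\<close>
  from being a root of \<open>h\<close>, and \<open>conjugates\<close> gives the decay of whatever
  \<open>h\<close> annihilates.\<close>

locale pisot_recurrence =
  fixes \<beta> :: real and gi :: "int poly"
  assumes beta_gt_1: "\<beta> > 1"
    and monic: "lead_coeff gi = 1"
    and unit_coeff: "coeff gi 0 \<in> {1, -1}"
    and root: "poly (map_poly of_int gi) \<beta> = 0"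
    and simple_root: "poly (pderiv (map_poly of_int gi)) \<beta> \<noteq> 0"
    and conjugates: "\<And>z::complex. poly (map_poly of_int gi) z = 0 \<Longrightarrow> z \<noteq> of_real \<beta> \<Longrightarrow> cmod z < 1"
begin

definition m :: nat where "m = Polynomial.degree gi"

definition g :: "real poly" where "g = map_poly of_int gi"

definition h :: "real poly" where "h = g div [:- \<beta>, 1:]"

text \<open>This is \<open>xi0 \<beta>\<close>: differentiating g = (x - \<beta>) h at \<beta> gives
  g'(\<beta>) = h(\<beta>). The form with \<open>h\<close> is the one that normalises the expanding
  part of a recurrent sequence.\<close>

definition \<xi> :: real where "\<xi> = 1 / poly h \<beta>"

definition recurrent :: "(int \<Rightarrow> real) \<Rightarrow> bool" where
  "recurrent u \<longleftrightarrow> (\<forall>n. shift_op g u n = 0)"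

lemma beta_pos [simp]: "\<beta> > 0" "\<beta> \<noteq> 0"
  using beta_gt_1 by auto

lemma degree_g: "Polynomial.degree g = m"
  by (simp add: g_def m_def degree_map_poly)

lemma coeff_g: "coeff g i = of_int (coeff gi i)"
  by (simp add: g_def coeff_map_poly)

lemma coeff_g_m: "coeff g m = 1"
  using monic by (simp add: coeff_g m_def)

lemma coeff_g_0_square: "coeff g 0 * coeff g 0 = 1"
  using unit_coeff by (auto simp: coeff_g)

lemma root_g: "poly g \<beta> = 0"
  using root by (simp add: g_def)

lemma g_nonzero: "g \<noteq> 0"
  using coeff_g_m by force

lemma m_pos: "m > 0"
proof (rule ccontr)
  assume "\<not> m > 0"
  then have "g = [:1:]"
    using degree_g coeff_g_m by (metis degree_eq_zeroE coeff_pCons_0 gr0I)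
  then show False
    using root_g by simp
qed

lemma g_factor: "g = [:- \<beta>, 1:] * h"
  using root_g by (simp add: h_def poly_eq_0_iff_dvd del: mult_pCons_left)

lemma poly_h: "poly h \<beta> = poly (pderiv g) \<beta>"
proof -
  have "pderiv g = [:- \<beta>, 1:] * pderiv h + h * pderiv [:- \<beta>, 1:]"
    unfolding g_factor by (rule pderiv_mult)
  then show ?thesis
    by (simp add: pderiv_pCons)
qed

lemma poly_h_nonzero: "poly h \<beta> \<noteq> 0"
  using simple_root by (simp add: poly_h g_def)

lemma h_nonzero: "h \<noteq> 0"
  using g_factor g_nonzero by auto

lemma degree_h: "Suc (Polynomial.degree h) = m"
proof -
  have "Polynomial.degree g = Polynomial.degree [:- \<beta>, 1:] + Polynomial.degree h"
    unfolding g_factor by (rule degree_mult_eq) (use h_nonzero in auto)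
  then show ?thesis
    by (simp add: degree_g)
qed

lemma coeff_h_top: "coeff h (m - 1) = 1"
proof -
  have "lead_coeff g = lead_coeff h"
    unfolding g_factor lead_coeff_mult by simp
  then show ?thesis
    using degree_g degree_h coeff_g_m by (metis diff_Suc_1)
qed

section \<open>Recurrent sequences and their windows of \<open>m\<close> consecutive values\<close>

lemma recurrent_forward:
  assumes "recurrent u"
  shows "u (n + int m) = - (\<Sum>i<m. coeff g i * u (n + int i))"
proof -
  have "(\<Sum>i\<le>m. coeff g i * u (n + int i)) = 0"
    using assms by (simp add: recurrent_def shift_op_def degree_g)
  then show ?thesis
    by (simp add: lessThan_Suc_atMost[symmetric] coeff_g_m)
qed

text \<open>The constant term of \<open>g\<close> is its own inverse, so solving for the leftmost
  entry keeps the coefficients integral.\<close>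

lemma recurrent_backward:
  assumes "recurrent u"
  shows "u n = - (coeff g 0 * (\<Sum>i<m. coeff g (Suc i) * u (n + 1 + int i)))"
proof -
  have "(\<Sum>i\<le>m. coeff g i * u (n + int i)) = 0"
    using assms by (simp add: recurrent_def shift_op_def degree_g)
  then have "coeff g 0 * u n + (\<Sum>i<m. coeff g (Suc i) * u (n + 1 + int i)) = 0"
    by (simp add: lessThan_Suc_atMost[symmetric] sum.lessThan_Suc_shift algebra_simps
        del: sum.lessThan_Suc)
  then have "coeff g 0 * (coeff g 0 * u n + (\<Sum>i<m. coeff g (Suc i) * u (n + 1 + int i))) = 0"
    by simp
  then show ?thesis
    using coeff_g_0_square by (simp add: distrib_left flip: mult.assoc)
qed

text \<open>One statement for two uses: \<int> as \<open>A\<close> propagates integrality, and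
  \<open>{0}\<close> as \<open>A\<close> gives uniqueness of the sequence with a given
  window.\<close>

lemma recurrent_window:
  assumes "recurrent u" and window: "\<And>i. i < m \<Longrightarrow> u (a + int i) \<in> A"
    and closed: "0 \<in> A" "\<And>x y. x \<in> A \<Longrightarrow> y \<in> A \<Longrightarrow> x + y \<in> A" "\<And>c x. x \<in> A \<Longrightarrow> of_int c * x \<in> A"
  shows "u n \<in> A"
proof -
  have comb: "(\<Sum>i<m. of_int (c i) * x i) \<in> A" if "\<And>i. i < m \<Longrightarrow> x i \<in> A" for c x
  proof -
    have "(\<Sum>i\<in>F. of_int (c i) * x i) \<in> A" if "finite F" "F \<subseteq> {..<m}" for F
      using that
      by (induction F rule: finite_induct) (use closed \<open>\<And>i. i < m \<Longrightarrow> x i \<in> A\<close> in auto)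
    then show ?thesis
      by blast
  qed
  have neg: "- x \<in> A" if "x \<in> A" for x
    using closed(3)[of x "-1"] that by simp
  have "\<forall>i<m. u (n + int i) \<in> A"
  proof (induction n rule: int_induct_bidirectional[where a = a])
    case 1
    then show ?case using window by simp
  next
    case (2 n)
    have "u (n + int m) \<in> A"
      unfolding recurrent_forward[OF assms(1)] coeff_g using 2 by (intro neg comb) simp
    then have "u (n + int (Suc i)) \<in> A" if "i < m" for i
      using 2[rule_format, of "Suc i"] that by (cases "Suc i = m") (auto simp del: of_nat_Suc)
    then show ?case
      by (simp add: add.assoc)
  next
    case (3 n)
    have "u (n - 1) \<in> A"
      unfolding recurrent_backward[OF assms(1), of "n - 1"] coeff_g
      using 3 by (intro neg closed(3) comb) simp
    then have "u (n - 1 + int i) \<in> A" if "i < m" for i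
      using 3 that by (cases i) auto
    then show ?case
      by simp
  qed
  then show ?thesis
    using m_pos by (metis add_0_right of_nat_0)
qed

lemma recurrent_Ints:
  assumes "recurrent u" and "\<And>i. i < m \<Longrightarrow> u (a + int i) \<in> \<int>"
  shows "u n \<in> \<int>"
  by (rule recurrent_window[OF assms]) auto

text \<open>The torus coordinates belong to the places 0, -1, ..., -(m - 1), so this is the form in
  which integrality is read off from the torus.\<close>

lemma recurrent_Ints_backward_window:
  assumes "recurrent u" and "\<And>i. i < m \<Longrightarrow> u (a - int i) \<in> \<int>"
  shows "u n \<in> \<int>"
proof (rule recurrent_Ints[OF assms(1), of "a - int (m - 1)"])
  fix i assume "i < m"
  then show "u (a - int (m - 1) + int i) \<in> \<int>"
    using assms(2)[of "m - 1 - i"] by (simp add: of_nat_diff algebra_simps)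
qed

lemma recurrent_eqI:
  assumes "recurrent u" "recurrent w" and "\<And>i. i < m \<Longrightarrow> u (a + int i) = w (a + int i)"
  shows "u n = w n"
proof -
  have "recurrent (\<lambda>n. u n - w n)"
    using assms(1,2) by (simp add: recurrent_def shift_op_minus)
  then have "u n - w n \<in> {0}"
    by (rule recurrent_window) (use assms(3) in auto)
  then show ?thesis by simp
qed

lemma recurrent_translate: "recurrent u \<Longrightarrow> recurrent (\<lambda>n. u (n + a))"
  by (simp add: recurrent_def shift_op_translate)

lemma recurrent_minus: "recurrent u \<Longrightarrow> recurrent w \<Longrightarrow> recurrent (\<lambda>n. u n - w n)"
  by (simp add: recurrent_def shift_op_minus)

lemma recurrent_plus: "recurrent u \<Longrightarrow> recurrent w \<Longrightarrow> recurrent (\<lambda>n. u n + w n)"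
  by (simp add: recurrent_def shift_op_plus)

lemma recurrent_cmult: "recurrent u \<Longrightarrow> recurrent (\<lambda>n. c * u n)"
  by (simp add: recurrent_def shift_op_cmult)

lemma recurrent_sum: "(\<And>l. l \<in> L \<Longrightarrow> recurrent (u l)) \<Longrightarrow> recurrent (\<lambda>n. \<Sum>l\<in>L. u l n)"
  by (simp add: recurrent_def shift_op_sum)

lemma recurrent_powi: "recurrent (\<lambda>n. c * \<beta> powi n)"
  using root_g by (simp add: recurrent_def shift_op_cmult shift_op_powi)

lemma recurrent_shift_op:
  assumes "recurrent u"
  shows "recurrent (shift_op p u)"
proof -
  have "shift_op g (shift_op p u) n = shift_op p (shift_op g u) n" for n
    by (simp only: shift_op_mult[symmetric] mult.commute)
  also have "\<dots> n = 0" for n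
    using assms by (simp add: recurrent_def shift_op_def)
  finally show ?thesis
    by (simp add: recurrent_def)
qed

text \<open>A companion matrix acting on windows; \<open>window_prev\<close> below inverts it, again
  because the constant term is a unit. Windows are padded with 0 from index \<open>m\<close> on, so
  that \<open>window_next_prev\<close> can be an equality of functions.\<close>

definition window_next :: "(nat \<Rightarrow> real) \<Rightarrow> nat \<Rightarrow> real" where
  "window_next w i =
     (if Suc i < m then w (Suc i) else if Suc i = m then - (\<Sum>j<m. coeff g j * w j) else 0)"

definition window_prev :: "(nat \<Rightarrow> real) \<Rightarrow> nat \<Rightarrow> real" where
  "window_prev w i =
     (if i = 0 then - (coeff g 0 * (\<Sum>j<m. coeff g (Suc j) * w j)) else if i < m then w (i - 1) else 0)"

lemma window_next_prev:
  assumes "\<And>i. i \<ge> m \<Longrightarrow> w i = 0"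
  shows "window_next (window_prev w) = w"
proof
  fix i
  obtain m' where m': "m = Suc m'"
    using m_pos gr0_implies_Suc by blast
  have "(\<Sum>j<m. coeff g j * window_prev w j)
      = coeff g 0 * window_prev w 0 + (\<Sum>j<m'. coeff g (Suc j) * w j)"
    unfolding m' by (subst sum.lessThan_Suc_shift) (auto simp: window_prev_def m' intro!: sum.cong)
  also have "coeff g 0 * window_prev w 0 = - (\<Sum>j<m. coeff g (Suc j) * w j)"
    using coeff_g_0_square by (simp add: window_prev_def flip: mult.assoc)
  also have "(\<Sum>j<m. coeff g (Suc j) * w j) = (\<Sum>j<m'. coeff g (Suc j) * w j) + w m'"
    using coeff_g_m by (simp add: m')
  finally show "window_next (window_prev w) i = w i"
    using assms[of i] by (auto simp: window_next_def m' window_prev_def)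
qed

text \<open>The prescribed window is moved right by iterating \<open>window_next\<close> and left by
  iterating \<open>window_prev\<close>; entry 0 of the window at \<open>n\<close> is the value at
  \<open>n\<close>.\<close>

lemma recurrent_exists_0: "\<exists>u. recurrent u \<and> (\<forall>i<m. u (int i) = v i)"
proof -
  define w0 where "w0 = (\<lambda>i. if i < m then v i else 0)"
  define W where "W n = (if n \<ge> 0 then (window_next ^^ nat n) w0 else (window_prev ^^ nat (- n)) w0)"
    for n :: int
  have supp: "(window_prev ^^ j) w0 i = 0" if "i \<ge> m" for i j
    using that m_pos by (cases j) (auto simp: w0_def window_prev_def)
  have W_next: "W (n + 1) = window_next (W n)" for n
  proof (cases "n \<ge> 0")
    case True
    then have "nat (n + 1) = Suc (nat n)" by simp
    with True show ?thesis by (simp add: W_def)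
  next
    case False
    then have "nat (- n) = Suc (nat (- (n + 1)))" by simp
    then have "W n = window_prev ((window_prev ^^ nat (- (n + 1))) w0)"
      using False by (simp add: W_def)
    then have "window_next (W n) = (window_prev ^^ nat (- (n + 1))) w0"
      using window_next_prev supp by simp
    with False show ?thesis
      by (cases "n = -1") (auto simp: W_def)
  qed
  define u where "u n = W n 0" for n
  have u_W: "W n i = u (n + int i)" if "i < m" for i n
    using that
  proof (induction i arbitrary: n)
    case (Suc i)
    then have "W n (Suc i) = W (n + 1) i"
      by (simp add: W_next window_next_def)
    also have "\<dots> = u (n + 1 + int i)"
      using Suc by simp
    finally show ?case
      by (simp add: add.assoc)
  qed (simp add: u_def)
  have "u (n + int m) = - (\<Sum>j<m. coeff g j * u (n + int j))" for n
  proof -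
    have "u (n + int m) = W (n + 1) (m - 1)"
      using u_W[of "m - 1" "n + 1"] m_pos by (simp add: of_nat_diff)
    also have "\<dots> = - (\<Sum>j<m. coeff g j * W n j)"
      using m_pos by (simp add: W_next window_next_def)
    finally show ?thesis
      by (simp add: u_W)
  qed
  then have "recurrent u"
    by (simp add: recurrent_def shift_op_def degree_g lessThan_Suc_atMost[symmetric] coeff_g_m)
  moreover have "u (int i) = v i" if "i < m" for i
    using u_W[OF that, of 0] that by (simp add: W_def w0_def)
  ultimately show ?thesis by blast
qed

lemma recurrent_exists: "\<exists>u. recurrent u \<and> (\<forall>i<m. u (a + int i) = v i)"
proof -
  obtain u where u: "recurrent u" "\<forall>i<m. u (int i) = v i"
    using recurrent_exists_0 by blast
  show ?thesis
    by (rule exI[of _ "\<lambda>n. u (n - a)"])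
       (use u(2) recurrent_translate[OF u(1), of "- a"] in simp)
qed

text \<open>Since (x - \<beta>) h = g, acting by \<open>h\<close> makes a recurrent sequence
  geometric with ratio \<beta>; this is its value at 0. Multiplied by \<open>\<xi>\<close> it is the
  coefficient of \<beta>^n in \<open>u\<close>.\<close>

definition expanding_coeff :: "(int \<Rightarrow> real) \<Rightarrow> real" where
  "expanding_coeff u = shift_op h u 0"

lemma shift_op_h:
  assumes "recurrent u"
  shows "shift_op h u n = expanding_coeff u * \<beta> powi n"
proof (induction n rule: int_induct_bidirectional[where a = 0])
  have step: "shift_op h u (n + 1) = \<beta> * shift_op h u n" for n
  proof -
    have "0 = shift_op [:- \<beta>, 1:] (shift_op h u) n"
      using assms unfolding recurrent_def g_factor by (simp only: shift_op_mult)
    then show ?thesis by (simp add: shift_op_pCons)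
  qed
  case (2 n)
  then show ?case by (simp add: step power_int_add)
next
  have step: "shift_op h u (n + 1) = \<beta> * shift_op h u n" for n
  proof -
    have "0 = shift_op [:- \<beta>, 1:] (shift_op h u) n"
      using assms unfolding recurrent_def g_factor by (simp only: shift_op_mult)
    then show ?thesis by (simp add: shift_op_pCons)
  qed
  case (3 n)
  then show ?case using step[of "n - 1"] by (simp add: power_int_diff field_simps)
qed (simp add: expanding_coeff_def)

lemma expanding_coeff_altdef: "expanding_coeff u = (\<Sum>i<m. coeff h i * u (int i))"
  using degree_h by (simp add: expanding_coeff_def shift_op_def lessThan_Suc_atMost[symmetric])

text \<open>A root of \<open>h\<close> is a root of \<open>g\<close>, and it is not \<beta> because
  h(\<beta>) \<noteq> 0; hence it lies in the open unit disc. The passage to complex sequences is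
  forced by splitting \<open>h\<close> into linear factors.\<close>

lemma summable_of_shift_op_h:
  assumes "\<And>n. shift_op h u n = 0"
  shows "summable (\<lambda>n. \<bar>u (int n + a)\<bar>)"
proof -
  have "summable (\<lambda>n. cmod (of_real (u (int n + a))))"
  proof (rule summable_of_shift_op_stable[of "map_poly of_real h"])
    show "map_poly of_real h \<noteq> (0 :: complex poly)"
      using h_nonzero by (metis degree_0 degree_map_poly map_poly_eq_0_iff of_real_0 of_real_eq_0_iff)
    show "cmod z < 1" if z: "poly (map_poly of_real h) z = 0" for z :: complex
    proof -
      have "map_poly of_int gi = (map_poly of_real g :: complex poly)"
        by (simp add: g_def map_poly_map_poly o_def)
      also have "\<dots> = map_poly of_real [:- \<beta>, 1:] * map_poly of_real h"
        unfolding g_factor by (rule poly_eqI) (simp add: coeff_map_poly coeff_mult del: mult_pCons_left)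
      finally have "poly (map_poly of_int gi) z = 0"
        using z by simp
      moreover have "z \<noteq> of_real \<beta>"
      proof
        assume "z = of_real \<beta>"
        then have "of_real (poly h \<beta>) = (0 :: complex)"
          using z by (simp add: poly_altdef degree_map_poly coeff_map_poly)
        then show False using poly_h_nonzero by simp
      qed
      ultimately show ?thesis by (rule conjugates)
    qed
    have "shift_op (map_poly of_real h) (\<lambda>n. of_real (u (n + a))) (int n) = (0 :: complex)" for n
      by (simp add: shift_op_of_real shift_op_translate assms)
    then show "summable (\<lambda>n. cmod (shift_op (map_poly of_real h) (\<lambda>n. of_real (u (n + a))) (int n)))"
      by simp
  qed
  then show ?thesis
    by simp
qed

text \<open>Since \<xi> h(\<beta>) = 1, acting by \<open>h\<close> gives the same result on both
  terms of the difference, so \<open>h\<close> annihilates it.\<close>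

lemma summable_contracting_part:
  assumes "recurrent u"
  shows "summable (\<lambda>n. \<bar>\<xi> * expanding_coeff u * \<beta> powi (int n + a) - u (int n + a)\<bar>)"
proof (rule summable_of_shift_op_h)
  fix n
  have "shift_op h (\<lambda>n. \<xi> * expanding_coeff u * \<beta> powi n - u n) n
      = \<xi> * expanding_coeff u * (poly h \<beta> * \<beta> powi n) - expanding_coeff u * \<beta> powi n"
    by (simp add: shift_op_minus shift_op_cmult shift_op_powi shift_op_h[OF assms])
  then show "shift_op h (\<lambda>n. \<xi> * expanding_coeff u * \<beta> powi n - u n) n = 0"
    using poly_h_nonzero by (simp add: \<xi>_def)
qed

text \<open>Acting by \<open>h\<close> on the null sequence yields a constant times \<beta>^n, which
  tends to 0 only for the constant 0.\<close>

lemma eq_expanding_coeff: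
  assumes "recurrent u" and lim: "(\<lambda>n. \<eta> * \<beta> powi int n - u (int n)) \<longlonglongrightarrow> 0"
  shows "\<eta> = \<xi> * expanding_coeff u"
proof -
  have *: "shift_op h (\<lambda>n. \<eta> * \<beta> powi n - u n) n = (\<eta> * poly h \<beta> - expanding_coeff u) * \<beta> powi n" for n
    by (simp add: shift_op_minus shift_op_cmult shift_op_powi shift_op_h[OF assms(1)] algebra_simps)
  have "(\<lambda>n. (\<eta> * poly h \<beta> - expanding_coeff u) * \<beta> powi int n) \<longlonglongrightarrow> 0"
    using shift_op_tendsto_0[OF lim, of h] by (simp add: *)
  then have "(\<lambda>n. (\<eta> * poly h \<beta> - expanding_coeff u) * \<beta> ^ n * inverse \<beta> ^ n) \<longlonglongrightarrow> 0 * 0"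
    using beta_gt_1 by (intro tendsto_mult LIMSEQ_power_zero) (auto simp: inverse_less_1_iff)
  moreover have "(\<eta> * poly h \<beta> - expanding_coeff u) * \<beta> ^ n * inverse \<beta> ^ n
      = \<eta> * poly h \<beta> - expanding_coeff u" for n
    by (simp add: power_inverse)
  ultimately have "\<eta> * poly h \<beta> - expanding_coeff u = 0"
    by (simp add: LIMSEQ_const_iff)
  then show ?thesis
    using poly_h_nonzero by (simp add: \<xi>_def field_simps)
qed

end

section \<open>The ring generated by the base and its Pisot set\<close>

lemma dist_nearest_int_le: "dist_nearest_int x \<le> \<bar>x - of_int k\<bar>"
  unfolding dist_nearest_int_def using round_diff_minimal[of x k] by (simp add: abs_minus_commute)

lemma dist_nearest_int_nonneg [simp]: "dist_nearest_int x \<ge> 0"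
  by (simp add: dist_nearest_int_def)

lemma dist_nearest_int_triangle:
  "dist_nearest_int (x + y) \<le> dist_nearest_int x + dist_nearest_int y"
proof -
  have "dist_nearest_int (x + y) \<le> \<bar>(x + y) - of_int (round x + round y)\<bar>"
    by (rule dist_nearest_int_le)
  also have "\<dots> \<le> \<bar>x - of_int (round x)\<bar> + \<bar>y - of_int (round y)\<bar>"
    by simp
  finally show ?thesis
    by (simp add: dist_nearest_int_def)
qed

lemma dist_nearest_int_minus [simp]: "dist_nearest_int (- x) = dist_nearest_int x"
proof -
  have "dist_nearest_int (- x) \<le> dist_nearest_int x" for x
    using dist_nearest_int_le[of "- x" "- round x"] by (simp add: dist_nearest_int_def)
  from this[of x] this[of "- x"] show ?thesis by simp
qed

lemma dist_nearest_int_eq_0_iff: "dist_nearest_int x = 0 \<longleftrightarrow> x \<in> \<int>"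
proof
  assume "dist_nearest_int x = 0"
  then show "x \<in> \<int>"
    unfolding dist_nearest_int_def by (metis Ints_of_int abs_eq_0 eq_iff_diff_eq_0)
next
  assume "x \<in> \<int>"
  then obtain k where "x = of_int k" by (auto elim: Ints_cases)
  then show "dist_nearest_int x = 0"
    by (simp add: dist_nearest_int_def)
qed

lemma dist_nearest_int_tendsto_0I:
  assumes "(\<lambda>n. f n - a n) \<longlonglongrightarrow> 0" and "\<And>n. a n \<in> \<int>"
  shows "(\<lambda>n. dist_nearest_int (f n)) \<longlonglongrightarrow> 0"
proof (rule tendsto_sandwich[OF _ _ tendsto_const])
  show "\<forall>\<^sub>F n in sequentially. 0 \<le> dist_nearest_int (f n)"
    by simp
  show "(\<lambda>n. \<bar>f n - a n\<bar>) \<longlonglongrightarrow> 0"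
    using assms(1) by (rule tendsto_rabs_zero)
  have "dist_nearest_int (f n) \<le> \<bar>f n - a n\<bar>" for n
    using assms(2)[of n] dist_nearest_int_le by (auto elim!: Ints_cases)
  then show "\<forall>\<^sub>F n in sequentially. dist_nearest_int (f n) \<le> \<bar>f n - a n\<bar>"
    by simp
qed

section \<open>Arithmetic in the ring generated by one number\<close>

lemma int_ring_ext_add: "x \<in> int_ring_ext b \<Longrightarrow> y \<in> int_ring_ext b \<Longrightarrow> x + y \<in> int_ring_ext b"
  unfolding int_ring_ext_def
proof (elim rangeE)
  fix p q :: "int poly"
  assume "x = poly (map_poly of_int p) b" "y = poly (map_poly of_int q) b"
  moreover have "map_poly of_int (p + q) = (map_poly of_int p + map_poly of_int q :: real poly)"
    by (rule poly_eqI) (simp add: coeff_map_poly)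
  ultimately have "x + y = poly (map_poly of_int (p + q)) b" by simp
  then show "x + y \<in> range (\<lambda>p. poly (map_poly of_int p) b)" by blast
qed

lemma int_ring_ext_mult: "x \<in> int_ring_ext b \<Longrightarrow> y \<in> int_ring_ext b \<Longrightarrow> x * y \<in> int_ring_ext b"
  unfolding int_ring_ext_def
proof (elim rangeE)
  fix p q :: "int poly"
  assume "x = poly (map_poly of_int p) b" "y = poly (map_poly of_int q) b"
  moreover have "map_poly of_int (p * q) = (map_poly of_int p * map_poly of_int q :: real poly)"
    by (rule poly_eqI) (simp add: coeff_map_poly coeff_mult)
  ultimately have "x * y = poly (map_poly of_int (p * q)) b" by simp
  then show "x * y \<in> range (\<lambda>p. poly (map_poly of_int p) b)" by blast
qed

lemma int_ring_ext_of_int: "of_int k \<in> int_ring_ext b"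
proof -
  have "of_int k = poly (map_poly of_int [:k:]) b" by (simp add: map_poly_pCons)
  then show ?thesis unfolding int_ring_ext_def by blast
qed

lemma int_ring_ext_of_nat: "of_nat k \<in> int_ring_ext b"
  using int_ring_ext_of_int[of "int k"] by simp

lemma int_ring_ext_gen: "b \<in> int_ring_ext b"
proof -
  have "b = poly (map_poly of_int [:0, 1:]) b" by (simp add: map_poly_pCons)
  then show ?thesis unfolding int_ring_ext_def by blast
qed

lemma int_ring_ext_0: "0 \<in> int_ring_ext b"
  using int_ring_ext_of_int[of 0] by simp

lemma int_ring_ext_uminus: "x \<in> int_ring_ext b \<Longrightarrow> - x \<in> int_ring_ext b"
  using int_ring_ext_mult[OF int_ring_ext_of_int[of "-1"]] by simp

lemma int_ring_ext_diff: "x \<in> int_ring_ext b \<Longrightarrow> y \<in> int_ring_ext b \<Longrightarrow> x - y \<in> int_ring_ext b"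
  using int_ring_ext_add[OF _ int_ring_ext_uminus] by fastforce

lemma int_ring_ext_sum: "(\<And>i. i \<in> I \<Longrightarrow> f i \<in> int_ring_ext b) \<Longrightarrow> sum f I \<in> int_ring_ext b"
  by (induction I rule: infinite_finite_induct) (auto intro: int_ring_ext_add int_ring_ext_0)

lemma int_ring_ext_power: "x \<in> int_ring_ext b \<Longrightarrow> x ^ n \<in> int_ring_ext b"
  by (induction n) (use int_ring_ext_of_int[of 1] in \<open>auto intro: int_ring_ext_mult\<close>)

context pisot_recurrence
begin

text \<open>For gi = c + x q the root gives \<beta> q(\<beta>) = -c, and c is 1 or -1.\<close>

lemma inverse_beta_in_int_ring_ext: "inverse \<beta> \<in> int_ring_ext \<beta>"
proof -
  obtain c q where gi: "gi = pCons c q"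
    using pCons_cases by blast
  have "of_int c + \<beta> * poly (map_poly of_int q) \<beta> = 0"
    using root by (simp add: gi map_poly_pCons)
  then have "\<beta> * poly (map_poly of_int q) \<beta> = - of_int c"
    by simp
  then have "\<beta> * (of_int (- c) * poly (map_poly of_int q) \<beta>) = 1"
    using unit_coeff by (auto simp: gi)
  then have "inverse \<beta> = of_int (- c) * poly (map_poly of_int q) \<beta>"
    by (rule inverse_unique)
  moreover have "poly (map_poly of_int q) \<beta> \<in> int_ring_ext \<beta>"
    unfolding int_ring_ext_def by blast
  ultimately show ?thesis
    by (simp add: int_ring_ext_mult int_ring_ext_of_int del: of_int_minus)
qed

lemma powi_in_int_ring_ext: "\<beta> powi n \<in> int_ring_ext \<beta>"
  using int_ring_ext_power int_ring_ext_gen inverse_beta_in_int_ring_ext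
  by (simp add: power_int_def)

text \<open>Synthetic division: from the top down, each coefficient of \<open>h\<close> is an
  integer plus \<beta> times the next higher one.\<close>

lemma coeff_h_in_int_ring_ext: "coeff h i \<in> int_ring_ext \<beta>"
proof -
  have "i \<le> m \<Longrightarrow> coeff h i \<in> int_ring_ext \<beta>"
  proof (induction rule: inc_induct)
    case base
    then show ?case using degree_h by (simp add: coeff_eq_0 int_ring_ext_0)
  next
    case (step i)
    have "coeff g (Suc i) = coeff h i - \<beta> * coeff h (Suc i)"
      by (subst g_factor) simp
    then have "coeff h i = of_int (coeff gi (Suc i)) + \<beta> * coeff h (Suc i)"
      by (simp add: coeff_g)
    then show ?case
      using step.IH by (simp add: int_ring_ext_add int_ring_ext_mult int_ring_ext_gen int_ring_ext_of_int)
  qed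
  moreover have "coeff h i = 0" if "i \<ge> m"
    using degree_h that by (simp add: coeff_eq_0)
  ultimately show ?thesis
    using int_ring_ext_0 by (cases "i \<le> m") auto
qed

text \<open>
  \<open>a n\<close> plays the role of the trace of \<open>\<eta> \<beta>^n\<close>; the difference is a combination of powers of the
  conjugates inside the unit disc.
\<close>

definition integer_approx :: "real \<Rightarrow> (int \<Rightarrow> real) \<Rightarrow> bool" where
  "integer_approx \<eta> a \<longleftrightarrow> recurrent a \<and> (\<forall>n. a n \<in> \<int>) \<and>
     (\<lambda>n. \<eta> * \<beta> powi int n - a (int n)) \<longlonglongrightarrow> 0"

text \<open>Convergence to 0 already identifies \<open>\<eta>\<close> as \<open>\<xi>\<close> times
  the expanding coefficient of \<open>a\<close>; the difference is then the contracting part, which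
  decays summably.\<close>

lemma integer_approx_summable:
  assumes "integer_approx \<eta> a"
  shows "summable (\<lambda>n. \<bar>\<eta> * \<beta> powi (int n + b) - a (int n + b)\<bar>)"
proof -
  have "recurrent a" "\<eta> = \<xi> * expanding_coeff a"
    using assms eq_expanding_coeff by (auto simp: integer_approx_def)
  then show ?thesis
    using summable_contracting_part by simp
qed

lemma integer_approx_plus:
  assumes "integer_approx \<eta> a" "integer_approx \<eta>' a'"
  shows "integer_approx (\<eta> + \<eta>') (\<lambda>n. a n + a' n)"
proof -
  have "(\<lambda>n. (\<eta> * \<beta> powi int n - a (int n)) + (\<eta>' * \<beta> powi int n - a' (int n))) \<longlonglongrightarrow> 0 + 0"
    using assms unfolding integer_approx_def by (intro tendsto_add) auto
  then have "(\<lambda>n. (\<eta> + \<eta>') * \<beta> powi int n - (a (int n) + a' (int n))) \<longlonglongrightarrow> 0"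
    by (simp add: algebra_simps)
  then show ?thesis
    using assms by (simp add: integer_approx_def recurrent_plus)
qed

lemma integer_approx_shift_op:
  assumes "integer_approx \<eta> a"
  shows "integer_approx (poly (map_poly of_int p) \<beta> * \<eta>) (shift_op (map_poly of_int p) a)"
proof -
  let ?p = "map_poly of_int p :: real poly"
  have "(\<lambda>n. shift_op ?p (\<lambda>n. \<eta> * \<beta> powi n - a n) (int n)) \<longlonglongrightarrow> 0"
    using assms by (intro shift_op_tendsto_0) (simp add: integer_approx_def)
  then have "(\<lambda>n. poly ?p \<beta> * \<eta> * \<beta> powi int n - shift_op ?p a (int n)) \<longlonglongrightarrow> 0"
    by (simp add: shift_op_minus shift_op_cmult shift_op_powi mult_ac)
  then show ?thesis
    using assms by (auto simp: integer_approx_def intro: recurrent_shift_op shift_op_Ints)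
qed

section \<open>Basic recurrent sequences with integer values\<close>

definition R :: "nat \<Rightarrow> int \<Rightarrow> real" where
  "R l = (SOME u. recurrent u \<and> (\<forall>i<m. u (int i) = (if i = l then 1 else 0)))"

lemma R_props: "recurrent (R l)" "i < m \<Longrightarrow> R l (int i) = (if i = l then 1 else 0)"
proof -
  have "\<exists>u. recurrent u \<and> (\<forall>i<m. u (int i) = (if i = l then 1 else 0))"
    using recurrent_exists[of 0] by simp
  from someI_ex[OF this] show "recurrent (R l)" "i < m \<Longrightarrow> R l (int i) = (if i = l then 1 else 0)"
    by (auto simp: R_def)
qed

lemma expanding_coeff_R: "l < m \<Longrightarrow> expanding_coeff (R l) = coeff h l"
proof -
  assume "l < m"
  have "expanding_coeff (R l) = (\<Sum>i<m. if i = l then coeff h i else 0)"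
    unfolding expanding_coeff_altdef by (rule sum.cong) (auto simp: R_props)
  with \<open>l < m\<close> show ?thesis by simp
qed

text \<open>
  \<open>H n\<close> is the trace of \<open>\<beta>^n / g'(\<beta>)\<close>: by Euler's formula this trace is \<open>0\<close> for \<open>0 \<le> n < m - 1\<close> and
  \<open>1\<close> for \<open>n = m - 1\<close>.
\<close>

definition H :: "int \<Rightarrow> real" where
  "H = R (m - 1)"

lemma integer_approx_H: "integer_approx \<xi> H"
proof -
  have rec: "recurrent H"
    by (simp only: H_def R_props)
  have "H n \<in> \<int>" for n
    by (rule recurrent_Ints[OF rec, of 0]) (auto simp: H_def R_props)
  moreover have "expanding_coeff H = 1"
    unfolding H_def using expanding_coeff_R[of "m - 1"] m_pos coeff_h_top by simp
  then have "(\<lambda>n. \<xi> * \<beta> powi int n - H (int n)) \<longlonglongrightarrow> 0"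
    using summable_contracting_part[OF rec, of 0]
    by (auto dest!: summable_LIMSEQ_zero simp: tendsto_rabs_zero_iff)
  ultimately show ?thesis
    using rec by (simp add: integer_approx_def)
qed

text \<open>Plays the role of the trace of \<beta>^n: acting by g' through the shift multiplies
  \<beta>^n / g'(\<beta>) by g'(\<beta>).\<close>

definition A :: "int \<Rightarrow> real" where
  "A = shift_op (pderiv g) H"

lemma pderiv_g: "pderiv g = map_poly of_int (pderiv gi)"
  by (rule poly_eqI) (simp add: coeff_pderiv coeff_map_poly g_def)

lemma pderiv_g_\<xi>: "poly (pderiv g) \<beta> * \<xi> = 1"
  using poly_h_nonzero by (simp add: \<xi>_def poly_h)

lemma integer_approx_A: "integer_approx 1 A"
  using integer_approx_shift_op[OF integer_approx_H, of "pderiv gi"]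
  by (simp add: A_def pderiv_g_\<xi> flip: pderiv_g)

text \<open>The expanding coefficient of an integer-valued sequence is an integer combination of
  coefficients of \<open>h\<close>, all of which lie in \<int>[\<beta>].\<close>

lemma integer_approx_imp_\<xi>_mult:
  assumes "integer_approx \<eta> a"
  shows "\<exists>z\<in>int_ring_ext \<beta>. \<eta> = \<xi> * z"
proof
  show "\<eta> = \<xi> * expanding_coeff a"
    using assms eq_expanding_coeff by (auto simp: integer_approx_def)
  have "a (int i) \<in> int_ring_ext \<beta>" for i
    using assms int_ring_ext_of_int unfolding integer_approx_def by (metis Ints_cases)
  then show "expanding_coeff a \<in> int_ring_ext \<beta>"
    unfolding expanding_coeff_altdef
    by (intro int_ring_ext_sum int_ring_ext_mult coeff_h_in_int_ring_ext)
qed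

text \<open>Each admissible \<open>\<eta>\<close> is a fixed linear form in the \<open>m\<close>
  integers a(0), ..., a(m - 1), and boundedness leaves finitely many choices for these. The
  periodicity results below rest on this.\<close>

lemma finite_bounded_integer_approx:
  "finite {\<eta>. \<exists>a. integer_approx \<eta> a \<and> (\<forall>i<m. \<bar>a (int i)\<bar> \<le> K)}" (is "finite ?S")
proof -
  define V where "V = real_of_int ` {k. \<bar>k\<bar> \<le> \<lfloor>K\<rfloor>}"
  have "finite {k :: int. \<bar>k\<bar> \<le> \<lfloor>K\<rfloor>}"
    by (rule finite_subset[of _ "{- \<lfloor>K\<rfloor>..\<lfloor>K\<rfloor>}"]) auto
  then have fin: "finite V" by (simp add: V_def)
  have "?S \<subseteq> (\<lambda>w. \<xi> * (\<Sum>i<m. coeff h i * w i)) ` (PiE {..<m} (\<lambda>_. V))"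
  proof
    fix \<eta> assume "\<eta> \<in> ?S"
    then obtain a where a: "integer_approx \<eta> a" "\<And>i. i < m \<Longrightarrow> \<bar>a (int i)\<bar> \<le> K"
      by blast
    define w where "w = restrict (\<lambda>i. a (int i)) {..<m}"
    have "a (int i) \<in> V" if "i < m" for i
    proof -
      obtain k where k: "a (int i) = of_int k"
        using a(1) by (metis Ints_cases integer_approx_def)
      then have "\<bar>k\<bar> \<le> \<lfloor>K\<rfloor>"
        using a(2)[OF that] by (simp add: le_floor_iff)
      then show ?thesis by (simp add: V_def k)
    qed
    then have "w \<in> PiE {..<m} (\<lambda>_. V)"
      by (auto simp: w_def)
    moreover have "\<eta> = \<xi> * (\<Sum>i<m. coeff h i * w i)"
      using a(1) eq_expanding_coeff by (auto simp: integer_approx_def expanding_coeff_altdef w_def)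
    ultimately show "\<eta> \<in> (\<lambda>w. \<xi> * (\<Sum>i<m. coeff h i * w i)) ` (PiE {..<m} (\<lambda>_. V))"
      by blast
  qed
  then show ?thesis
    by (rule finite_subset) (auto intro!: finite_PiE fin)
qed

lemma Ints_tendsto_0_imp_eventually_0:
  fixes x :: "nat \<Rightarrow> real"
  assumes "\<And>n. x n \<in> \<int>" "x \<longlonglongrightarrow> 0"
  shows "\<forall>\<^sub>F n in sequentially. x n = 0"
proof -
  have "\<forall>\<^sub>F n in sequentially. \<bar>x n\<bar> < 1"
    using tendstoD[OF assms(2), of 1] by simp
  then show ?thesis
    by eventually_elim (use Ints_eq_abs_less1[OF assms(1) Ints_0] in simp)
qed

text \<open>Pisot's argument: \<open>g\<close> annihilates \<beta>^n, so the nearest integers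
  \<open>r\<close> satisfy the recurrence up to a null sequence. This defect is integral and hence
  vanishes from some place on.\<close>

lemma pisot_set_iff: "\<eta> \<in> pisot_set \<beta> \<longleftrightarrow> (\<exists>a. integer_approx \<eta> a)"
proof
  assume "\<exists>a. integer_approx \<eta> a"
  then show "\<eta> \<in> pisot_set \<beta>"
    unfolding pisot_set_def integer_approx_def
    by (auto intro!: dist_nearest_int_tendsto_0I[where f = "\<lambda>n. \<eta> * \<beta> ^ n"])
next
  assume "\<eta> \<in> pisot_set \<beta>"
  define r where "r n = real_of_int (round (\<eta> * \<beta> powi n))" for n :: int
  have lim: "(\<lambda>n. \<eta> * \<beta> powi int n - r (int n)) \<longlonglongrightarrow> 0"
    using \<open>\<eta> \<in> pisot_set \<beta>\<close>
    by (simp add: pisot_set_def r_def dist_nearest_int_def tendsto_rabs_zero_iff)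
  have "(\<lambda>n. shift_op g (\<lambda>n. \<eta> * \<beta> powi n - r n) (int n)) \<longlonglongrightarrow> 0"
    by (rule shift_op_tendsto_0[OF lim])
  then have "(\<lambda>n. - shift_op g r (int n)) \<longlonglongrightarrow> 0"
    by (simp add: shift_op_minus shift_op_cmult shift_op_powi root_g)
  from tendsto_minus[OF this] have "(\<lambda>n. shift_op g r (int n)) \<longlonglongrightarrow> 0"
    by simp
  then have "\<forall>\<^sub>F n in sequentially. shift_op g r (int n) = 0"
    by (intro Ints_tendsto_0_imp_eventually_0) (auto simp: g_def r_def intro: shift_op_Ints)
  then obtain N where N: "\<And>n. n \<ge> N \<Longrightarrow> shift_op g r (int n) = 0"
    by (auto simp: eventually_sequentially)
  \<comment> \<open>The recurrence is known for \<open>r\<close> from \<open>N\<close> on;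
    \<open>u\<close> continues the window of \<open>r\<close> at \<open>N\<close> to all of \<int>,
    as \<open>integer_approx\<close> demands.\<close>
  obtain u where u: "recurrent u" "\<And>i. i < m \<Longrightarrow> u (int N + int i) = r (int N + int i)"
    using recurrent_exists[of "int N" "\<lambda>i. r (int N + int i)"] by blast
  have u_r: "u (int N + int j) = r (int N + int j)" for j
  proof (induction j rule: less_induct)
    case (less j)
    show ?case
    proof (cases "j < m")
      case False
      then obtain j' where j': "j = j' + m"
        by (metis add.commute le_Suc_ex not_less)
      have "(\<Sum>i\<le>m. coeff g i * r (int (N + j') + int i)) = 0"
        using N[of "N + j'"] by (simp add: shift_op_def degree_g del: of_nat_add)
      then have "r (int (N + j') + int m) = - (\<Sum>i<m. coeff g i * r (int (N + j') + int i))"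
        by (simp add: lessThan_Suc_atMost[symmetric] coeff_g_m)
      also have "\<dots> = - (\<Sum>i<m. coeff g i * u (int (N + j') + int i))"
      proof -
        have "r (int (N + j') + int i) = u (int (N + j') + int i)" if "i < m" for i
          using less[of "j' + i"] that by (simp add: j' add.assoc)
        then show ?thesis by simp
      qed
      also have "\<dots> = u (int (N + j') + int m)"
        by (rule recurrent_forward[OF u(1), symmetric])
      finally show ?thesis
        by (simp add: j' add.assoc)
    qed (use u in simp)
  qed
  have "(\<lambda>n. \<eta> * \<beta> powi int (n + N) - u (int (n + N))) \<longlonglongrightarrow> 0"
    using LIMSEQ_ignore_initial_segment[OF lim, of N] u_r by (simp add: add.commute)
  then have "(\<lambda>n. \<eta> * \<beta> powi int n - u (int n)) \<longlonglongrightarrow> 0"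
    by (rule LIMSEQ_offset)
  moreover have "u n \<in> \<int>" for n
    by (rule recurrent_Ints[OF u(1), of "int N"]) (simp add: u(2) r_def)
  ultimately show "\<exists>a. integer_approx \<eta> a"
    using u(1) by (auto simp: integer_approx_def)
qed

lemma pisot_set_mult:
  assumes "x \<in> pisot_set \<beta>" "z \<in> int_ring_ext \<beta>"
  shows "z * x \<in> pisot_set \<beta>"
proof -
  obtain p where p: "z = poly (map_poly of_int p) \<beta>"
    using assms(2) unfolding int_ring_ext_def by blast
  show ?thesis
    using assms(1) integer_approx_shift_op unfolding pisot_set_iff p by blast
qed

lemma \<xi>_in_pisot_set: "\<xi> \<in> pisot_set \<beta>" and one_in_pisot_set: "1 \<in> pisot_set \<beta>"
  using integer_approx_H integer_approx_A by (auto simp: pisot_set_iff)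

lemma pisot_set_add: "x \<in> pisot_set \<beta> \<Longrightarrow> y \<in> pisot_set \<beta> \<Longrightarrow> x + y \<in> pisot_set \<beta>"
  unfolding pisot_set_iff using integer_approx_plus by blast

end

section \<open>Greedy expansions as orbits of remainders\<close>

text \<open>
  \<open>v n\<close> is the remainder \<open>\<Sum>i. \<epsilon> (n + i) \<beta>^-(i+1)\<close>; membership in the compactum amounts to all remainders
  lying in \<open>[0,1)\<close>.
\<close>

definition remainders :: "real \<Rightarrow> (int \<Rightarrow> nat) \<Rightarrow> (int \<Rightarrow> real) \<Rightarrow> bool" where
  "remainders b \<epsilon> v \<longleftrightarrow> (\<forall>n. 0 \<le> v n \<and> v n < 1 \<and> b * v n = real (\<epsilon> n) + v (n + 1))"

definition tail_value :: "real \<Rightarrow> (int \<Rightarrow> nat) \<Rightarrow> int \<Rightarrow> real" where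
  "tail_value b \<epsilon> n = (\<Sum>i. real (\<epsilon> (n + int i)) * inverse b ^ Suc i)"

lemma recursion_unfold:
  fixes v :: "int \<Rightarrow> real"
  assumes "b > 1" and "\<And>n. b * v n = real (\<epsilon> n) + v (n + 1)"
  shows "v n = (\<Sum>i<j. real (\<epsilon> (n + int i)) * inverse b ^ Suc i) + inverse b ^ j * v (n + int j)"
proof (induction j)
  case (Suc j)
  have "v (n + int j) = inverse b * (real (\<epsilon> (n + int j)) + v (n + int j + 1))"
    using assms by (simp add: field_simps)
  then show ?case
    by (subst Suc) (simp add: algebra_simps)
qed simp

lemma recursion_sums:
  fixes v :: "int \<Rightarrow> real"
  assumes "b > 1" and "\<And>n. b * v n = real (\<epsilon> n) + v (n + 1)" and "\<And>n. \<bar>v n\<bar> \<le> K"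
  shows "(\<lambda>i. real (\<epsilon> (n + int i)) * inverse b ^ Suc i) sums v n"
proof -
  have "(\<lambda>j. inverse b ^ j * v (n + int j)) \<longlonglongrightarrow> 0"
  proof (rule tendsto_0_le)
    show "\<forall>\<^sub>F j in sequentially. norm (inverse b ^ j * v (n + int j)) \<le> norm (inverse b ^ j) * K"
      using assms(1,3) by (auto simp: abs_mult intro!: mult_left_mono)
    show "(\<lambda>j. inverse b ^ j) \<longlonglongrightarrow> 0"
      using assms(1) by (intro LIMSEQ_power_zero) (auto simp: inverse_less_1_iff)
  qed
  from tendsto_diff[OF tendsto_const[of "v n"] this]
  have "(\<lambda>j. v n - inverse b ^ j * v (n + int j)) \<longlonglongrightarrow> v n"
    by simp
  moreover have "v n - inverse b ^ j * v (n + int j)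
      = (\<Sum>i<j. real (\<epsilon> (n + int i)) * inverse b ^ Suc i)" for j
    using recursion_unfold[of b v \<epsilon> n j] assms(1,2) by simp
  ultimately show ?thesis
    by (simp add: sums_def)
qed

lemma remainders_tail_value:
  assumes "b > 1" "remainders b \<epsilon> v"
  shows "v n = tail_value b \<epsilon> n"
proof -
  have "(\<lambda>i. real (\<epsilon> (n + int i)) * inverse b ^ Suc i) sums v n"
    by (rule recursion_sums[where K = 1]) (use assms in \<open>auto simp: remainders_def less_imp_le\<close>)
  then show ?thesis
    by (simp add: tail_value_def sums_iff)
qed

lemma remainders_frac_floor:
  assumes "remainders b \<epsilon> v"
  shows "frac (b * v n) = v (n + 1)" "nat \<lfloor>b * v n\<rfloor> = \<epsilon> n"
proof -
  have *: "b * v n = of_int (int (\<epsilon> n)) + v (n + 1)" "0 \<le> v (n + 1)" "v (n + 1) < 1"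
    using assms by (auto simp: remainders_def)
  then have "\<lfloor>b * v n\<rfloor> = int (\<epsilon> n)"
    by (intro floor_unique) auto
  then show "frac (b * v n) = v (n + 1)" "nat \<lfloor>b * v n\<rfloor> = \<epsilon> n"
    using *(1) by (simp_all add: frac_def)
qed

lemma beta_digit_remainder:
  assumes "remainders b \<epsilon> v"
  shows "beta_digit b (v n) i = \<epsilon> (n + int i)"
proof -
  have "((\<lambda>y. frac (b * y)) ^^ i) (v n) = v (n + int i)"
    by (induction i) (simp_all add: remainders_frac_floor[OF assms] algebra_simps)
  then show ?thesis
    by (simp add: beta_digit_def remainders_frac_floor[OF assms])
qed

text \<open>The place \<open>n0\<close> is the first one that can carry a nonzero digit; the
  remainder there is \<open>x\<close> scaled into [0,1). Further left all digits are 0, and each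
  step to the left divides the remainder by \<open>b\<close>.\<close>

lemma beta_expansion_remainders:
  assumes "b > 1" "x \<ge> 0"
  shows "\<exists>v n0. remainders b (beta_expansion b x) v \<and> v n0 = b powi (n0 - 1) * x \<and>
    (\<forall>n<n0. beta_expansion b x n = 0) \<and> (x < 1 \<longrightarrow> n0 = 1)"
proof -
  define j where "j = (LEAST j. x < b ^ j)"
  have "\<exists>j. x < b ^ j"
    using real_arch_pow assms(1) by blast
  then have j: "x < b ^ j"
    unfolding j_def by (rule LeastI_ex)
  define y where "y = x / b ^ j"
  have y: "0 \<le> y" "y < 1"
    using j assms by (auto simp: y_def)
  define t where "t i = ((\<lambda>y. frac (b * y)) ^^ i) y" for i
  have t: "t 0 = y" "t (Suc i) = frac (b * t i)" for i
    by (simp_all add: t_def)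
  have t_range: "0 \<le> t i \<and> t i < 1" for i
    using y by (cases i) (auto simp: t frac_lt_1)
  define v where "v n = (if n + int j \<ge> 1 then t (nat (n + int j - 1)) else b powi (n + int j - 1) * y)" for n
  have digit: "beta_expansion b x n = (if n + int j \<ge> 1 then nat \<lfloor>b * t (nat (n + int j - 1))\<rfloor> else 0)" for n
    by (simp add: beta_expansion_def beta_digit_def t_def y_def flip: j_def)
  have "0 \<le> v n \<and> v n < 1 \<and> b * v n = real (beta_expansion b x n) + v (n + 1)" for n
  proof (cases "n + int j \<ge> 1")
    case True
    then have "nat (n + 1 + int j - 1) = Suc (nat (n + int j - 1))" by simp
    moreover have "\<lfloor>b * t i\<rfloor> \<ge> 0" for i
      using t_range assms(1) by simp
    ultimately show ?thesis
      using True t_range by (simp add: v_def digit t frac_def)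
  next
    case False
    have "v n = b powi (n + int j - 1) * y" using False by (simp add: v_def)
    moreover have "v (n + 1) = b powi (n + int j) * y"
      using False by (cases "n + int j = 0") (auto simp: v_def t)
    moreover have "b * b powi (n + int j - 1) = b powi (n + int j)"
      using assms(1) by (simp add: power_int_diff)
    moreover have "b powi (n + int j - 1) \<le> 1"
      using False assms(1) power_int_increasing[of "n + int j - 1" 0 b] by simp
    ultimately show ?thesis
      using False y assms(1) digit[of n] mult_left_le_one_le[of y "b powi (n + int j - 1)"]
      by (auto simp flip: mult.assoc)
  qed
  then have "remainders b (beta_expansion b x) v"
    by (simp add: remainders_def)
  moreover have "v (1 - int j) = b powi (1 - int j - 1) * x"
    by (simp add: v_def t y_def power_int_minus divide_inverse)
  moreover have "\<forall>n<1 - int j. beta_expansion b x n = 0"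
    by (simp add: digit)
  moreover have "1 - int j = 1" if "x < 1"
    using that by (simp add: j_def)
  ultimately show ?thesis by blast
qed

lemma beta_expansion_eq_remainder_digits:
  assumes "b > 1" "remainders b \<epsilon> v" "n \<ge> 1"
  shows "beta_expansion b (v 1) n = \<epsilon> n"
proof -
  have "v 1 < 1"
    using assms(2) by (simp add: remainders_def)
  then have "(LEAST j. v 1 < b ^ j) = 0"
    by simp
  then show ?thesis
    using beta_digit_remainder[OF assms(2), of 1 "nat (n - 1)"] assms(3)
    by (simp add: beta_expansion_def)
qed

text \<open>The quasi-greedy remainders of \<open>1\<close>, which lie in \<open>(0,1]\<close> instead of \<open>[0,1)\<close>.\<close>

lemma unit_expansion_remainders:
  assumes "b > 1" and fin: "finite_expansion b 1"
  shows "\<exists>q :: nat \<Rightarrow> real. q 0 = 1 \<and>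
    (\<forall>i. 0 < q i \<and> q i \<le> 1 \<and> b * q i = real (unit_expansion b i) + q (Suc i))"
proof -
  define t where "t i = ((\<lambda>y. frac (b * y)) ^^ i) 1" for i
  have t: "t 0 = 1" "t (Suc i) = frac (b * t i)" for i
    by (simp_all add: t_def)
  have t_range: "0 \<le> t i \<and> t i \<le> 1" "0 \<le> t (Suc i) \<and> t (Suc i) < 1" for i
    by (cases i; simp add: t frac_lt_1 less_imp_le)+
  have digit: "beta_digit b 1 i = nat \<lfloor>b * t i\<rfloor>" for i
    by (simp add: beta_digit_def t_def)
  have split: "b * t i = real (beta_digit b 1 i) + t (Suc i)" for i
    using t_range(1)[of i] assms(1) by (simp add: digit t frac_def)
  define k1 where "k1 = Max {j. beta_digit b 1 j \<noteq> 0}"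
  have "beta_digit b 1 0 \<noteq> 0"
    using assms(1) by (simp add: digit t)
  then have k1: "beta_digit b 1 k1 \<noteq> 0"
    using Max_in[of "{j. beta_digit b 1 j \<noteq> 0}"] fin unfolding k1_def finite_expansion_def by blast
  have beyond: "beta_digit b 1 i = 0" if "i > k1" for i
    using Max_ge[of "{j. beta_digit b 1 j \<noteq> 0}" i] fin that unfolding k1_def finite_expansion_def by fastforce
  \<comment> \<open>Beyond the last nonzero digit each step multiplies the remainder by
    \<open>b\<close>, so a positive one would eventually exceed 1.\<close>
  have "t (Suc k1) = 0"
  proof (rule ccontr)
    assume "t (Suc k1) \<noteq> 0"
    then have pos: "t (Suc k1) > 0" using t_range by (metis less_eq_real_def)
    have t_eq: "t (Suc k1 + n) = b ^ n * t (Suc k1)" for n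
    proof (induction n)
      case (Suc n)
      then show ?case
        using split[of "Suc k1 + n"] beyond[of "Suc k1 + n"] by simp
    qed simp
    obtain n where "1 / t (Suc k1) < b ^ n"
      using real_arch_pow assms(1) by blast
    then have "t (Suc k1 + n) > 1"
      unfolding t_eq using pos by (simp add: field_simps)
    then show False
      using t_range(1)[of "Suc k1 + n"] by simp
  qed
  \<comment> \<open>A remainder 0 stays 0, which would make the digit at \<open>k1\<close>
    vanish.\<close>
  have t_pos: "t i > 0" if "i \<le> k1" for i
  proof (rule ccontr)
    assume "\<not> t i > 0"
    then have "t i = 0" using t_range(1)[of i] by simp
    then have "t (i + n) = 0" for n
      by (induction n) (auto simp: t)
    from this[of "k1 - i"] have "t k1 = 0"
      using that by simp
    then show False
      using k1 by (simp add: digit)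
  qed
  \<comment> \<open>At the end of each period the remainder 0 is replaced by 1, paid for by the last
    digit of the period being lowered by one.\<close>
  define q where "q i = t (i mod Suc k1)" for i
  have unit_expansion: "unit_expansion b i
      = (if i mod Suc k1 = k1 then beta_digit b 1 k1 - 1 else beta_digit b 1 (i mod Suc k1))" for i
    using fin unfolding unit_expansion_def k1_def Let_def by simp
  have "b * q i = real (unit_expansion b i) + q (Suc i)" for i
  proof (cases "i mod Suc k1 = k1")
    case True
    then have "Suc i mod Suc k1 = 0"
      by (simp add: mod_Suc)
    with True show ?thesis
      using split[of k1] \<open>t (Suc k1) = 0\<close> k1
      by (simp add: q_def unit_expansion t(1) of_nat_diff)
  next
    case False
    then have "Suc i mod Suc k1 = Suc (i mod Suc k1)"
      by (simp add: mod_Suc)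
    with False show ?thesis
      using split[of "i mod Suc k1"]
      by (simp add: q_def unit_expansion)
  qed
  moreover have "i mod Suc k1 \<le> k1" for i
    by (metis less_Suc_eq_le mod_less_divisor zero_less_Suc)
  ultimately have "q 0 = 1 \<and> (\<forall>i. 0 < q i \<and> q i \<le> 1 \<and> b * q i = real (unit_expansion b i) + q (Suc i))"
    using t_pos t_range(1) by (simp add: q_def t)
  then show ?thesis by blast
qed

text \<open>Equal digits cancel, so each step multiplies the gap by \<open>b\<close>. This is the
  bridge between comparing digits lexicographically and comparing remainders.\<close>

lemma remainder_gap:
  fixes v q :: "nat \<Rightarrow> real"
  assumes "\<And>i. b * v i = real (e i) + v (Suc i)" "\<And>i. b * q i = real (d i) + q (Suc i)"
    and "\<And>i. i < k \<Longrightarrow> e i = d i"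
  shows "q k - v k = b ^ k * (q 0 - v 0)"
  using assms(3)
proof (induction k)
  case (Suc k)
  have "q (Suc k) - v (Suc k) = b * (q k - v k)"
    using assms(1)[of k] assms(2)[of k] Suc.prems[of k] by (simp add: right_diff_distrib)
  also have "q k - v k = b ^ k * (q 0 - v 0)"
    using Suc by simp
  finally show ?case by (simp add: mult.assoc)
qed simp

text \<open>The gap between the remainders of 1 and those of the sequence starts positive. It would
  grow without bound if the digits always agreed, so there is a first disagreement; there the larger
  remainder belongs to 1, and a \<ge> 0 together with q \<le> 1 forces the smaller digit on the
  sequence.\<close>

lemma remainders_in_beta_compactum:
  assumes "b > 1" "finite_expansion b 1" "remainders b \<epsilon> v"
  shows "\<epsilon> \<in> beta_compactum b"
  unfolding beta_compactum_def
proof (intro CollectI allI)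
  fix n
  obtain q :: "nat \<Rightarrow> real" where q: "q 0 = 1"
      "\<And>i. 0 < q i \<and> q i \<le> 1" "\<And>i. b * q i = real (unit_expansion b i) + q (Suc i)"
    using unit_expansion_remainders[OF assms(1,2)] by blast
  define a where "a i = v (n + int i)" for i
  define e where "e i = \<epsilon> (n + int i)" for i
  have a: "0 \<le> a i \<and> a i < 1" "b * a i = real (e i) + a (Suc i)" for i
    using assms(3) unfolding remainders_def a_def e_def by (auto simp: algebra_simps)
  note gap = remainder_gap[of b a e q "unit_expansion b", OF a(2) q(3)]
  have "\<exists>k. e k \<noteq> unit_expansion b k"
  proof (rule ccontr)
    assume "\<not> ?thesis"
    then have eq: "q k - a k = b ^ k * (1 - a 0)" for k
      using gap[of k] q(1) by simp
    obtain k where "1 / (1 - a 0) < b ^ k"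
      using real_arch_pow assms(1) by blast
    then have "q k - a k > 1"
      using a(1)[of 0] by (simp add: eq field_simps)
    then show False
      using a(1)[of k] q(2)[of k] by simp
  qed
  then obtain k where k: "e k \<noteq> unit_expansion b k" "\<And>i. i < k \<Longrightarrow> e i = unit_expansion b i"
    using exists_least_iff[of "\<lambda>k. e k \<noteq> unit_expansion b k"] by auto
  have "q k - a k > 0"
    using gap[OF k(2)] a(1)[of 0] q(1) assms(1) by simp
  then have "b * a k < b * q k"
    using assms(1) by simp
  then have "real (e k) < real (unit_expansion b k) + 1"
    using a(1)[of "Suc k"] q(2)[of "Suc k"] by (simp add: a(2) q(3))
  then have "e k < unit_expansion b k"
    using k(1) by linarith
  then show "less_fun (\<lambda>i. \<epsilon> (n + int i)) (unit_expansion b)"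
    using k(2) unfolding e_def by (intro less_funI) blast
qed

text \<open>Digits are at most the first digit of the bounding sequence, so a geometric series gives
  a crude bound \<open>K\<close> for all remainders. A remainder of at least 1 would set off
  geometric growth beyond \<open>K\<close>.\<close>

lemma beta_compactum_remainders:
  assumes "b > 1" "finite_expansion b 1" "\<epsilon> \<in> beta_compactum b"
  shows "remainders b \<epsilon> (tail_value b \<epsilon>)"
proof -
  obtain q :: "nat \<Rightarrow> real" where q: "q 0 = 1"
      "\<And>i. 0 < q i \<and> q i \<le> 1" "\<And>i. b * q i = real (unit_expansion b i) + q (Suc i)"
    using unit_expansion_remainders[OF assms(1,2)] by blast
  define d where "d = unit_expansion b"
  define v where "v = tail_value b \<epsilon>"
  have lex: "\<exists>k. \<epsilon> (n + int k) < d k \<and> (\<forall>i<k. \<epsilon> (n + int i) = d i)" for n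
    using assms(3) unfolding beta_compactum_def less_fun_def d_def by blast
  have bound: "\<epsilon> n \<le> d 0" for n
  proof -
    obtain k where "\<epsilon> (n + int k) < d k" "\<forall>i<k. \<epsilon> (n + int i) = d i"
      using lex by blast
    then show ?thesis by (cases k) auto
  qed
  have geo: "(\<lambda>i. real (d 0) * inverse b ^ Suc i) sums (real (d 0) * (inverse b * (1 / (1 - inverse b))))"
    using assms(1) by (simp only: power_Suc) (intro sums_mult geometric_sums, simp add: inverse_less_1_iff)
  have term_le: "real (\<epsilon> (n + int i)) * inverse b ^ Suc i \<le> real (d 0) * inverse b ^ Suc i" for n i
    using bound assms(1) by (intro mult_right_mono) auto
  have summ: "summable (\<lambda>i. real (\<epsilon> (n + int i)) * inverse b ^ Suc i)" for n
    by (rule summable_comparison_test'[where N = 0, OF sums_summable[OF geo]])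
       (use assms(1) term_le in \<open>auto simp: abs_mult\<close>)
  have v_nonneg: "v n \<ge> 0" for n
    unfolding v_def tail_value_def using assms(1) by (intro suminf_nonneg summ) auto
  define K where "K = real (d 0) * (inverse b * (1 / (1 - inverse b)))"
  have v_le: "v n \<le> K" for n
    unfolding v_def tail_value_def K_def sums_unique[OF geo]
    by (intro suminf_le summ sums_summable[OF geo] term_le)
  have v_step: "b * v n = real (\<epsilon> n) + v (n + 1)" for n
  proof -
    have "v n = real (\<epsilon> n) * inverse b + (\<Sum>i. real (\<epsilon> (n + int (Suc i))) * inverse b ^ Suc (Suc i))"
      unfolding v_def tail_value_def using suminf_split_head[OF summ, of n] by simp
    also have "(\<Sum>i. real (\<epsilon> (n + int (Suc i))) * inverse b ^ Suc (Suc i)) = inverse b * v (n + 1)"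
      unfolding v_def tail_value_def
      by (subst suminf_mult[OF summ, symmetric]) (simp add: algebra_simps)
    finally show ?thesis
      using assms(1) by (simp add: field_simps)
  qed
  text \<open>An excess of \<open>v n\<close> over \<open>1\<close> would be passed on to a later remainder, magnified at least by the factor \<open>b\<close>.\<close>
  have excess: "\<exists>n'. v n' - 1 > b * (v n - 1)" if "v n \<ge> 1" for n
  proof -
    obtain k where k: "\<epsilon> (n + int k) < d k" "\<forall>i<k. \<epsilon> (n + int i) = d i"
      using lex by blast
    define a where "a i = v (n + int i)" for i
    have a: "b * a i = real (\<epsilon> (n + int i)) + a (Suc i)" for i
      using v_step[of "n + int i"] by (simp add: a_def algebra_simps)
    have "q k - a k = b ^ k * (q 0 - a 0)"
      by (rule remainder_gap[of b a "\<lambda>i. \<epsilon> (n + int i)" q d]) (use a q(3) k(2) in \<open>auto simp: d_def\<close>)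
    then have "a k - q k = b ^ k * (v n - 1)"
      by (simp add: q(1) a_def algebra_simps)
    moreover have "b ^ k * (v n - 1) \<ge> 1 * (v n - 1)"
      using assms(1) that by (intro mult_right_mono one_le_power) auto
    ultimately have "b * (v n - 1) \<le> b * (a k - q k)"
      using assms(1) by simp
    also have "\<dots> = real (\<epsilon> (n + int k)) - real (d k) + a (Suc k) - q (Suc k)"
      using a[of k] q(3)[of k] by (simp add: right_diff_distrib d_def)
    \<comment> \<open>The smaller digit costs at least 1, and positivity of the quasi-greedy
      remainder makes the inequality strict.\<close>
    also have "\<dots> < v (n + int (Suc k)) - 1"
      using k(1) q(2)[of "Suc k"] by (simp add: a_def)
    finally show ?thesis by blast
  qed
  have "v n < 1" for n
  proof (rule ccontr)
    assume "\<not> v n < 1"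
    \<comment> \<open>As \<open>excess\<close> is strict, even a remainder equal to 1 leads to one
      above 1.\<close>
    then obtain n1 where n1: "v n1 - 1 > 0"
      using excess[of n] assms(1) by (smt (verit) mult_nonneg_nonneg)
    have "\<exists>n'. v n' - 1 \<ge> b ^ j * (v n1 - 1)" for j
    proof (induction j)
      case (Suc j)
      then obtain n' where n': "v n' - 1 \<ge> b ^ j * (v n1 - 1)" by blast
      moreover have "b ^ j * (v n1 - 1) > 0"
        using n1 assms(1) by simp
      ultimately obtain n'' where "v n'' - 1 > b * (v n' - 1)"
        using excess[of n'] by auto
      moreover have "b * (v n' - 1) \<ge> b * (b ^ j * (v n1 - 1))"
        using n' assms(1) by (intro mult_left_mono) auto
      ultimately show ?case
        by (intro exI[of _ n'']) (simp add: mult.assoc)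
    qed auto
    moreover obtain j where "K / (v n1 - 1) < b ^ j"
      using real_arch_pow assms(1) by blast
    then have "b ^ j * (v n1 - 1) > K"
      using n1 by (simp add: field_simps)
    ultimately show False
      using v_le by (smt (verit))
  qed
  then show ?thesis
    using v_nonneg v_step by (simp add: remainders_def v_def)
qed

lemma beta_compactum_iff:
  assumes "b > 1" "finite_expansion b 1"
  shows "\<epsilon> \<in> beta_compactum b \<longleftrightarrow> remainders b \<epsilon> (tail_value b \<epsilon>)"
  using remainders_in_beta_compactum beta_compactum_remainders assms by blast

text \<open>One step of the greedy map sends 1 to \<open>frac b\<close>, an element of \<int>[b] in
  [0,1) with a finite expansion; the expansion of 1 has one more digit in front.\<close>

lemma finitary_imp_finite_expansion_1:
  assumes "b > 1" "finitary b"
  shows "finite_expansion b 1"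
proof -
  have "frac b = b - of_int \<lfloor>b\<rfloor>"
    by (simp add: frac_def)
  then have "frac b \<in> int_ring_ext b \<inter> {0..<1}"
    using frac_lt_1[of b] by (simp add: int_ring_ext_diff int_ring_ext_gen int_ring_ext_of_int)
  then have "finite_expansion b (frac b)"
    using assms(2) unfolding finitary_def by blast
  moreover have "beta_digit b 1 (Suc i) = beta_digit b (frac b) i" for i
    by (simp add: beta_digit_def funpow_Suc_right del: funpow.simps)
  ultimately have "finite {i. beta_digit b 1 (Suc i) \<noteq> 0}"
    by (simp add: finite_expansion_def)
  then have "finite (insert 0 (Suc ` {i. beta_digit b 1 (Suc i) \<noteq> 0}))"
    by simp
  moreover have "{i. beta_digit b 1 i \<noteq> 0} \<subseteq> insert 0 (Suc ` {i. beta_digit b 1 (Suc i) \<noteq> 0})"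
  proof
    fix i assume "i \<in> {i. beta_digit b 1 i \<noteq> 0}"
    then show "i \<in> insert 0 (Suc ` {i. beta_digit b 1 (Suc i) \<noteq> 0})"
      by (cases i) auto
  qed
  ultimately show ?thesis
    unfolding finite_expansion_def by (rule rev_finite_subset)
qed

section \<open>The torus and the codings\<close>

lemma torus_proj_eq_Collect:
  assumes "x \<in> carrier_vec n"
  shows "torus_proj n x = {y \<in> carrier_vec n. \<forall>i<n. y $ i - x $ i \<in> \<int>}"
proof (rule equalityI; rule subsetI)
  fix y assume "y \<in> torus_proj n x"
  then show "y \<in> {y \<in> carrier_vec n. \<forall>i<n. y $ i - x $ i \<in> \<int>}"
    using assms by (auto simp: torus_proj_def r_coset_def int_lattice_def monoid_vec_simps)
next
  fix y assume y: "y \<in> {y \<in> carrier_vec n. \<forall>i<n. y $ i - x $ i \<in> \<int>}"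
  then have "y - x \<in> int_lattice n" "y = (y - x) + x"
    using assms by (auto simp: int_lattice_def)
  then show "y \<in> torus_proj n x"
    unfolding torus_proj_def r_coset_def monoid_vec_simps by blast
qed

lemma torus_proj_eq_iff:
  assumes "x \<in> carrier_vec n" "y \<in> carrier_vec n"
  shows "torus_proj n x = torus_proj n y \<longleftrightarrow> (\<forall>i<n. x $ i - y $ i \<in> \<int>)"
proof
  assume "torus_proj n x = torus_proj n y"
  moreover have "x \<in> torus_proj n x"
    using assms by (simp add: torus_proj_eq_Collect)
  ultimately show "\<forall>i<n. x $ i - y $ i \<in> \<int>"
    using assms by (simp add: torus_proj_eq_Collect)
next
  assume xy: "\<forall>i<n. x $ i - y $ i \<in> \<int>"
  have "z - x $ i \<in> \<int> \<longleftrightarrow> z - y $ i \<in> \<int>" if "i < n" for z i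
  proof -
    have *: "x $ i - y $ i \<in> \<int>" using xy that by simp
    show ?thesis
      using Ints_add[OF _ *, of "z - x $ i"] Ints_diff[OF _ *, of "z - y $ i"] by auto
  qed
  then show "torus_proj n x = torus_proj n y"
    using assms by (auto simp: torus_proj_eq_Collect)
qed

lemma int_lattice_normal: "int_lattice n \<lhd> vec_group n"
proof -
  interpret comm_group "vec_group n"
    by (rule comm_group_vec)
  have inv: "inv\<^bsub>vec_group n\<^esub> x = - x" if "x \<in> carrier_vec n" for x :: "real vec"
    by (rule inv_equality) (use that in \<open>auto simp: monoid_vec_simps\<close>)
  have "subgroup (int_lattice n) (vec_group n)"
    by unfold_locales (auto simp: int_lattice_def monoid_vec_simps inv)
  then show ?thesis
    by (rule subgroup_imp_normal)
qed

lemma group_torus: "group (torus n)"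
  unfolding torus_def by (rule normal.factorgroup_is_group[OF int_lattice_normal])

lemma carrier_torus: "carrier (torus n) = torus_proj n ` carrier_vec n"
  by (auto simp: torus_def FactGroup_def RCOSETS_def torus_proj_def monoid_vec_simps)

lemma torus_proj_mult:
  assumes "x \<in> carrier_vec n" "y \<in> carrier_vec n"
  shows "torus_proj n x \<otimes>\<^bsub>torus n\<^esub> torus_proj n y = torus_proj n (x + y)"
  using normal.rcos_sum[OF int_lattice_normal] assms
  by (simp add: torus_def torus_proj_def monoid_vec_simps)

lemma one_torus: "\<one>\<^bsub>torus n\<^esub> = torus_proj n (0\<^sub>v n)"
  by (auto simp: torus_def torus_proj_eq_Collect int_lattice_def)

text \<open>The \<open>THE\<close> in \<open>torus_lim\<close> needs uniqueness: the distance to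
  \<int> of the difference of two limits is at most a sum of two null sequences, so they agree
  modulo 1.\<close>

lemma torus_lim_eq:
  assumes x: "x \<in> carrier_vec n"
    and lim: "\<And>i. i < n \<Longrightarrow> (\<lambda>N. dist_nearest_int (U N $ i - x $ i)) \<longlonglongrightarrow> 0"
  shows "torus_lim n U = torus_proj n x"
  unfolding torus_lim_def
proof (rule the_equality)
  show "torus_proj n x \<in> carrier (torus n) \<and>
      (\<exists>y\<in>torus_proj n x. \<forall>i<n. (\<lambda>N. dist_nearest_int (U N $ i - y $ i)) \<longlonglongrightarrow> 0)"
    using x lim by (auto simp: carrier_torus torus_proj_eq_Collect intro!: bexI[of _ x])
next
  fix L assume L: "L \<in> carrier (torus n) \<and>
      (\<exists>y\<in>L. \<forall>i<n. (\<lambda>N. dist_nearest_int (U N $ i - y $ i)) \<longlonglongrightarrow> 0)"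
  then obtain w where w: "w \<in> carrier_vec n" "L = torus_proj n w"
    by (auto simp: carrier_torus)
  from L obtain y where y: "y \<in> L" "\<And>i. i < n \<Longrightarrow> (\<lambda>N. dist_nearest_int (U N $ i - y $ i)) \<longlonglongrightarrow> 0"
    by blast
  have yc: "y \<in> carrier_vec n" and yw: "\<forall>i<n. y $ i - w $ i \<in> \<int>"
    using y(1) w by (auto simp: torus_proj_eq_Collect)
  have "x $ i - y $ i \<in> \<int>" if "i < n" for i
  proof -
    have "dist_nearest_int (x $ i - y $ i)
        \<le> dist_nearest_int (U N $ i - y $ i) + dist_nearest_int (U N $ i - x $ i)" for N
      using dist_nearest_int_triangle[of "U N $ i - y $ i" "- (U N $ i - x $ i)"]
      unfolding dist_nearest_int_minus by simp
    moreover have "(\<lambda>N. dist_nearest_int (U N $ i - y $ i) + dist_nearest_int (U N $ i - x $ i)) \<longlonglongrightarrow> 0 + 0"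
      by (intro tendsto_add lim y(2) that)
    ultimately have "dist_nearest_int (x $ i - y $ i) \<le> 0"
      by (intro LIMSEQ_le_const[where a = "dist_nearest_int (x $ i - y $ i)"]) auto
    then show ?thesis
      by (simp add: antisym dist_nearest_int_eq_0_iff[symmetric])
  qed
  then have "torus_proj n x = torus_proj n y"
    using x yc by (simp add: torus_proj_eq_iff)
  also have "\<dots> = torus_proj n w"
    using yw yc w(1) by (simp add: torus_proj_eq_iff)
  finally show "L = torus_proj n x"
    using w(2) by simp
qed

locale finitary_pisot = pisot_recurrence +
  assumes finite_expansion_1: "finite_expansion \<beta> 1"
begin

section \<open>Remainders of points of the compactum and of their limits\<close>

abbreviation X :: "(int \<Rightarrow> nat) set" where "X \<equiv> beta_compactum \<beta>"

abbreviation tail :: "(int \<Rightarrow> nat) \<Rightarrow> int \<Rightarrow> real" where "tail \<equiv> tail_value \<beta>"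

lemma X_iff: "\<epsilon> \<in> X \<longleftrightarrow> remainders \<beta> \<epsilon> (tail \<epsilon>)"
  by (rule beta_compactum_iff[OF beta_gt_1 finite_expansion_1])

text \<open>
  Limits of points of the compactum only satisfy the non-strict bound, yet they still have a well
  defined coding.
\<close>

definition Xbar :: "(int \<Rightarrow> nat) set" where
  "Xbar = {\<epsilon>. \<forall>n. 0 \<le> tail \<epsilon> n \<and> tail \<epsilon> n \<le> 1 \<and> \<beta> * tail \<epsilon> n = real (\<epsilon> n) + tail \<epsilon> (n + 1)}"

lemma X_imp_Xbar: "\<epsilon> \<in> X \<Longrightarrow> \<epsilon> \<in> Xbar"
  by (auto simp: X_iff remainders_def Xbar_def less_imp_le)

lemma tail_step_Xbar: "\<epsilon> \<in> Xbar \<Longrightarrow> \<beta> * tail \<epsilon> n = real (\<epsilon> n) + tail \<epsilon> (n + 1)"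
  by (simp add: Xbar_def)

lemma tail_abs_le_Xbar: "\<epsilon> \<in> Xbar \<Longrightarrow> \<bar>tail \<epsilon> n\<bar> \<le> 1"
  by (simp add: Xbar_def)

lemma Xbar_digit_bound:
  assumes "\<epsilon> \<in> Xbar"
  shows "real (\<epsilon> n) \<le> \<beta>"
proof -
  have "real (\<epsilon> n) \<le> \<beta> * tail \<epsilon> n"
    using assms by (simp add: Xbar_def)
  also have "\<dots> \<le> \<beta> * 1"
    using assms by (intro mult_left_mono) (auto simp: Xbar_def less_imp_le)
  finally show ?thesis by simp
qed

lemma tail_range:
  assumes "\<epsilon> \<in> X"
  shows "0 \<le> tail \<epsilon> n" "tail \<epsilon> n < 1" "\<bar>tail \<epsilon> n\<bar> \<le> 1"
  using assms by (auto simp: X_iff remainders_def less_imp_le)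

lemma tail_step: "\<epsilon> \<in> X \<Longrightarrow> \<beta> * tail \<epsilon> n = real (\<epsilon> n) + tail \<epsilon> (n + 1)"
  by (simp add: X_iff remainders_def)

lemmas X_digit_bound = Xbar_digit_bound[OF X_imp_Xbar]

lemma X_tail:
  assumes "remainders \<beta> \<epsilon> v"
  shows "\<epsilon> \<in> X" "tail \<epsilon> = v"
  using remainders_in_beta_compactum[OF beta_gt_1 finite_expansion_1 assms]
    remainders_tail_value[OF beta_gt_1 assms] by auto

text \<open>Passing one digit changes the rescaled remainder by a digit times a power of \<beta>.
  Negative powers also lie in \<int>[\<beta>], so one class modulo \<int>[\<beta>] belongs to the
  whole sequence.\<close>

lemma tail_class:
  assumes "\<epsilon> \<in> X"
  shows "\<beta> powi (1 - n) * tail \<epsilon> n - tail \<epsilon> 1 \<in> int_ring_ext \<beta>"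
proof (induction n rule: int_induct_bidirectional[where a = 1])
  have step: "\<beta> powi (1 - n) * tail \<epsilon> n = \<beta> powi (- n) * real (\<epsilon> n) + \<beta> powi (1 - (n + 1)) * tail \<epsilon> (n + 1)" for n
  proof -
    have "\<beta> powi (1 - n) * tail \<epsilon> n = \<beta> powi (- n) * (\<beta> * tail \<epsilon> n)"
      using power_int_add[of \<beta> 1 "- n"] by simp
    then show ?thesis
      by (simp add: tail_step[OF assms] distrib_left)
  qed
  have digit: "\<beta> powi k * real j \<in> int_ring_ext \<beta>" for k j
    by (intro int_ring_ext_mult powi_in_int_ring_ext int_ring_ext_of_nat)
  {
    case 1
    then show ?case by (simp add: int_ring_ext_0)
  next
    case (2 n)
    then show ?case
      using int_ring_ext_diff[OF 2 digit[of "- n" "\<epsilon> n"]] step[of n] by (simp add: algebra_simps)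
  next
    case (3 n)
    then show ?case
      using int_ring_ext_add[OF 3 digit[of "- (n - 1)" "\<epsilon> (n - 1)"]] step[of "n - 1"]
      by (simp add: algebra_simps)
  }
qed

text \<open>The real lift of the torus coordinates, with origin \<open>M\<close>. Digits from
  \<open>M\<close> on enter through the remainder. A digit k + 1 places before \<open>M\<close>
  would contribute a multiple of \<eta> \<beta>^(n+k); subtracting the integer a(n+k) from this
  factor makes the series converge.\<close>

definition coding :: "real \<Rightarrow> (int \<Rightarrow> real) \<Rightarrow> (int \<Rightarrow> nat) \<Rightarrow> int \<Rightarrow> int \<Rightarrow> real" where
  "coding \<eta> a \<epsilon> M n = \<eta> * \<beta> powi n * tail \<epsilon> M +
     (\<Sum>k. real (\<epsilon> (M - 1 - int k)) * (\<eta> * \<beta> powi (n + int k) - a (n + int k)))"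

lemma coding_summable_abs_Xbar:
  assumes "\<epsilon> \<in> Xbar" "integer_approx \<eta> a"
  shows "summable (\<lambda>k. \<bar>real (\<epsilon> (M - 1 - int k)) * (\<eta> * \<beta> powi (n + int k) - a (n + int k))\<bar>)"
proof (rule summable_comparison_test')
  show "summable (\<lambda>k. \<beta> * \<bar>\<eta> * \<beta> powi (n + int k) - a (n + int k)\<bar>)"
    using integer_approx_summable[OF assms(2), of n] by (intro summable_mult) (simp add: add.commute)
  show "norm \<bar>real (\<epsilon> (M - 1 - int k)) * (\<eta> * \<beta> powi (n + int k) - a (n + int k))\<bar>
      \<le> \<beta> * \<bar>\<eta> * \<beta> powi (n + int k) - a (n + int k)\<bar>" for k
    using Xbar_digit_bound[OF assms(1)] by (simp add: abs_mult mult_right_mono)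
qed

lemmas coding_summable_abs = coding_summable_abs_Xbar[OF X_imp_Xbar]
lemmas coding_summable_Xbar = summable_rabs_cancel[OF coding_summable_abs_Xbar]
lemmas coding_summable = coding_summable_Xbar[OF X_imp_Xbar]

text \<open>The bound is uniform in \<open>\<epsilon>\<close> and \<open>M\<close>, as digits are at
  most \<beta> and the errors of \<open>a\<close> are summable.\<close>

lemma coding_tail_bound:
  assumes "\<epsilon> \<in> X" "integer_approx \<eta> a"
  shows "\<bar>coding \<eta> a \<epsilon> M n - \<eta> * \<beta> powi n * tail \<epsilon> M\<bar>
    \<le> \<beta> * (\<Sum>k. \<bar>\<eta> * \<beta> powi (n + int k) - a (n + int k)\<bar>)"
proof -
  have s: "summable (\<lambda>k. \<bar>\<eta> * \<beta> powi (n + int k) - a (n + int k)\<bar>)"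
    using integer_approx_summable[OF assms(2), of n] by (simp add: add.commute)
  have "\<bar>coding \<eta> a \<epsilon> M n - \<eta> * \<beta> powi n * tail \<epsilon> M\<bar>
      \<le> (\<Sum>k. \<bar>real (\<epsilon> (M - 1 - int k)) * (\<eta> * \<beta> powi (n + int k) - a (n + int k))\<bar>)"
    unfolding coding_def using summable_rabs[OF coding_summable_abs[OF assms]] by simp
  also have "\<dots> \<le> (\<Sum>k. \<beta> * \<bar>\<eta> * \<beta> powi (n + int k) - a (n + int k)\<bar>)"
    using X_digit_bound[OF assms(1)]
    by (intro suminf_le coding_summable_abs assms summable_mult s) (simp add: abs_mult mult_right_mono)
  also have "\<dots> = \<beta> * (\<Sum>k. \<bar>\<eta> * \<beta> powi (n + int k) - a (n + int k)\<bar>)"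
    by (rule suminf_mult[OF s])
  finally show ?thesis .
qed

text \<open>The bound of \<open>coding_tail_bound\<close> at \<open>n\<close> is a multiple of the
  tail of one fixed convergent series. Hence a coding with integer values is an integer
  approximation of \<open>\<eta> * tail \<epsilon> M\<close>.\<close>

lemma coding_tendsto:
  assumes "\<epsilon> \<in> X" "integer_approx \<eta> a"
  shows "(\<lambda>n. \<eta> * tail \<epsilon> M * \<beta> powi int n - coding \<eta> a \<epsilon> M (int n)) \<longlonglongrightarrow> 0"
proof -
  define f where "f = (\<lambda>k. \<bar>\<eta> * \<beta> powi int k - a (int k)\<bar>)"
  have s: "summable f"
    using integer_approx_summable[OF assms(2), of 0] by (simp add: f_def)
  have "(\<Sum>k. f (k + n)) = suminf f - (\<Sum>k<n. f k)" for n
    by (rule suminf_minus_initial_segment[OF s])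
  moreover have "(\<lambda>n. suminf f - (\<Sum>k<n. f k)) \<longlonglongrightarrow> suminf f - suminf f"
    by (intro tendsto_diff tendsto_const summable_LIMSEQ[OF s])
  ultimately have "(\<lambda>n. \<Sum>k. f (k + n)) \<longlonglongrightarrow> 0"
    by simp
  then show ?thesis
  proof (rule tendsto_0_le)
    have "norm (\<eta> * tail \<epsilon> M * \<beta> powi int n - coding \<eta> a \<epsilon> M (int n)) \<le> norm (\<Sum>k. f (k + n)) * \<beta>" for n
    proof -
      have "norm (\<eta> * tail \<epsilon> M * \<beta> powi int n - coding \<eta> a \<epsilon> M (int n)) \<le> \<beta> * (\<Sum>k. f (k + n))"
        using coding_tail_bound[OF assms, of M "int n"]
        unfolding f_def of_nat_add add.commute[of "int n"]
        by (simp only: real_norm_def abs_minus_commute mult_ac)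
      also have "\<dots> \<le> norm (\<Sum>k. f (k + n)) * \<beta>"
        by simp
      finally show ?thesis .
    qed
    then show "\<forall>\<^sub>F n in sequentially.
        norm (\<eta> * tail \<epsilon> M * \<beta> powi int n - coding \<eta> a \<epsilon> M (int n)) \<le> norm (\<Sum>k. f (k + n)) * \<beta>"
      by simp
  qed
qed

lemma coding_shift_op:
  assumes "\<epsilon> \<in> X" "integer_approx \<eta> a"
  shows "shift_op p (coding \<eta> a \<epsilon> M) n = coding (poly p \<beta> * \<eta>) (shift_op p a) \<epsilon> M n"
proof -
  define D where "D n = \<eta> * \<beta> powi n - a n" for n
  have D: "shift_op p D n = poly p \<beta> * \<eta> * \<beta> powi n - shift_op p a n" for n
    unfolding D_def by (simp add: shift_op_minus shift_op_cmult shift_op_powi)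
  have coding: "coding \<eta> a \<epsilon> M
      = (\<lambda>n. \<eta> * tail \<epsilon> M * \<beta> powi n + (\<Sum>k. real (\<epsilon> (M - 1 - int k)) * D (n + int k)))"
    by (simp add: coding_def D_def fun_eq_iff)
  have "summable (\<lambda>k. real (\<epsilon> (M - 1 - int k)) * D (n + int k))" for n
    using coding_summable[OF assms] by (simp add: D_def)
  then have "shift_op p (\<lambda>n. \<Sum>k. real (\<epsilon> (M - 1 - int k)) * D (n + int k)) n
      = (\<Sum>k. real (\<epsilon> (M - 1 - int k)) * shift_op p D (n + int k))"
    by (subst shift_op_suminf) (simp_all add: shift_op_cmult shift_op_translate)
  then show ?thesis
    unfolding coding by (simp add: shift_op_plus shift_op_cmult shift_op_powi coding_def D)
qed

lemma coding_recurrent: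
  assumes "\<epsilon> \<in> X" "integer_approx \<eta> a"
  shows "recurrent (coding \<eta> a \<epsilon> M)"
proof -
  have "shift_op g a = (\<lambda>_. 0)"
    using assms(2) by (auto simp: integer_approx_def recurrent_def)
  then show ?thesis
    by (simp add: recurrent_def coding_shift_op[OF assms] root_g) (simp add: coding_def)
qed

text \<open>When the origin passes the digit at \<open>M\<close>, this digit leaves the remainder
  and becomes the first term of the series, where its integer multiple of \<open>a n\<close> has
  been dropped.\<close>

lemma coding_step_Xbar:
  assumes "\<epsilon> \<in> Xbar" "integer_approx \<eta> a"
  shows "coding \<eta> a \<epsilon> M (n + 1) = coding \<eta> a \<epsilon> (M + 1) n + real (\<epsilon> M) * a n"
proof -
  let ?f = "\<lambda>k. real (\<epsilon> (M + 1 - 1 - int k)) * (\<eta> * \<beta> powi (n + int k) - a (n + int k))"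
  have "coding \<eta> a \<epsilon> M (n + 1) = \<eta> * \<beta> powi n * (\<beta> * tail \<epsilon> M) + (\<Sum>k. ?f (Suc k))"
    by (simp add: coding_def power_int_add algebra_simps)
  also have "(\<Sum>k. ?f (Suc k)) = suminf ?f - ?f 0"
    by (rule suminf_split_head[OF coding_summable_Xbar[OF assms]])
  finally show ?thesis
    by (simp add: tail_step_Xbar[OF assms(1)] coding_def algebra_simps)
qed

lemmas coding_step = coding_step_Xbar[OF X_imp_Xbar]

lemma partial_value_eq_tail_Xbar:
  assumes "\<epsilon> \<in> Xbar"
  shows "partial_value \<beta> \<epsilon> N = \<beta> ^ Suc N * tail \<epsilon> (- int N)"
proof -
  have sums: "(\<lambda>i. real (\<epsilon> (- int N + int i)) * inverse \<beta> ^ Suc i) sums tail \<epsilon> (- int N)"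
    by (rule recursion_sums[OF beta_gt_1, of "tail \<epsilon>"]) (use tail_step_Xbar tail_abs_le_Xbar assms in auto)
  have "\<beta> powi (int N - int j) = \<beta> ^ Suc N * inverse \<beta> ^ Suc j" for j
  proof -
    have "\<beta> powi (int N - int j) = \<beta> powi (int (Suc N) - int (Suc j))"
      by simp
    also have "\<dots> = \<beta> powi int (Suc N) / \<beta> powi int (Suc j)"
      by (rule power_int_diff) simp
    finally show ?thesis
      unfolding power_int_of_nat by (simp add: divide_inverse power_inverse)
  qed
  then have "(\<lambda>j. real (\<epsilon> (int j - int N)) * \<beta> powi (int N - int j)) sums (\<beta> ^ Suc N * tail \<epsilon> (- int N))"
    using sums_mult[OF sums, of "\<beta> ^ Suc N"] by (simp add: mult_ac)
  then show ?thesis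
    by (simp add: partial_value_def sums_iff)
qed

lemmas partial_value_eq_tail = partial_value_eq_tail_Xbar[OF X_imp_Xbar]

lemma partial_value_eq_sum:
  assumes "\<epsilon> \<in> Xbar"
  shows "partial_value \<beta> \<epsilon> N = tail \<epsilon> 1 + (\<Sum>k<Suc N. real (\<epsilon> (- int k)) * \<beta> ^ k)"
proof (induction N)
  case 0
  then show ?case
    using tail_step_Xbar[OF assms, of 0] by (simp add: partial_value_eq_tail_Xbar[OF assms])
next
  case (Suc N)
  have "\<beta> * tail \<epsilon> (- int (Suc N)) = real (\<epsilon> (- int (Suc N))) + tail \<epsilon> (- int N)"
    using tail_step_Xbar[OF assms, of "- int (Suc N)"] by simp
  then have "partial_value \<beta> \<epsilon> (Suc N) = \<beta> ^ Suc N * real (\<epsilon> (- int (Suc N))) + partial_value \<beta> \<epsilon> N"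
    by (simp only: partial_value_eq_tail_Xbar[OF assms] power_Suc2[of \<beta> "Suc N"] mult.assoc)
       (simp add: distrib_left)
  then show ?case
    using Suc by simp
qed

text \<open>Removing the integer combination of values of \<open>a\<close> from the scaled partial
  value leaves exactly a partial sum of the series in \<open>coding\<close>.\<close>

lemma dist_partial_value_coding_Xbar:
  assumes "\<epsilon> \<in> Xbar" "integer_approx \<eta> a"
  shows "(\<lambda>N. dist_nearest_int (partial_value \<beta> \<epsilon> N * (\<eta> * \<beta> powi n) - coding \<eta> a \<epsilon> 1 n)) \<longlonglongrightarrow> 0"
proof (rule dist_nearest_int_tendsto_0I)
  let ?f = "\<lambda>k. real (\<epsilon> (1 - 1 - int k)) * (\<eta> * \<beta> powi (n + int k) - a (n + int k))"
  have "(\<lambda>N. (\<Sum>k<Suc N. ?f k) - suminf ?f) \<longlonglongrightarrow> suminf ?f - suminf ?f"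
    by (intro tendsto_diff tendsto_const LIMSEQ_Suc[OF summable_LIMSEQ[OF coding_summable_Xbar[OF assms]]])
  moreover have "partial_value \<beta> \<epsilon> N * (\<eta> * \<beta> powi n) - coding \<eta> a \<epsilon> 1 n
       - (\<Sum>k<Suc N. real (\<epsilon> (- int k)) * a (n + int k)) = (\<Sum>k<Suc N. ?f k) - suminf ?f" for N
  proof -
    have "(\<Sum>k<Suc N. real (\<epsilon> (- int k)) * \<beta> ^ k) * (\<eta> * \<beta> powi n)
        = (\<Sum>k<Suc N. ?f k) + (\<Sum>k<Suc N. real (\<epsilon> (- int k)) * a (n + int k))"
      unfolding sum_distrib_right sum.distrib[symmetric]
      by (rule sum.cong) (auto simp: power_int_add algebra_simps)
    then show ?thesis
      by (simp only: partial_value_eq_sum[OF assms(1)] coding_def distrib_right) simp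
  qed
  ultimately show "(\<lambda>N. partial_value \<beta> \<epsilon> N * (\<eta> * \<beta> powi n) - coding \<eta> a \<epsilon> 1 n
       - (\<Sum>k<Suc N. real (\<epsilon> (- int k)) * a (n + int k))) \<longlonglongrightarrow> 0"
    by simp
  show "(\<Sum>k<Suc N. real (\<epsilon> (- int k)) * a (n + int k)) \<in> \<int>" for N
    using assms(2) by (auto simp: integer_approx_def intro!: Ints_sum Ints_mult simp del: sum.lessThan_Suc)
qed

lemmas dist_partial_value_coding = dist_partial_value_coding_Xbar[OF X_imp_Xbar]

section \<open>The two codings as points of the torus\<close>

definition coding_vec :: "real \<Rightarrow> (int \<Rightarrow> real) \<Rightarrow> (int \<Rightarrow> nat) \<Rightarrow> real vec" where
  "coding_vec \<eta> a \<epsilon> = vec m (\<lambda>i. coding \<eta> a \<epsilon> 1 (- int i))"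

lemma coding_vec_simps [simp]:
  "coding_vec \<eta> a \<epsilon> \<in> carrier_vec m"
  "dim_vec (coding_vec \<eta> a \<epsilon>) = m"
  "i < m \<Longrightarrow> coding_vec \<eta> a \<epsilon> $ i = coding \<eta> a \<epsilon> 1 (- int i)"
  by (simp_all add: coding_vec_def)

lemma torus_lim_partial_value:
  assumes "\<epsilon> \<in> X" "integer_approx \<eta> a"
  shows "torus_lim m (\<lambda>N. partial_value \<beta> \<epsilon> N \<cdot>\<^sub>v vec m (\<lambda>i. \<eta> * \<beta> powi (- int i)))
    = torus_proj m (coding_vec \<eta> a \<epsilon>)"
  by (rule torus_lim_eq) (use dist_partial_value_coding[OF assms] in auto)

definition \<phi>0 :: "(int \<Rightarrow> nat) \<Rightarrow> real vec set" where
  "\<phi>0 \<epsilon> = torus_proj m (coding_vec \<xi> H \<epsilon>)"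

definition \<phi> :: "(int \<Rightarrow> nat) \<Rightarrow> real vec set" where
  "\<phi> \<epsilon> = torus_proj m (coding_vec 1 A \<epsilon>)"

lemma coding_A:
  assumes "\<epsilon> \<in> X"
  shows "coding 1 A \<epsilon> M = shift_op (pderiv g) (coding \<xi> H \<epsilon> M)"
  by (simp add: fun_eq_iff coding_shift_op[OF assms integer_approx_H] pderiv_g_\<xi> A_def)

text \<open>The torus sees \<open>m\<close> consecutive places; the recurrence spreads integrality
  from them to all of \<int>.\<close>

lemma \<phi>0_eq_iff:
  assumes "\<epsilon> \<in> X" "\<epsilon>' \<in> X"
  shows "\<phi>0 \<epsilon> = \<phi>0 \<epsilon>' \<longleftrightarrow> (\<forall>n. coding \<xi> H \<epsilon> 1 n - coding \<xi> H \<epsilon>' 1 n \<in> \<int>)"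
proof -
  have "recurrent (\<lambda>n. coding \<xi> H \<epsilon> 1 n - coding \<xi> H \<epsilon>' 1 n)"
    by (intro recurrent_minus coding_recurrent assms integer_approx_H)
  from recurrent_Ints_backward_window[OF this, of 0] show ?thesis
    unfolding \<phi>0_def by (subst torus_proj_eq_iff) auto
qed

lemma \<phi>_eq_one_iff:
  assumes "\<epsilon> \<in> X"
  shows "\<phi> \<epsilon> = \<one>\<^bsub>torus m\<^esub> \<longleftrightarrow> (\<forall>n. coding 1 A \<epsilon> 1 n \<in> \<int>)"
proof -
  have "recurrent (coding 1 A \<epsilon> 1)"
    by (intro coding_recurrent assms integer_approx_A)
  from recurrent_Ints_backward_window[OF this, of 0] show ?thesis
    unfolding \<phi>_def one_torus by (subst torus_proj_eq_iff) auto
qed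

text \<open>Multiplicativity is expressed on lifts: the defect \<open>u\<close> is recurrent and
  integral, and g' in the shift has integer coefficients, so it preserves integrality.\<close>

lemma \<phi>0_mult_imp_\<phi>_mult:
  assumes "\<epsilon> \<in> X" "\<epsilon>1 \<in> X" "\<epsilon>2 \<in> X" and eq: "\<phi>0 \<epsilon> = \<phi>0 \<epsilon>1 \<otimes>\<^bsub>torus m\<^esub> \<phi>0 \<epsilon>2"
  shows "\<phi> \<epsilon> = \<phi> \<epsilon>1 \<otimes>\<^bsub>torus m\<^esub> \<phi> \<epsilon>2"
proof -
  define u where "u n = coding \<xi> H \<epsilon> 1 n - (coding \<xi> H \<epsilon>1 1 n + coding \<xi> H \<epsilon>2 1 n)" for n
  have "recurrent u"
    unfolding u_def by (intro recurrent_minus recurrent_plus coding_recurrent assms integer_approx_H)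
  moreover have "u (0 - int i) \<in> \<int>" if "i < m" for i
    using eq that unfolding \<phi>0_def u_def
    by (simp add: torus_proj_mult torus_proj_eq_iff add_carrier_vec)
  ultimately have "u n \<in> \<int>" for n
    by (rule recurrent_Ints_backward_window)
  then have "shift_op (pderiv g) u n \<in> \<int>" for n
    unfolding pderiv_g by (rule shift_op_Ints)
  then have "coding 1 A \<epsilon> 1 n - (coding 1 A \<epsilon>1 1 n + coding 1 A \<epsilon>2 1 n) \<in> \<int>" for n
    unfolding u_def by (simp add: coding_A assms shift_op_minus shift_op_plus)
  then show ?thesis
    unfolding \<phi>_def by (simp add: torus_proj_mult torus_proj_eq_iff add_carrier_vec)
qed

lemma \<phi>0_eq_imp_\<phi>_eq:
  assumes "\<epsilon> \<in> X" "\<epsilon>' \<in> X" and eq: "\<phi>0 \<epsilon> = \<phi>0 \<epsilon>'"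
  shows "\<phi> \<epsilon> = \<phi> \<epsilon>'"
proof -
  define u where "u n = coding \<xi> H \<epsilon> 1 n - coding \<xi> H \<epsilon>' 1 n" for n
  have "u n \<in> \<int>" for n
    using eq assms by (simp add: \<phi>0_eq_iff u_def)
  then have "shift_op (pderiv g) u n \<in> \<int>" for n
    unfolding pderiv_g by (rule shift_op_Ints)
  then have "coding 1 A \<epsilon> 1 n - coding 1 A \<epsilon>' 1 n \<in> \<int>" for n
    unfolding u_def by (simp add: coding_A assms shift_op_minus)
  then show ?thesis
    unfolding \<phi>_def by (simp add: torus_proj_eq_iff)
qed

end

section \<open>The kernel\<close>

lemma tail_value_cong:
  assumes "\<And>i. i \<ge> n \<Longrightarrow> \<epsilon> i = \<epsilon>' i"
  shows "tail_value b \<epsilon> n = tail_value b \<epsilon>' n"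
  unfolding tail_value_def using assms by simp

definition periodic :: "(int \<Rightarrow> nat) \<Rightarrow> bool" where
  "periodic \<epsilon> \<longleftrightarrow> (\<exists>p>0. \<forall>n. \<epsilon> (n + int p) = \<epsilon> n)"

lemma tail_value_periodic:
  assumes "\<And>n. \<epsilon> (n + int p) = \<epsilon> n"
  shows "tail_value b \<epsilon> (n - int (k * p)) = tail_value b \<epsilon> n"
proof (induction k)
  case (Suc k)
  have "\<epsilon> (n - int (Suc k * p) + int i) = \<epsilon> (n - int (k * p) + int i)" for i
    using assms[of "n - int (Suc k * p) + int i"] by (simp add: algebra_simps)
  then show ?case
    using Suc by (simp add: tail_value_def)
qed simp

context finitary_pisot
begin

lemma zero_in_X: "(\<lambda>_. 0) \<in> X"
  and tail_zero: "tail (\<lambda>_. 0) n = 0"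
  and partial_value_zero: "partial_value \<beta> (\<lambda>_. 0) N = 0"
  and coding_zero: "coding \<eta> a (\<lambda>_. 0) M n = 0"
proof -
  have "remainders \<beta> (\<lambda>_. 0) (\<lambda>_. 0)"
    by (simp add: remainders_def)
  from X_tail[OF this] show "(\<lambda>_. 0) \<in> X" "tail (\<lambda>_. 0) n = 0" "coding \<eta> a (\<lambda>_. 0) M n = 0"
    by (simp_all add: coding_def)
  show "partial_value \<beta> (\<lambda>_. 0) N = 0"
    by (simp add: partial_value_def)
qed

lemma pisot_set_dist:
  assumes "x \<in> pisot_set \<beta>"
  shows "(\<lambda>k. dist_nearest_int (x * \<beta> powi n * \<beta> ^ k)) \<longlonglongrightarrow> 0"
  using pisot_set_mult[OF assms powi_in_int_ring_ext[of n]]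
  by (simp add: pisot_set_def mult.commute)

text \<open>The limits along the full sequence exist, so a congruence of codings may be tested along
  any subsequence. It is applied along a common period and along places with remainder 1.\<close>

lemma coding_diff_Ints:
  assumes X: "\<epsilon> \<in> Xbar" "\<epsilon>' \<in> Xbar" and a: "integer_approx \<eta> a" and "strict_mono s"
    and lim: "(\<lambda>k. dist_nearest_int ((partial_value \<beta> \<epsilon> (s k) - partial_value \<beta> \<epsilon>' (s k)) * (\<eta> * \<beta> powi n))) \<longlonglongrightarrow> 0"
  shows "coding \<eta> a \<epsilon> 1 n - coding \<eta> a \<epsilon>' 1 n \<in> \<int>"
proof -
  let ?P = "\<lambda>\<epsilon> k. partial_value \<beta> \<epsilon> (s k) * (\<eta> * \<beta> powi n)"
  let ?c = "\<lambda>\<epsilon>. coding \<eta> a \<epsilon> 1 n"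
  have sub: "(\<lambda>k. dist_nearest_int (?P \<epsilon> k - ?c \<epsilon>)) \<longlonglongrightarrow> 0" if "\<epsilon> \<in> Xbar" for \<epsilon>
    using LIMSEQ_subseq_LIMSEQ[OF dist_partial_value_coding_Xbar[OF that a] \<open>strict_mono s\<close>]
    by (simp add: o_def)
  have "dist_nearest_int (?c \<epsilon> - ?c \<epsilon>')
      \<le> dist_nearest_int (?P \<epsilon> k - ?P \<epsilon>' k) + (dist_nearest_int (?P \<epsilon> k - ?c \<epsilon>) + dist_nearest_int (?P \<epsilon>' k - ?c \<epsilon>'))" for k
    using dist_nearest_int_triangle[of "?P \<epsilon> k - ?P \<epsilon>' k" "- (?P \<epsilon> k - ?c \<epsilon>) + (?P \<epsilon>' k - ?c \<epsilon>')"]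
      dist_nearest_int_triangle[of "- (?P \<epsilon> k - ?c \<epsilon>)" "?P \<epsilon>' k - ?c \<epsilon>'"]
    unfolding dist_nearest_int_minus by simp
  moreover have "(\<lambda>k. dist_nearest_int (?P \<epsilon> k - ?P \<epsilon>' k) + (dist_nearest_int (?P \<epsilon> k - ?c \<epsilon>) + dist_nearest_int (?P \<epsilon>' k - ?c \<epsilon>'))) \<longlonglongrightarrow> 0 + (0 + 0)"
    using lim by (intro tendsto_add sub X) (simp add: left_diff_distrib)
  ultimately have "dist_nearest_int (?c \<epsilon> - ?c \<epsilon>') \<le> 0"
    by (intro LIMSEQ_le_const[where a = "dist_nearest_int (?c \<epsilon> - ?c \<epsilon>')"]) auto
  then show ?thesis
    by (simp add: antisym dist_nearest_int_eq_0_iff[symmetric])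
qed

lemma periodic_coding_diff_Ints:
  assumes X: "\<epsilon> \<in> X" "\<epsilon>' \<in> X" and a: "integer_approx \<eta> a"
    and per: "periodic \<epsilon>" "periodic \<epsilon>'"
    and pisot: "(tail \<epsilon> 1 - tail \<epsilon>' 1) * \<eta> \<in> pisot_set \<beta>"
  shows "coding \<eta> a \<epsilon> 1 n - coding \<eta> a \<epsilon>' 1 n \<in> \<int>"
proof -
  obtain p p' where p: "p > 0" "\<And>n. \<epsilon> (n + int p) = \<epsilon> n" and p': "p' > 0" "\<And>n. \<epsilon>' (n + int p') = \<epsilon>' n"
    using per unfolding periodic_def by blast
  define q where "q = p' * p"
  have "q > 0" using p(1) p'(1) by (simp add: q_def)
  \<comment> \<open>The partial value at \<open>s k\<close> is \<beta>^(s k + 1) times the remainder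
    at \<open>- s k\<close>. This place is 1 minus a multiple of the common period, so the remainder
    is the one at 1 and the Pisot assumption applies to the difference.\<close>
  define s where "s k = Suc k * q - 1" for k
  have Suc_s: "Suc (s k) = Suc k * q" for k
    using \<open>q > 0\<close> by (simp add: s_def)
  have "strict_mono s"
    unfolding strict_mono_Suc_iff
  proof
    fix k
    have "Suc (s k) < Suc (s (Suc k))"
      using \<open>q > 0\<close> by (simp add: Suc_s)
    then show "s k < s (Suc k)" by simp
  qed
  have "- int (s k) = 1 - int (Suc k * p' * p)" "- int (s k) = 1 - int (Suc k * p * p')" for k
    using arg_cong[OF Suc_s[of k], of int] by (simp_all add: q_def algebra_simps)
  then have tails: "tail \<epsilon> (- int (s k)) = tail \<epsilon> 1" "tail \<epsilon>' (- int (s k)) = tail \<epsilon>' 1" for k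
    using tail_value_periodic[of \<epsilon> p \<beta> 1 "Suc k * p'"] tail_value_periodic[of \<epsilon>' p' \<beta> 1 "Suc k * p"] p(2) p'(2)
    by simp_all
  let ?t = "(tail \<epsilon> 1 - tail \<epsilon>' 1) * \<eta>"
  have "strict_mono (\<lambda>k. Suc k * q)"
    using \<open>q > 0\<close> by (simp add: strict_mono_Suc_iff)
  from LIMSEQ_subseq_LIMSEQ[OF pisot_set_dist[OF pisot, of n] this]
  have "(\<lambda>k. dist_nearest_int (?t * \<beta> powi n * \<beta> ^ Suc (s k))) \<longlonglongrightarrow> 0"
    by (simp add: o_def Suc_s)
  then have "(\<lambda>k. dist_nearest_int ((partial_value \<beta> \<epsilon> (s k) - partial_value \<beta> \<epsilon>' (s k)) * (\<eta> * \<beta> powi n))) \<longlonglongrightarrow> 0"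
    by (simp add: partial_value_eq_tail X tails algebra_simps)
  then show ?thesis
    by (rule coding_diff_Ints[OF X_imp_Xbar[OF X(1)] X_imp_Xbar[OF X(2)] a \<open>strict_mono s\<close>])
qed

lemma coding_bounded:
  assumes a: "integer_approx \<eta> a"
  shows "\<exists>K. \<forall>\<epsilon>\<in>X. \<forall>M. \<forall>i<m. \<bar>coding \<eta> a \<epsilon> M (int i)\<bar> \<le> K"
proof -
  define S where "S i = \<bar>\<eta>\<bar> * \<beta> ^ i + \<beta> * (\<Sum>k. \<bar>\<eta> * \<beta> powi (int i + int k) - a (int i + int k)\<bar>)" for i
  have S: "\<bar>coding \<eta> a \<epsilon> M (int i)\<bar> \<le> S i" if "\<epsilon> \<in> X" for \<epsilon> M i
  proof -
    have "\<bar>\<eta> * \<beta> powi int i * tail \<epsilon> M\<bar> \<le> \<bar>\<eta>\<bar> * \<beta> ^ i * 1"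
      unfolding abs_mult using tail_range(3)[OF that] by (intro mult_mono mult_nonneg_nonneg) (auto intro: less_imp_le)
    then show ?thesis
      using coding_tail_bound[OF that a, of M "int i"] unfolding S_def by linarith
  qed
  have "\<bar>coding \<eta> a \<epsilon> M (int i)\<bar> \<le> (\<Sum>i<m. S i)" if "\<epsilon> \<in> X" "i < m" for \<epsilon> M i
  proof -
    have "S i \<le> (\<Sum>i<m. S i)"
      by (rule member_le_sum) (use that(2) order_trans[OF abs_ge_zero S[OF that(1)]] in auto)
    with S[OF that(1)] show ?thesis by (rule order_trans)
  qed
  then show ?thesis by blast
qed

lemma tail_eq_imp:
  assumes "\<epsilon> \<in> X" "tail \<epsilon> n = tail \<epsilon> n'"
  shows "tail \<epsilon> (n + int i) = tail \<epsilon> (n' + int i)" "\<epsilon> (n + int i) = \<epsilon> (n' + int i)"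
proof -
  note rem = assms(1)[unfolded X_iff]
  have *: "tail \<epsilon> (n + int i) = tail \<epsilon> (n' + int i)" for i
  proof (induction i)
    case (Suc i)
    have "tail \<epsilon> (k + int (Suc i)) = frac (\<beta> * tail \<epsilon> (k + int i))" for k
      using remainders_frac_floor(1)[OF rem, of "k + int i"] by (simp add: algebra_simps)
    with Suc show ?case by simp
  qed (use assms(2) in simp)
  then show "tail \<epsilon> (n + int i) = tail \<epsilon> (n' + int i)" .
  show "\<epsilon> (n + int i) = \<epsilon> (n' + int i)"
    using remainders_frac_floor(2)[OF rem] * by metis
qed

text \<open>Finitely many remainders form a backward orbit of a deterministic map, so the orbit is a cycle.\<close>

lemma finite_tails_imp_periodic:
  assumes X: "\<epsilon> \<in> X" and fin: "finite (range (\<lambda>j. tail \<epsilon> (- int j)))"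
  shows "periodic \<epsilon>"
proof -
  obtain j0 where "infinite {j. tail \<epsilon> (- int j) = tail \<epsilon> (- int j0)}"
    using pigeonhole_infinite[OF infinite_UNIV_nat fin] by auto
  then have unbounded: "\<exists>j>k. tail \<epsilon> (- int j) = tail \<epsilon> (- int j0)" for k
    unfolding infinite_nat_iff_unbounded by blast
  obtain j1 where j1: "j1 > j0" "tail \<epsilon> (- int j1) = tail \<epsilon> (- int j0)"
    using unbounded by blast
  define p where "p = j1 - j0"
  have "\<epsilon> (n + int p) = \<epsilon> n" for n
  proof -
    \<comment> \<open>The place \<open>- j\<close> lies left of \<open>n\<close> and has the same
      remainder as \<open>- j0\<close> and \<open>- j1\<close>. Reading from \<open>- j1\<close>
      instead of \<open>- j0\<close> moves the place by \<open>p\<close> and leaves the digits the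
      same.\<close>
    obtain j where j: "j > nat (- n)" "tail \<epsilon> (- int j) = tail \<epsilon> (- int j0)"
      using unbounded by blast
    define i where "i = nat (n + int j)"
    have n: "n = - int j + int i"
      using j(1) by (simp add: i_def)
    have "\<epsilon> (n + int p) = \<epsilon> (- int j1 + int (i + p))"
      using tail_eq_imp(2)[OF X, of "- int j" "- int j1" "i + p"] j j1 by (simp add: n algebra_simps)
    also have "- int j1 + int (i + p) = - int j0 + int i"
      using j1(1) by (simp add: p_def of_nat_diff)
    also have "\<epsilon> (- int j0 + int i) = \<epsilon> n"
      using tail_eq_imp(2)[OF X, of "- int j" "- int j0" i] j by (simp add: n)
    finally show ?thesis .
  qed
  moreover have "p > 0"
    using j1(1) by (simp add: p_def)
  ultimately show ?thesis
    unfolding periodic_def by blast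
qed

text \<open>Moving the origin changes the coding by integers, so integrality spreads from origin 1
  to every \<open>M\<close>; \<open>coding_tendsto\<close> then applies to every remainder.\<close>

lemma coding_Ints_imp:
  assumes X: "\<epsilon> \<in> X" and int: "\<And>n. coding 1 A \<epsilon> 1 n \<in> \<int>"
  shows "integer_approx (tail \<epsilon> M) (coding 1 A \<epsilon> M)"
proof -
  have A: "A n \<in> \<int>" for n
    using integer_approx_A by (simp add: integer_approx_def)
  note step = coding_step[OF X integer_approx_A]
  have "\<forall>n. coding 1 A \<epsilon> M n \<in> \<int>"
  proof (induction M rule: int_induct_bidirectional[where a = 1])
    case 1
    then show ?case using int by blast
  next
    case (2 M)
    show ?case
    proof
      fix n
      have "coding 1 A \<epsilon> (M + 1) n = coding 1 A \<epsilon> M (n + 1) - real (\<epsilon> M) * A n"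
        using step[of M n] by simp
      then show "coding 1 A \<epsilon> (M + 1) n \<in> \<int>"
        using 2 A by (simp add: Ints_diff Ints_mult)
    qed
  next
    case (3 M)
    show ?case
    proof
      fix n
      have "coding 1 A \<epsilon> (M - 1) n = coding 1 A \<epsilon> M (n - 1) + real (\<epsilon> (M - 1)) * A (n - 1)"
        using step[of "M - 1" "n - 1"] by simp
      then show "coding 1 A \<epsilon> (M - 1) n \<in> \<int>"
        using 3 A by (simp add: Ints_add Ints_mult)
    qed
  qed
  moreover have "(\<lambda>n. tail \<epsilon> M * \<beta> powi int n - coding 1 A \<epsilon> M (int n)) \<longlonglongrightarrow> 0"
    using coding_tendsto[OF X integer_approx_A, of M] by simp
  ultimately show ?thesis
    using coding_recurrent[OF X integer_approx_A] by (simp add: integer_approx_def)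
qed

lemma \<phi>_eq_one_iff_periodic:
  assumes X: "\<epsilon> \<in> X"
  shows "\<phi> \<epsilon> = \<one>\<^bsub>torus m\<^esub> \<longleftrightarrow> periodic \<epsilon> \<and> tail \<epsilon> 1 \<in> pisot_set \<beta>"
proof
  assume "\<phi> \<epsilon> = \<one>\<^bsub>torus m\<^esub>"
  then have approx: "integer_approx (tail \<epsilon> M) (coding 1 A \<epsilon> M)" for M
    using X by (intro coding_Ints_imp) (auto simp: \<phi>_eq_one_iff)
  obtain K where K: "\<forall>\<epsilon>\<in>X. \<forall>M. \<forall>i<m. \<bar>coding 1 A \<epsilon> M (int i)\<bar> \<le> K"
    using coding_bounded[OF integer_approx_A] by blast
  have "range (\<lambda>j. tail \<epsilon> (- int j)) \<subseteq> {\<eta>. \<exists>a. integer_approx \<eta> a \<and> (\<forall>i<m. \<bar>a (int i)\<bar> \<le> K)}"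
    using approx K X by blast
  then have "finite (range (\<lambda>j. tail \<epsilon> (- int j)))"
    by (rule finite_subset) (rule finite_bounded_integer_approx)
  then show "periodic \<epsilon> \<and> tail \<epsilon> 1 \<in> pisot_set \<beta>"
    using finite_tails_imp_periodic[OF X] approx by (auto simp: pisot_set_iff)
next
  assume *: "periodic \<epsilon> \<and> tail \<epsilon> 1 \<in> pisot_set \<beta>"
  \<comment> \<open>The zero sequence has coding 0, so the congruence for two periodic sequences
    becomes integrality.\<close>
  have "periodic (\<lambda>_. 0)"
    by (auto simp: periodic_def)
  then have "coding 1 A \<epsilon> 1 n - coding 1 A (\<lambda>_. 0) 1 n \<in> \<int>" for n
    using * by (intro periodic_coding_diff_Ints X zero_in_X integer_approx_A) (auto simp: tail_zero)
  then show "\<phi> \<epsilon> = \<one>\<^bsub>torus m\<^esub>"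
    by (simp add: \<phi>_eq_one_iff[OF X] coding_zero)
qed

text \<open>The integral difference of the codings approximates \<open>\<xi>\<close> times the
  difference of the remainders. Numbers with such an approximation are multiples of
  \<open>\<xi>\<close> by elements of \<int>[\<beta>], and \<open>\<xi>\<close> cancels.\<close>

lemma \<phi>0_eq_imp_tail_diff:
  assumes X: "\<epsilon> \<in> X" "\<epsilon>' \<in> X" and eq: "\<phi>0 \<epsilon> = \<phi>0 \<epsilon>'"
  shows "tail \<epsilon> 1 - tail \<epsilon>' 1 \<in> int_ring_ext \<beta>"
proof -
  let ?a = "\<lambda>n. coding \<xi> H \<epsilon> 1 n - coding \<xi> H \<epsilon>' 1 n"
  have "(\<lambda>n. (\<xi> * tail \<epsilon> 1 * \<beta> powi int n - coding \<xi> H \<epsilon> 1 (int n))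
      - (\<xi> * tail \<epsilon>' 1 * \<beta> powi int n - coding \<xi> H \<epsilon>' 1 (int n))) \<longlonglongrightarrow> 0 - 0"
    by (intro tendsto_diff coding_tendsto X integer_approx_H)
  then have "(\<lambda>n. \<xi> * (tail \<epsilon> 1 - tail \<epsilon>' 1) * \<beta> powi int n - ?a (int n)) \<longlonglongrightarrow> 0"
    by (simp add: algebra_simps)
  moreover have "recurrent ?a"
    by (intro recurrent_minus coding_recurrent X integer_approx_H)
  moreover have "\<forall>n. ?a n \<in> \<int>"
    using eq X by (simp add: \<phi>0_eq_iff)
  ultimately have "integer_approx (\<xi> * (tail \<epsilon> 1 - tail \<epsilon>' 1)) ?a"
    by (simp add: integer_approx_def)
  from integer_approx_imp_\<xi>_mult[OF this] show ?thesis
    using poly_h_nonzero by (auto simp: \<xi>_def)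
qed

lemma periodic_tail_diff_imp_\<phi>0_eq:
  assumes X: "\<epsilon> \<in> X" "\<epsilon>' \<in> X" and per: "periodic \<epsilon>" "periodic \<epsilon>'"
    and diff: "tail \<epsilon> 1 - tail \<epsilon>' 1 \<in> int_ring_ext \<beta>"
  shows "\<phi>0 \<epsilon> = \<phi>0 \<epsilon>'"
  unfolding \<phi>0_eq_iff[OF X]
  by (intro allI periodic_coding_diff_Ints X per integer_approx_H pisot_set_mult \<xi>_in_pisot_set diff)

lemma mem_coset_iff: "y \<in> (+) x ` int_ring_ext \<beta> \<longleftrightarrow> y - x \<in> int_ring_ext \<beta>"
  by (auto simp: image_iff intro: bexI[of _ "y - x"])

text \<open>By \<open>tail_class\<close>, agreement with an expansion from some place on becomes a
  condition on the class of the remainder at 1. Conversely, \<open>tail \<epsilon> 1\<close> is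
  itself a nonnegative element of the coset whose expansion agrees from place 1 on.\<close>

lemma periodic_tails_eq:
  "periodic_tails \<beta> ((+) x ` int_ring_ext \<beta>)
    = {\<epsilon> \<in> X. periodic \<epsilon> \<and> tail \<epsilon> 1 - x \<in> int_ring_ext \<beta>}"
proof (intro equalityI subsetI)
  fix \<epsilon> assume "\<epsilon> \<in> periodic_tails \<beta> ((+) x ` int_ring_ext \<beta>)"
  then obtain \<xi>' n0 where X: "\<epsilon> \<in> X" and per: "periodic \<epsilon>"
    and coset: "\<xi>' \<in> (+) x ` int_ring_ext \<beta>" "\<xi>' \<ge> 0" and n0: "\<And>n. n \<ge> n0 \<Longrightarrow> \<epsilon> n = beta_expansion \<beta> \<xi>' n"
    unfolding periodic_tails_def periodic_def by blast
  have \<xi>': "\<xi>' - x \<in> int_ring_ext \<beta>" "\<xi>' \<ge> 0"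
    using coset by (simp_all only: mem_coset_iff)
  define e where "e = beta_expansion \<beta> \<xi>'"
  obtain v n1 where v: "remainders \<beta> e v" "v n1 = \<beta> powi (n1 - 1) * \<xi>'"
    using beta_expansion_remainders[OF beta_gt_1 \<xi>'(2)] unfolding e_def by blast
  note e = X_tail[OF v(1)]
  have "\<beta> powi (1 - n1) * tail e n1 = \<xi>'"
    by (simp add: e(2) v(2) power_int_diff)
  then have d1: "tail e 1 - \<xi>' \<in> int_ring_ext \<beta>"
    using int_ring_ext_uminus[OF tail_class[OF e(1), of n1]] by simp
  have d2: "\<beta> powi (1 - n0) * tail e n0 - tail \<epsilon> 1 \<in> int_ring_ext \<beta>"
    using tail_class[OF X, of n0] tail_value_cong[of n0 \<epsilon> e] n0 by (simp add: e_def)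
  have d3: "\<beta> powi (1 - n0) * tail e n0 - tail e 1 \<in> int_ring_ext \<beta>"
    by (rule tail_class[OF e(1)])
  from int_ring_ext_add[OF int_ring_ext_add[OF int_ring_ext_diff[OF d3 d2] d1] \<xi>'(1)] show "\<epsilon> \<in> {\<epsilon> \<in> X. periodic \<epsilon> \<and> tail \<epsilon> 1 - x \<in> int_ring_ext \<beta>}"
    using X per by (simp add: algebra_simps)
next
  fix \<epsilon> assume "\<epsilon> \<in> {\<epsilon> \<in> X. periodic \<epsilon> \<and> tail \<epsilon> 1 - x \<in> int_ring_ext \<beta>}"
  then have \<epsilon>: "\<epsilon> \<in> X" "periodic \<epsilon>" "tail \<epsilon> 1 \<in> (+) x ` int_ring_ext \<beta>"
    by (auto simp: mem_coset_iff)
  have "\<forall>n\<ge>1. \<epsilon> n = beta_expansion \<beta> (tail \<epsilon> 1) n"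
    using beta_expansion_eq_remainder_digits[OF beta_gt_1] \<epsilon>(1) by (simp add: X_iff)
  then show "\<epsilon> \<in> periodic_tails \<beta> ((+) x ` int_ring_ext \<beta>)"
    using \<epsilon> tail_range(1)[OF \<epsilon>(1), of 1] unfolding periodic_tails_def periodic_def by blast
qed

lemma \<phi>0_class_eq_periodic_tails:
  assumes X: "\<epsilon> \<in> X" and one: "\<phi> \<epsilon> = \<one>\<^bsub>torus m\<^esub>"
  shows "{\<epsilon>' \<in> X. \<phi>0 \<epsilon>' = \<phi>0 \<epsilon>} = periodic_tails \<beta> ((+) (tail \<epsilon> 1) ` int_ring_ext \<beta>)"
proof -
  have "periodic \<epsilon>"
    using one by (simp add: \<phi>_eq_one_iff_periodic[OF X])
  moreover have "periodic \<epsilon>'" if "\<epsilon>' \<in> X" "\<phi>0 \<epsilon>' = \<phi>0 \<epsilon>" for \<epsilon>'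
    using \<phi>0_eq_imp_\<phi>_eq[OF that(1) X that(2)] one \<phi>_eq_one_iff_periodic[OF that(1)] by simp
  ultimately show ?thesis
    unfolding periodic_tails_eq
    using \<phi>0_eq_imp_tail_diff[OF _ X] periodic_tail_diff_imp_\<phi>0_eq[OF _ X] by blast
qed

text \<open>Nonemptiness of g([\<xi>]): only a nonempty set of tails can be an element of the
  quotient, whose elements are equivalence classes.\<close>

lemma ex_periodic_tail:
  assumes "x \<in> pisot_set \<beta>"
  shows "\<exists>\<epsilon>\<in>X. periodic \<epsilon> \<and> tail \<epsilon> 1 - x \<in> int_ring_ext \<beta>"
proof -
  \<comment> \<open>A representative of the coset in [0,1), so that the expansion has no digits
    before place 1.\<close>
  define r where "r = frac x"
  have r_x: "r - x \<in> int_ring_ext \<beta>"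
    using int_ring_ext_of_int[of "- \<lfloor>x\<rfloor>" \<beta>] by (simp add: r_def frac_def)
  have "r = (r - x) * 1 + x" by simp
  then have "r \<in> pisot_set \<beta>"
    using pisot_set_add[OF pisot_set_mult[OF one_in_pisot_set r_x] assms] by simp
  then obtain b where b: "integer_approx r b"
    by (auto simp: pisot_set_iff)
  define e where "e = beta_expansion \<beta> r"
  obtain v n0 where v: "remainders \<beta> e v" "v n0 = \<beta> powi (n0 - 1) * r" "n0 = 1" "\<forall>n<n0. e n = 0"
    using beta_expansion_remainders[OF beta_gt_1, of r] frac_lt_1[of x] unfolding e_def r_def by auto
  note e = X_tail[OF v(1)]
  have tail_e: "tail e 1 = r"
    using v(2,3) e(2) by simp
  have e_zero: "e n = 0" if "n < 1" for n
    using v(3,4) that by simp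
  define \<delta> where "\<delta> n = r * \<beta> powi n - b n" for n
  have \<delta>_lim: "(\<lambda>n. \<delta> (int n)) \<longlonglongrightarrow> 0"
    using b by (simp add: integer_approx_def \<delta>_def)
  have \<delta>_rec: "recurrent \<delta>"
    using b unfolding \<delta>_def by (intro recurrent_minus recurrent_powi) (simp add: integer_approx_def)
  obtain B where B: "\<And>n. \<bar>\<delta> (int n)\<bar> \<le> B"
    using Bseq_eq_bounded convergentI[OF \<delta>_lim, THEN convergent_imp_Bseq]
    by (auto simp: Bseq_def)
  \<comment> \<open>At origin 1 the coding of \<open>e\<close> is exactly r \<beta>^n and misses the
    integers b(n) by \<open>\<delta>\<close>. Subtracting the translated \<open>\<delta>\<close>
    makes the coding integral at every later origin, and \<open>\<delta>\<close> is bounded to the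
    right, so the bound stays uniform.\<close>
  define a where "a N n = coding 1 A e (1 + int N) n - \<delta> (n + int N)" for N n
  have a_int: "\<forall>n. a N n \<in> \<int>" for N
  proof (induction N)
    case 0
    have "a 0 n = b n" for n
      by (simp add: a_def coding_def e_zero tail_e \<delta>_def)
    then show ?case
      using b by (simp add: integer_approx_def)
  next
    case (Suc N)
    have "a (Suc N) n = a N (n + 1) - real (e (1 + int N)) * A n" for n
      using coding_step[OF e(1) integer_approx_A, of "1 + int N" n] by (simp add: a_def algebra_simps)
    then show ?case
      using Suc integer_approx_A by (simp add: integer_approx_def Ints_diff Ints_mult)
  qed
  have approx: "integer_approx (tail e (1 + int N)) (a N)" for N
  proof -
    have "recurrent (a N)"
      unfolding a_def by (intro recurrent_minus coding_recurrent e(1) integer_approx_A recurrent_translate \<delta>_rec)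
    moreover have "(\<lambda>n. (1 * tail e (1 + int N) * \<beta> powi int n - coding 1 A e (1 + int N) (int n)) + \<delta> (int (n + N))) \<longlonglongrightarrow> 0 + 0"
      by (intro tendsto_add coding_tendsto e(1) integer_approx_A LIMSEQ_ignore_initial_segment[OF \<delta>_lim])
    then have "(\<lambda>n. tail e (1 + int N) * \<beta> powi int n - a N (int n)) \<longlonglongrightarrow> 0"
      by (simp add: a_def algebra_simps)
    ultimately show ?thesis
      using a_int by (simp add: integer_approx_def)
  qed
  obtain K where K: "\<forall>\<epsilon>\<in>X. \<forall>M. \<forall>i<m. \<bar>coding 1 A \<epsilon> M (int i)\<bar> \<le> K"
    using coding_bounded[OF integer_approx_A] by blast
  have "\<bar>a N (int i)\<bar> \<le> K + B" if "i < m" for N i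
  proof -
    have "\<bar>coding 1 A e (1 + int N) (int i)\<bar> \<le> K"
      using K e(1) that by blast
    then show ?thesis
      using B[of "i + N"] by (simp add: a_def)
  qed
  then have "range (\<lambda>N. tail e (1 + int N)) \<subseteq> {\<eta>. \<exists>a. integer_approx \<eta> a \<and> (\<forall>i<m. \<bar>a (int i)\<bar> \<le> K + B)}"
    using approx by blast
  then have "finite (range (\<lambda>N. tail e (1 + int N)))"
    by (rule finite_subset) (rule finite_bounded_integer_approx)
  then have "\<not> inj (\<lambda>N. tail e (1 + int N))"
    using finite_imageD infinite_UNIV_nat by blast
  then obtain N1 N2 where N: "N1 < N2" "tail e (1 + int N1) = tail e (1 + int N2)"
    unfolding inj_def by (metis linorder_neqE_nat)
  define p where "p = N2 - N1"
  define M where "M = 1 + int N1"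
  have p: "p > 0" "tail e (M + int p) = tail e M"
    using N by (simp_all add: p_def M_def of_nat_diff)
  \<comment> \<open>Folds \<int> onto one period starting at \<open>M\<close>. At the seam the
    remainder recursion holds because the remainders at \<open>M\<close> and \<open>M + p\<close>
    agree.\<close>
  define f where "f n = M + (n - M) mod int p" for n
  have tail_f: "tail e (f (n + 1)) = tail e (f n + 1)" for n
  proof (cases "(n - M) mod int p = int p - 1")
    case True
    then have "(n + 1 - M) mod int p = 0"
      using p(1) by (metis add_diff_eq add.commute diff_add_cancel mod_add_left_eq mod_self)
    with True p(2) show ?thesis
      by (simp add: f_def)
  next
    case False
    moreover have "0 \<le> (n - M) mod int p" "(n - M) mod int p < int p"
      using p(1) by simp_all
    ultimately have "((n - M) mod int p + 1) mod int p = (n - M) mod int p + 1"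
      by (intro mod_pos_pos_trivial) auto
    then have "(n + 1 - M) mod int p = (n - M) mod int p + 1"
      by (metis add_diff_eq add.commute mod_add_left_eq)
    then show ?thesis
      by (simp add: f_def add.assoc)
  qed
  have "remainders \<beta> (\<lambda>n. e (f n)) (\<lambda>n. tail e (f n))"
    using tail_range[OF e(1)] tail_step[OF e(1)] by (simp add: remainders_def tail_f)
  note \<epsilon> = X_tail[OF this]
  have "n + int p - M = (n - M) + int p" for n
    by simp
  then have "f (n + int p) = f n" for n
    by (simp only: f_def mod_add_self2)
  then have "periodic (\<lambda>n. e (f n))"
    using p(1) by (auto simp: periodic_def)
  moreover have "f M = M"
    by (simp add: f_def)
  then have "\<beta> powi (1 - M) * tail e M - tail (\<lambda>n. e (f n)) 1 \<in> int_ring_ext \<beta>"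
    using tail_class[OF \<epsilon>(1), of M] by (simp add: \<epsilon>(2))
  from int_ring_ext_add[OF int_ring_ext_diff[OF tail_class[OF e(1), of M] this] r_x]
  have "tail (\<lambda>n. e (f n)) 1 - x \<in> int_ring_ext \<beta>"
    by (simp add: tail_e)
  ultimately show ?thesis
    using \<epsilon>(1) by blast
qed

end

section \<open>Surjectivity\<close>

text \<open>The diagonal argument over an enumeration of \<int>; for a single coordinate a bounded
  monotone subsequence suffices.\<close>

lemma ex_pointwise_convergent_subsequence:
  fixes f :: "nat \<Rightarrow> int \<Rightarrow> real"
  assumes bound: "\<And>N n. \<bar>f N n\<bar> \<le> K"
  shows "\<exists>s w. strict_mono (s :: nat \<Rightarrow> nat) \<and> (\<forall>n. (\<lambda>N. f (s N) n) \<longlonglongrightarrow> w n)"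
proof -
  interpret subseqs "\<lambda>j s. convergent (\<lambda>N. f (s N) (int_decode j))"
  proof
    fix j and s :: "nat \<Rightarrow> nat"
    obtain r where r: "strict_mono r" "monoseq (\<lambda>N. f (s (r N)) (int_decode j))"
      using seq_monosub[of "\<lambda>N. f (s N) (int_decode j)"] by blast
    moreover have "Bseq (\<lambda>N. f (s (r N)) (int_decode j))"
      by (rule BseqI'[of _ K]) (simp add: bound)
    ultimately have "strict_mono r \<and> convergent (\<lambda>N. f ((s \<circ> r) N) (int_decode j))"
      by (simp add: Bseq_monoseq_convergent)
    then show "\<exists>r' :: nat \<Rightarrow> nat. strict_mono r' \<and> convergent (\<lambda>N. f ((s \<circ> r') N) (int_decode j))"
      by (rule exI[of _ r])
  qed
  have "convergent (\<lambda>N. f (diagseq N) n)" for n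
  proof -
    \<comment> \<open>The diagonal sequence is known to refine the stage belonging to
      \<open>n\<close> only after its initial terms, hence the shift.\<close>
    have "convergent (\<lambda>N. f ((diagseq \<circ> (+) (Suc (int_encode n))) N) (int_decode (int_encode n)))"
    proof (rule diagseq_holds)
      fix r s :: "nat \<Rightarrow> nat" and j
      assume "strict_mono r" "convergent (\<lambda>N. f (s N) (int_decode j))"
      then show "convergent (\<lambda>N. f ((s \<circ> r) N) (int_decode j))"
        using convergent_subseq_convergent[of "\<lambda>N. f (s N) (int_decode j)" r] by (simp add: o_def)
    qed
    then have "convergent (\<lambda>N. f (diagseq (N + Suc (int_encode n))) n)"
      by (simp add: o_def add.commute)
    then show ?thesis
      using convergent_ignore_initial_segment[of "\<lambda>N. f (diagseq N) n" "Suc (int_encode n)"] by simp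
  qed
  then have "(\<lambda>N. f (diagseq N) n) \<longlonglongrightarrow> lim (\<lambda>N. f (diagseq N) n)" for n
    by (simp add: convergent_LIMSEQ_iff)
  then show ?thesis
    by (intro exI[of _ diagseq] exI[of _ "\<lambda>n. lim (\<lambda>N. f (diagseq N) n)"] conjI subseq_diagseq allI)
qed

text \<open>Dominated convergence for series: the differences are dominated by 2 B |d k|, whose tail
  is small uniformly in \<open>N\<close>, and the finitely many remaining terms converge.\<close>

lemma tendsto_suminf_mult_bounded:
  fixes x :: "nat \<Rightarrow> nat \<Rightarrow> real"
  assumes lim: "\<And>k. (\<lambda>N. x N k) \<longlonglongrightarrow> y k" and bound: "\<And>N k. \<bar>x N k\<bar> \<le> B"
    and d: "summable (\<lambda>k. \<bar>d k\<bar>)"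
  shows "(\<lambda>N. \<Sum>k. x N k * d k) \<longlonglongrightarrow> (\<Sum>k. y k * d k)"
proof -
  have y_bound: "\<bar>y k\<bar> \<le> B" for k
    by (rule LIMSEQ_le_const2[OF tendsto_rabs[OF lim]]) (use bound in blast)
  have sB: "summable (\<lambda>k. 2 * B * \<bar>d k\<bar>)"
    by (intro summable_mult d)
  define f where "f N k = (x N k - y k) * d k" for N k
  have f_le: "\<bar>f N k\<bar> \<le> 2 * B * \<bar>d k\<bar>" for N k
    unfolding f_def abs_mult using bound[of N k] y_bound[of k] by (intro mult_right_mono) auto
  have summable_bounded: "summable (\<lambda>k. z k * d k)" if "\<And>k. \<bar>z k\<bar> \<le> B" for z
    by (rule summable_comparison_test'[OF summable_mult[OF d, of B], of 0])
       (use that in \<open>auto simp: abs_mult intro: mult_right_mono\<close>)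
  have sf_abs: "summable (\<lambda>k. \<bar>f N k\<bar>)" for N
    by (rule summable_comparison_test'[OF sB, of 0]) (use f_le in auto)
  then have sf: "summable (f N)" for N
    by (rule summable_rabs_cancel)
  have "(\<lambda>N. suminf (f N)) \<longlonglongrightarrow> 0"
  proof (rule LIMSEQ_I)
    fix e :: real assume "e > 0"
    then obtain K where K: "\<And>n. n \<ge> K \<Longrightarrow> norm (\<Sum>i. 2 * B * \<bar>d (i + n)\<bar>) < e / 2"
      using suminf_exist_split[OF _ sB, of "e / 2"] by auto
    have "(\<lambda>N. \<Sum>k<K. f N k) \<longlonglongrightarrow> 0"
      unfolding f_def by (intro tendsto_null_sum tendsto_mult_left_zero LIM_zero lim)
    then obtain N0 where N0: "\<And>N. N \<ge> N0 \<Longrightarrow> \<bar>\<Sum>k<K. f N k\<bar> < e / 2"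
      using LIMSEQ_D[of _ 0 "e / 2"] \<open>e > 0\<close> by fastforce
    have "norm (suminf (f N) - 0) < e" if "N \<ge> N0" for N
    proof -
      have "\<bar>\<Sum>k. f N (k + K)\<bar> \<le> (\<Sum>k. \<bar>f N (k + K)\<bar>)"
        by (rule summable_rabs[OF summable_ignore_initial_segment[OF sf_abs]])
      also have "\<dots> \<le> (\<Sum>k. 2 * B * \<bar>d (k + K)\<bar>)"
        by (intro suminf_le f_le summable_ignore_initial_segment[OF sf_abs]
            summable_ignore_initial_segment[OF sB])
      also have "\<dots> < e / 2"
        using K[of K] by simp
      finally show ?thesis
        using N0[OF that] suminf_split_initial_segment[OF sf, of N K] by simp
    qed
    then show "\<exists>N0. \<forall>N\<ge>N0. norm (suminf (f N) - 0) < e"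
      by blast
  qed
  moreover have "suminf (f N) = (\<Sum>k. x N k * d k) - (\<Sum>k. y k * d k)" for N
    unfolding f_def left_diff_distrib
    by (rule suminf_diff[symmetric]) (intro summable_bounded bound y_bound)+
  ultimately show ?thesis
    by (simp add: LIM_zero_iff)
qed

lemma dist_nearest_int_lim:
  assumes "f \<longlonglongrightarrow> L" "(\<lambda>N. dist_nearest_int (f N)) \<longlonglongrightarrow> 0"
  shows "L \<in> \<int>"
proof -
  have "dist_nearest_int L \<le> dist_nearest_int (f N) + \<bar>L - f N\<bar>" for N
    using dist_nearest_int_triangle[of "f N" "L - f N"] dist_nearest_int_le[of "L - f N" 0] by simp
  moreover have "(\<lambda>N. dist_nearest_int (f N) + \<bar>L - f N\<bar>) \<longlonglongrightarrow> 0 + \<bar>L - L\<bar>"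
    by (intro tendsto_intros assms)
  ultimately have "dist_nearest_int L \<le> 0"
    by (intro LIMSEQ_le_const[where a = "dist_nearest_int L"]) auto
  then show ?thesis
    by (simp add: antisym dist_nearest_int_eq_0_iff[symmetric])
qed

context finitary_pisot
begin

lemma coding_base_change_Xbar:
  assumes "\<epsilon> \<in> Xbar" "integer_approx \<eta> a"
  shows "coding \<eta> a \<epsilon> M n - coding \<eta> a \<epsilon> 1 (n + M - 1) \<in> \<int>"
proof -
  have a: "a n \<in> \<int>" for n
    using assms(2) by (simp add: integer_approx_def)
  have "\<forall>n. coding \<eta> a \<epsilon> M n - coding \<eta> a \<epsilon> 1 (n + M - 1) \<in> \<int>"
  proof (induction M rule: int_induct_bidirectional[where a = 1])
    case (2 M)
    show ?case
    proof
      fix n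
      have "coding \<eta> a \<epsilon> (M + 1) n - coding \<eta> a \<epsilon> 1 (n + (M + 1) - 1)
          = coding \<eta> a \<epsilon> M (n + 1) - coding \<eta> a \<epsilon> 1 (n + 1 + M - 1) - real (\<epsilon> M) * a n"
        using coding_step_Xbar[OF assms, of M n] by (simp add: algebra_simps)
      moreover have "coding \<eta> a \<epsilon> M (n + 1) - coding \<eta> a \<epsilon> 1 (n + 1 + M - 1) - real (\<epsilon> M) * a n \<in> \<int>"
        by (intro Ints_diff Ints_mult a 2[rule_format]) simp
      ultimately show "coding \<eta> a \<epsilon> (M + 1) n - coding \<eta> a \<epsilon> 1 (n + (M + 1) - 1) \<in> \<int>"
        by (simp only:)
    qed
  next
    case (3 M)
    show ?case
    proof
      fix n
      have "coding \<eta> a \<epsilon> (M - 1) n - coding \<eta> a \<epsilon> 1 (n + (M - 1) - 1)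
          = coding \<eta> a \<epsilon> M (n - 1) - coding \<eta> a \<epsilon> 1 (n - 1 + M - 1) + real (\<epsilon> (M - 1)) * a (n - 1)"
        using coding_step_Xbar[OF assms, of "M - 1" "n - 1"] by (simp add: algebra_simps)
      moreover have "coding \<eta> a \<epsilon> M (n - 1) - coding \<eta> a \<epsilon> 1 (n - 1 + M - 1) + real (\<epsilon> (M - 1)) * a (n - 1) \<in> \<int>"
        by (intro Ints_add Ints_mult a 3[rule_format]) simp
      ultimately show "coding \<eta> a \<epsilon> (M - 1) n - coding \<eta> a \<epsilon> 1 (n + (M - 1) - 1) \<in> \<int>"
        by (simp only:)
    qed
  qed simp
  then show ?thesis by blast
qed

text \<open>With the origin at the start of the greedy expansion of \<open>P\<close> there are no
  digits to the left. The series vanishes, the coding is exactly the scaled remainder, and moving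
  the origin to 1 costs integers.\<close>

lemma ex_coding_real:
  assumes "P \<ge> 0"
  shows "\<exists>\<epsilon>\<in>X. \<forall>n. coding \<xi> H \<epsilon> 1 n - \<xi> * P * \<beta> powi n \<in> \<int>"
proof -
  define e where "e = beta_expansion \<beta> P"
  obtain v n0 where v: "remainders \<beta> e v" "v n0 = \<beta> powi (n0 - 1) * P" "\<forall>n<n0. e n = 0"
    using beta_expansion_remainders[OF beta_gt_1 assms] unfolding e_def by blast
  note e = X_tail[OF v(1)]
  have "coding \<xi> H e 1 n - \<xi> * P * \<beta> powi n \<in> \<int>" for n
  proof -
    have "\<beta> powi (n0 - 1) * \<beta> powi (n - (n0 - 1)) = \<beta> powi n"
      by (simp flip: power_int_add)
    then have "coding \<xi> H e n0 (n - (n0 - 1)) = \<xi> * P * \<beta> powi n"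
      using v(2,3) by (simp add: coding_def e(2) mult.assoc mult.left_commute)
    then show ?thesis
      using Ints_minus[OF coding_base_change_Xbar[OF X_imp_Xbar[OF e(1)] integer_approx_H, of n0 "n - (n0 - 1)"]]
      by simp
  qed
  then show ?thesis
    using e(1) by blast
qed

text \<open>
  Far to the left, a recurrent sequence is made bounded by subtracting an integer-valued one; the
  contracting part of what remains has died out near the origin. Enlarging one value by a constant makes
  the coefficient of the expanding part nonnegative.
\<close>

lemma ex_coding_approx:
  assumes u: "recurrent u"
  shows "\<exists>es. (\<forall>N. es N \<in> X) \<and>
    (\<forall>i<m. (\<lambda>N. dist_nearest_int (coding \<xi> H (es N) 1 (- int i) - u (- int i))) \<longlonglongrightarrow> 0)"
proof -
  \<comment> \<open>Fractional parts contribute to \<open>c N\<close> at least minus the sum of the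
    |coeff h l|. Adding \<open>K\<close> to the top window entry, where \<open>h\<close> has
    coefficient 1, compensates; as \<open>K\<close> is an integer, congruence with \<open>u\<close>
    survives.\<close>
  define K :: nat where "K = nat \<lceil>\<Sum>l<m. \<bar>coeff h l\<bar>\<rceil>"
  have K: "(\<Sum>l<m. \<bar>coeff h l\<bar>) \<le> real K"
    unfolding K_def by linarith
  \<comment> \<open>The window read off from \<open>u\<close> occupies the places from
    \<open>- s N\<close> to \<open>- N\<close>.\<close>
  define s where "s N = int N + int (m - 1)" for N
  define y where "y N l = frac (u (int l - s N)) + (if l = m - 1 then real K else 0)" for N l
  define f where "f N n = (\<Sum>l<m. y N l * R l n)" for N n
  define c where "c N = (\<Sum>l<m. y N l * coeff h l)" for N
  define D where "D l n = \<xi> * coeff h l * \<beta> powi n - R l n" for l n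
  have y: "\<bar>y N l\<bar> \<le> real K + 1" for N l
    using frac_lt_1[of "u (int l - s N)"] frac_ge_0[of "u (int l - s N)"] by (auto simp: y_def)
  have f_rec: "recurrent (f N)" for N
    unfolding f_def by (intro recurrent_sum recurrent_cmult R_props)
  have f_window: "f N (int i) = y N i" if "i < m" for N i
  proof -
    have "f N (int i) = (\<Sum>l<m. if i = l then y N l else 0)"
      unfolding f_def by (rule sum.cong) (auto simp: R_props that)
    then show ?thesis using that by simp
  qed
  have f_u: "f N (n + s N) - u n \<in> \<int>" for N n
  proof (rule recurrent_Ints[where a = "- s N" and u = "\<lambda>n. f N (n + s N) - u n"])
    show "recurrent (\<lambda>n. f N (n + s N) - u n)"
      by (intro recurrent_minus recurrent_translate f_rec u)
    show "f N (- s N + int i + s N) - u (- s N + int i) \<in> \<int>" if "i < m" for i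
    proof -
      have "f N (- s N + int i + s N) - u (- s N + int i)
          = (if i = m - 1 then real K else 0) - of_int \<lfloor>u (int i - s N)\<rfloor>"
        using f_window[OF that, of N] by (simp add: y_def frac_def)
      then show ?thesis
        by (simp add: Ints_diff)
    qed
  qed
  have c: "c N \<ge> 0" for N
  proof -
    have "c N = (\<Sum>l<m. frac (u (int l - s N)) * coeff h l) + (\<Sum>l<m. if l = m - 1 then real K * coeff h l else 0)"
      unfolding c_def y_def sum.distrib[symmetric] by (rule sum.cong) (auto simp: distrib_right)
    also have "(\<Sum>l<m. if l = m - 1 then real K * coeff h l else 0) = K"
      using m_pos coeff_h_top by simp
    also have "(\<Sum>l<m. frac (u (int l - s N)) * coeff h l) \<ge> (\<Sum>l<m. - \<bar>coeff h l\<bar>)"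
    proof (rule sum_mono)
      fix l
      have "\<bar>frac (u (int l - s N)) * coeff h l\<bar> \<le> 1 * \<bar>coeff h l\<bar>"
        unfolding abs_mult using frac_lt_1[of "u (int l - s N)"]
        by (intro mult_right_mono) (auto simp: less_imp_le)
      then show "- \<bar>coeff h l\<bar> \<le> frac (u (int l - s N)) * coeff h l"
        by linarith
    qed
    ultimately show ?thesis
      using K by (simp add: sum_negf)
  qed
  have f_split: "f N n = \<xi> * c N * \<beta> powi n - (\<Sum>l<m. y N l * D l n)" for N n
  proof -
    have "\<xi> * c N * \<beta> powi n - (\<Sum>l<m. y N l * D l n)
        = (\<Sum>l<m. \<xi> * (y N l * coeff h l) * \<beta> powi n - y N l * D l n)"
      by (simp add: c_def sum_distrib_left sum_distrib_right sum_subtractf)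
    also have "\<dots> = f N n"
      unfolding f_def by (rule sum.cong) (auto simp: D_def algebra_simps)
    finally show ?thesis by simp
  qed
  have D_lim: "(\<lambda>N. D l (s N - int i)) \<longlonglongrightarrow> 0" if "l < m" for l i
  proof -
    have "summable (\<lambda>n. \<bar>\<xi> * expanding_coeff (R l) * \<beta> powi (int n + (int (m - 1) - int i)) - R l (int n + (int (m - 1) - int i))\<bar>)"
      by (rule summable_contracting_part[OF R_props(1)])
    then have "(\<lambda>n. \<bar>D l (int n + (int (m - 1) - int i))\<bar>) \<longlonglongrightarrow> 0"
      by (intro summable_LIMSEQ_zero) (simp add: D_def expanding_coeff_R that)
    then show ?thesis
      by (simp add: s_def tendsto_rabs_zero_iff add_diff_eq)
  qed
  have "c N * \<beta> powi s N \<ge> 0" for N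
    using c by (simp add: less_imp_le)
  from ex_coding_real[OF this]
  have "\<forall>N. \<exists>\<epsilon>. \<epsilon> \<in> X \<and> (\<forall>n. coding \<xi> H \<epsilon> 1 n - \<xi> * (c N * \<beta> powi s N) * \<beta> powi n \<in> \<int>)"
    by blast
  from choice[OF this] obtain es where "\<forall>N. es N \<in> X \<and>
      (\<forall>n. coding \<xi> H (es N) 1 n - \<xi> * (c N * \<beta> powi s N) * \<beta> powi n \<in> \<int>)"
    by (rule exE)
  then have es: "\<And>N. es N \<in> X"
    "\<And>N n. coding \<xi> H (es N) 1 n - \<xi> * (c N * \<beta> powi s N) * \<beta> powi n \<in> \<int>"
    by blast+
  have "(\<lambda>N. dist_nearest_int (coding \<xi> H (es N) 1 (- int i) - u (- int i))) \<longlonglongrightarrow> 0" for i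
  proof (rule dist_nearest_int_tendsto_0I)
    \<comment> \<open>The sum of two integral discrepancies, of the coding from its real target and
      of the translated \<open>f N\<close> from \<open>u\<close>; what remains is the contracting
      part alone.\<close>
    let ?z = "\<lambda>N. (coding \<xi> H (es N) 1 (- int i) - \<xi> * (c N * \<beta> powi s N) * \<beta> powi (- int i))
       + (f N (- int i + s N) - u (- int i))"
    show "?z N \<in> \<int>" for N
      by (intro Ints_add es(2) f_u)
    have "(\<lambda>N. \<Sum>l<m. y N l * D l (s N - int i)) \<longlonglongrightarrow> 0"
    proof (intro tendsto_null_sum)
      fix l assume "l \<in> {..<m}"
      then have "(\<lambda>N. D l (s N - int i)) \<longlonglongrightarrow> 0"
        by (intro D_lim) simp
      moreover have "norm (y N l * D l (s N - int i)) \<le> norm (D l (s N - int i)) * (real K + 1)" for N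
        unfolding real_norm_def abs_mult mult.commute[of "\<bar>y _ _\<bar>"]
        by (intro mult_left_mono y) simp
      ultimately show "(\<lambda>N. y N l * D l (s N - int i)) \<longlonglongrightarrow> 0"
        by (rule tendsto_0_le[OF _ always_eventually[OF allI]])
    qed
    moreover have "coding \<xi> H (es N) 1 (- int i) - u (- int i) - ?z N = (\<Sum>l<m. y N l * D l (s N - int i))" for N
    proof -
      have "\<beta> powi s N * \<beta> powi (- int i) = \<beta> powi (s N - int i)"
        using power_int_add[of \<beta> "s N" "- int i"] by simp
      then show ?thesis
        using f_split[of N "s N - int i"] by (simp add: mult.assoc)
    qed
    ultimately show "(\<lambda>N. coding \<xi> H (es N) 1 (- int i) - u (- int i) - ?z N) \<longlonglongrightarrow> 0"
      by simp
  qed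
  then show ?thesis
    using es(1) by blast
qed

text \<open>The subsequence is chosen for the remainders, which are uniformly bounded. The recursion
  recovers the digits, and a limit of natural numbers is a natural number. Strict bounds become
  non-strict, hence \<open>Xbar\<close>.\<close>

lemma ex_limit_in_Xbar:
  fixes es :: "nat \<Rightarrow> int \<Rightarrow> nat"
  assumes es: "\<And>N. es N \<in> X" and a: "integer_approx \<eta> a"
  shows "\<exists>\<epsilon>\<in>Xbar. \<exists>s. strict_mono s \<and>
    (\<forall>n. (\<lambda>N. coding \<eta> a (es (s N)) 1 n) \<longlonglongrightarrow> coding \<eta> a \<epsilon> 1 n)"
proof -
  have "\<bar>tail (es N) n\<bar> \<le> 1" for N n
    by (rule tail_range(3)[OF es])
  from ex_pointwise_convergent_subsequence[of "\<lambda>N. tail (es N)", OF this]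
  obtain s :: "nat \<Rightarrow> nat" and w where s: "strict_mono s" and lim: "\<And>n. (\<lambda>N. tail (es (s N)) n) \<longlonglongrightarrow> w n"
    by blast
  have w: "0 \<le> w n" "w n \<le> 1" for n
    using lim[of n] tail_range[OF es]
    by (auto intro: LIMSEQ_le_const LIMSEQ_le_const2 less_imp_le)
  have digit: "real (es (s N) n) = \<beta> * tail (es (s N)) n - tail (es (s N)) (n + 1)" for N n
    using tail_step[OF es] by simp
  have digit_lim': "(\<lambda>N. real (es (s N) n)) \<longlonglongrightarrow> \<beta> * w n - w (n + 1)" for n
    unfolding digit by (intro tendsto_intros lim)
  define \<epsilon> where "\<epsilon> n = nat \<lfloor>\<beta> * w n - w (n + 1)\<rfloor>" for n
  have \<epsilon>: "real (\<epsilon> n) = \<beta> * w n - w (n + 1)" for n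
  proof -
    have "(\<lambda>N. dist_nearest_int (real (es (s N) n))) \<longlonglongrightarrow> 0"
      by (simp add: dist_nearest_int_eq_0_iff[THEN iffD2])
    from dist_nearest_int_lim[OF digit_lim' this] have "\<beta> * w n - w (n + 1) \<in> \<int>" .
    moreover have "\<beta> * w n - w (n + 1) \<ge> 0"
      using digit_lim'[of n] by (rule LIMSEQ_le_const) auto
    ultimately show ?thesis
      by (auto simp: \<epsilon>_def elim!: Ints_cases)
  qed
  have digit_lim: "(\<lambda>N. real (es (s N) n)) \<longlonglongrightarrow> real (\<epsilon> n)" for n
    unfolding \<epsilon> by (rule digit_lim')
  have "tail \<epsilon> n = w n" for n
  proof -
    have "(\<lambda>i. real (\<epsilon> (n + int i)) * inverse \<beta> ^ Suc i) sums w n"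
      by (rule recursion_sums[OF beta_gt_1, where K = 1]) (use w in \<open>auto simp: \<epsilon>\<close>)
    then show ?thesis
      by (simp add: tail_value_def sums_iff)
  qed
  then have tail: "tail \<epsilon> = w" by blast
  have "\<epsilon> \<in> Xbar"
    using w by (simp add: Xbar_def tail \<epsilon>)
  moreover have "(\<lambda>N. coding \<eta> a (es (s N)) 1 n) \<longlonglongrightarrow> coding \<eta> a \<epsilon> 1 n" for n
  proof -
    define D where "D k = \<eta> * \<beta> powi (n + int k) - a (n + int k)" for k
    have sD: "summable (\<lambda>k. \<bar>D k\<bar>)"
      using integer_approx_summable[OF a, of n] by (simp add: D_def add.commute)
    have "(\<lambda>N. \<Sum>k. real (es (s N) (1 - 1 - int k)) * D k) \<longlonglongrightarrow> (\<Sum>k. real (\<epsilon> (1 - 1 - int k)) * D k)"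
      by (rule tendsto_suminf_mult_bounded[where B = \<beta>])
         (use X_digit_bound[OF es] sD digit_lim in auto)
    then show ?thesis
      unfolding coding_def tail D_def by (intro tendsto_intros lim)
  qed
  ultimately show ?thesis
    using s by blast
qed

text \<open>
  A remainder equal to \<open>1\<close> is turned into a carry at the first place where it occurs. If there is no first
  place, the partial values are infinitely often powers of \<open>\<beta>\<close>, and the coding is that of \<open>0\<close>.
\<close>

lemma Xbar_coding_equiv_X:
  assumes "\<epsilon> \<in> Xbar"
  shows "\<exists>\<epsilon>'\<in>X. \<forall>n. coding \<xi> H \<epsilon>' 1 n - coding \<xi> H \<epsilon> 1 n \<in> \<int>"
proof -
  have less_1_iff: "tail \<epsilon> n < 1 \<longleftrightarrow> tail \<epsilon> n \<noteq> 1" for n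
    using assms by (simp add: Xbar_def less_le)
  consider (strict) "\<forall>n. tail \<epsilon> n < 1" | (first) n where "tail \<epsilon> n = 1" "\<forall>j<n. tail \<epsilon> j < 1"
    | (unbounded) "\<forall>k. \<exists>n<k. tail \<epsilon> n = 1"
  proof (cases "\<forall>k. \<exists>n<k. tail \<epsilon> n = 1")
    case False
    then obtain k where k: "\<And>n. n < k \<Longrightarrow> tail \<epsilon> n < 1"
      unfolding less_1_iff by blast
    show ?thesis
    proof (cases "\<forall>n. tail \<epsilon> n < 1")
      case False
      then obtain n1 where n1: "tail \<epsilon> n1 = 1"
        unfolding less_1_iff by blast
      define j where "j = (LEAST j. tail \<epsilon> (k + int j) = 1)"
      have "n1 = k + int (nat (n1 - k))"
        using k[of n1] n1 by (cases "n1 < k") auto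
      then have "tail \<epsilon> (k + int (nat (n1 - k))) = 1"
        using n1 by simp
      then have "tail \<epsilon> (k + int j) = 1"
        unfolding j_def by (rule LeastI)
      moreover have "tail \<epsilon> i < 1" if "i < k + int j" for i
      proof (cases "i < k")
        case False
        then have "tail \<epsilon> (k + int (nat (i - k))) \<noteq> 1"
          using that not_less_Least[of "nat (i - k)" "\<lambda>j. tail \<epsilon> (k + int j) = 1"] unfolding j_def by simp
        then show ?thesis
          using False by (simp add: less_1_iff)
      qed (use k in blast)
      ultimately show ?thesis using first by blast
    qed (use strict in blast)
  qed (use unbounded in blast)
  then show ?thesis
  proof cases
    case strict
    then have "\<epsilon> \<in> X"
      using assms by (simp add: X_iff remainders_def Xbar_def)
    then show ?thesis by (intro bexI[of _ \<epsilon>]) simp_all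
  next
    case (first n)
    \<comment> \<open>A remainder 1 at \<open>n\<close> is worth one unit of the digit before it.
      Deleting the digits from \<open>n\<close> on and raising that digit leaves every earlier
      remainder unchanged.\<close>
    define e where "e i = (if i < n - 1 then \<epsilon> i else if i = n - 1 then \<epsilon> i + 1 else 0)" for i
    define v where "v i = (if i < n then tail \<epsilon> i else 0)" for i
    have "\<beta> * v i = real (e i) + v (i + 1)" for i
      using tail_step_Xbar[OF assms, of i] first(1) by (auto simp: v_def e_def)
    then have "remainders \<beta> e v"
      using first(2) assms by (simp add: remainders_def v_def Xbar_def)
    note e = X_tail[OF this]
    \<comment> \<open>Seen from the origin \<open>n - 1\<close> the carry is invisible: the
      remainder there and all earlier digits agree.\<close>
    have "coding \<xi> H e (n - 1) i = coding \<xi> H \<epsilon> (n - 1) i" for i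
      by (simp add: coding_def e(2)) (simp add: v_def e_def)
    then have "coding \<xi> H e 1 i - coding \<xi> H \<epsilon> 1 i \<in> \<int>" for i
      using Ints_diff[OF coding_base_change_Xbar[OF assms integer_approx_H, of "n - 1" "i - (n - 1) + 1"]
          coding_base_change_Xbar[OF X_imp_Xbar[OF e(1)] integer_approx_H, of "n - 1" "i - (n - 1) + 1"]]
      by simp
    then show ?thesis
      using e(1) by blast
  next
    case unbounded
    have "infinite {N. tail \<epsilon> (- int N) = 1}"
      unfolding infinite_nat_iff_unbounded
    proof
      fix N
      obtain n where "n < - int N" "tail \<epsilon> n = 1"
        using unbounded by blast
      then show "\<exists>k>N. k \<in> {N. tail \<epsilon> (- int N) = 1}"
        by (intro exI[of _ "nat (- n)"]) auto
    qed
    then obtain s :: "nat \<Rightarrow> nat" where s: "strict_mono s" "\<And>k. tail \<epsilon> (- int (s k)) = 1"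
      using infinite_enumerate by blast
    have "coding \<xi> H \<epsilon> 1 n - coding \<xi> H (\<lambda>_. 0) 1 n \<in> \<int>" for n
    proof (rule coding_diff_Ints[OF assms X_imp_Xbar[OF zero_in_X] integer_approx_H s(1)])
      have "strict_mono (\<lambda>k. Suc (s k))"
        using s(1) by (simp add: strict_mono_def)
      from LIMSEQ_subseq_LIMSEQ[OF pisot_set_dist[OF \<xi>_in_pisot_set, of n] this]
      show "(\<lambda>k. dist_nearest_int ((partial_value \<beta> \<epsilon> (s k) - partial_value \<beta> (\<lambda>_. 0) (s k)) * (\<xi> * \<beta> powi n))) \<longlonglongrightarrow> 0"
        by (simp add: o_def partial_value_zero partial_value_eq_tail_Xbar[OF assms] s(2) mult_ac)
    qed
    then have "coding \<xi> H (\<lambda>_. 0) 1 n - coding \<xi> H \<epsilon> 1 n \<in> \<int>" for n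
      using Ints_minus[of "coding \<xi> H \<epsilon> 1 n - coding \<xi> H (\<lambda>_. 0) 1 n"] by simp
    then show ?thesis
      using zero_in_X by blast
  qed
qed

lemma \<phi>0_surj: "\<phi>0 ` X = carrier (torus m)"
proof
  show "\<phi>0 ` X \<subseteq> carrier (torus m)"
    by (auto simp: \<phi>0_def carrier_torus)
  show "carrier (torus m) \<subseteq> \<phi>0 ` X"
  proof
    fix L assume "L \<in> carrier (torus m)"
    then obtain t where t: "t \<in> carrier_vec m" "L = torus_proj m t"
      by (auto simp: carrier_torus)
    \<comment> \<open>Coordinate \<open>i\<close> sits at place \<open>- i\<close>, so the window is
      filled in reverse order.\<close>
    obtain u where u: "recurrent u" "\<And>i. i < m \<Longrightarrow> u (- int (m - 1) + int i) = t $ (m - 1 - i)"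
      using recurrent_exists[of "- int (m - 1)" "\<lambda>i. t $ (m - 1 - i)"] by blast
    have u_t: "u (- int i) = t $ i" if "i < m" for i
      using u(2)[of "m - 1 - i"] that by (simp add: of_nat_diff)
    obtain es where es: "\<And>N. es N \<in> X"
      "\<And>i. i < m \<Longrightarrow> (\<lambda>N. dist_nearest_int (coding \<xi> H (es N) 1 (- int i) - u (- int i))) \<longlonglongrightarrow> 0"
      using ex_coding_approx[OF u(1)] by blast
    obtain \<epsilon>1 s where \<epsilon>1: "\<epsilon>1 \<in> Xbar" and s: "strict_mono s"
      and lim: "\<And>n. (\<lambda>N. coding \<xi> H (es (s N)) 1 n) \<longlonglongrightarrow> coding \<xi> H \<epsilon>1 1 n"
      using ex_limit_in_Xbar[of es, OF es(1) integer_approx_H] by blast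
    obtain \<epsilon> where \<epsilon>: "\<epsilon> \<in> X" "\<And>n. coding \<xi> H \<epsilon> 1 n - coding \<xi> H \<epsilon>1 1 n \<in> \<int>"
      using Xbar_coding_equiv_X[OF \<epsilon>1] by blast
    have "coding \<xi> H \<epsilon>1 1 (- int i) - u (- int i) \<in> \<int>" if "i < m" for i
    proof (rule dist_nearest_int_lim)
      show "(\<lambda>N. coding \<xi> H (es (s N)) 1 (- int i) - u (- int i)) \<longlonglongrightarrow> coding \<xi> H \<epsilon>1 1 (- int i) - u (- int i)"
        by (intro tendsto_intros lim)
      show "(\<lambda>N. dist_nearest_int (coding \<xi> H (es (s N)) 1 (- int i) - u (- int i))) \<longlonglongrightarrow> 0"
        using LIMSEQ_subseq_LIMSEQ[OF es(2)[OF that] s] by (simp add: o_def)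
    qed
    then have "(coding \<xi> H \<epsilon> 1 (- int i) - coding \<xi> H \<epsilon>1 1 (- int i))
        + (coding \<xi> H \<epsilon>1 1 (- int i) - t $ i) \<in> \<int>" if "i < m" for i
      using that by (intro Ints_add \<epsilon>(2)) (simp flip: u_t)
    then have "coding \<xi> H \<epsilon> 1 (- int i) - t $ i \<in> \<int>" if "i < m" for i
      using that by simp
    then have "\<phi>0 \<epsilon> = L"
      unfolding \<phi>0_def t(2) by (subst torus_proj_eq_iff) (use t(1) in auto)
    then show "L \<in> \<phi>0 ` X"
      using \<epsilon>(1) by blast
  qed
qed

end

section \<open>The quotient group and the minimal polynomial\<close>

text \<open>Surjectivity of \<open>f\<close> makes every fibre nonempty, so multiplying fibres
  follows multiplication in \<open>G\<close> and the group laws carry over to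
  \<open>Q\<close>.\<close>

lemma group_hom_quotient_by_surjection:
  fixes f :: "'a \<Rightarrow> 'b" and \<phi> :: "'a \<Rightarrow> 'c" and G :: "'b monoid" and K :: "'c monoid"
  assumes G: "group G" and K: "group K" and surj: "f ` X = carrier G"
    and carrier: "\<And>e. e \<in> X \<Longrightarrow> \<phi> e \<in> carrier K"
    and const: "\<And>e e'. e \<in> X \<Longrightarrow> e' \<in> X \<Longrightarrow> f e = f e' \<Longrightarrow> \<phi> e = \<phi> e'"
    and mult: "\<And>e a b. e \<in> X \<Longrightarrow> a \<in> X \<Longrightarrow> b \<in> X \<Longrightarrow> f e = f a \<otimes>\<^bsub>G\<^esub> f b \<Longrightarrow> \<phi> e = \<phi> a \<otimes>\<^bsub>K\<^esub> \<phi> b"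
    and Q: "Q = \<lparr>carrier = X // {(a, b). a \<in> X \<and> b \<in> X \<and> f a = f b},
      monoid.mult = (\<lambda>A B. {e \<in> X. \<exists>a\<in>A. \<exists>b\<in>B. f e = f a \<otimes>\<^bsub>G\<^esub> f b}),
      one = {e \<in> X. f e = \<one>\<^bsub>G\<^esub>}\<rparr>"
  shows "group_hom Q K (\<lambda>A. the_elem (\<phi> ` A))"
    and "carrier Q = (\<lambda>e. {e' \<in> X. f e' = f e}) ` X"
    and "\<And>e. e \<in> X \<Longrightarrow> the_elem (\<phi> ` {e' \<in> X. f e' = f e}) = \<phi> e"
proof -
  interpret G: group G by (rule G)
  define cls where "cls t = {e \<in> X. f e = t}" for t
  let ?r = "{(a, b). a \<in> X \<and> b \<in> X \<and> f a = f b}"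
  have "carrier Q = (\<lambda>e. ?r `` {e}) ` X"
    by (auto simp: Q quotient_def)
  also have "\<dots> = (\<lambda>e. {e' \<in> X. f e' = f e}) ` X"
    by (rule image_cong) auto
  finally show carrier_Q': "carrier Q = (\<lambda>e. {e' \<in> X. f e' = f e}) ` X" .
  then have carrier_Q: "carrier Q = cls ` carrier G"
    unfolding surj[symmetric] by (simp add: cls_def image_image)
  have in_cls: "\<exists>e\<in>X. f e = t" if "t \<in> carrier G" for t
    using that unfolding surj[symmetric] by blast
  have mult_Q: "cls s \<otimes>\<^bsub>Q\<^esub> cls t = cls (s \<otimes>\<^bsub>G\<^esub> t)" if "s \<in> carrier G" "t \<in> carrier G" for s t
    using in_cls[OF that(1)] in_cls[OF that(2)] unfolding Q cls_def by auto
  have one_Q: "\<one>\<^bsub>Q\<^esub> = cls \<one>\<^bsub>G\<^esub>"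
    by (simp add: Q cls_def)
  have group_Q: "group Q"
  proof (rule groupI)
    fix x assume "x \<in> carrier Q"
    then obtain t where t: "t \<in> carrier G" "x = cls t"
      by (auto simp: carrier_Q)
    then show "\<exists>y\<in>carrier Q. y \<otimes>\<^bsub>Q\<^esub> x = \<one>\<^bsub>Q\<^esub>"
      by (intro bexI[of _ "cls (inv\<^bsub>G\<^esub> t)"]) (auto simp: mult_Q one_Q carrier_Q)
  qed (auto simp: carrier_Q mult_Q one_Q G.m_assoc)
  have eval: "the_elem (\<phi> ` cls (f e)) = \<phi> e" if "e \<in> X" for e
  proof -
    have "\<phi> ` cls (f e) = {\<phi> e}"
      using const that unfolding cls_def by blast
    then show ?thesis by simp
  qed
  then show "\<And>e. e \<in> X \<Longrightarrow> the_elem (\<phi> ` {e' \<in> X. f e' = f e}) = \<phi> e"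
    by (simp add: cls_def)
  have "(\<lambda>A. the_elem (\<phi> ` A)) \<in> hom Q K"
  proof (rule homI)
    fix x assume "x \<in> carrier Q"
    then obtain a where "a \<in> X" "x = cls (f a)"
      by (auto simp: carrier_Q' cls_def)
    then show "the_elem (\<phi> ` x) \<in> carrier K"
      using eval carrier by simp
  next
    fix x y assume "x \<in> carrier Q" "y \<in> carrier Q"
    then obtain a b where ab: "a \<in> X" "x = cls (f a)" "b \<in> X" "y = cls (f b)"
      by (auto simp: carrier_Q' cls_def)
    have fab: "f a \<in> carrier G" "f b \<in> carrier G"
      using ab surj by blast+
    then obtain e where e: "e \<in> X" "f e = f a \<otimes>\<^bsub>G\<^esub> f b"
      using in_cls by (meson G.m_closed)
    have xy: "x \<otimes>\<^bsub>Q\<^esub> y = cls (f e)"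
      using ab fab e(2) by (simp add: mult_Q)
    have "the_elem (\<phi> ` (x \<otimes>\<^bsub>Q\<^esub> y)) = \<phi> e"
      unfolding xy by (rule eval[OF e(1)])
    also have "\<dots> = \<phi> a \<otimes>\<^bsub>K\<^esub> \<phi> b"
      by (rule mult[OF e(1) ab(1,3) e(2)])
    finally show "the_elem (\<phi> ` (x \<otimes>\<^bsub>Q\<^esub> y)) = the_elem (\<phi> ` x) \<otimes>\<^bsub>K\<^esub> the_elem (\<phi> ` y)"
      using ab by (simp add: eval)
  qed
  then show "group_hom Q K (\<lambda>A. the_elem (\<phi> ` A))"
    using group_Q K by (simp add: group_hom_def group_hom_axioms_def)
qed

section \<open>The rational minimal polynomial\<close>

lemma poly_of_rat_diff:
  "poly (map_poly of_rat (p - q)) x = poly (map_poly of_rat p) x - poly (map_poly of_rat q) (x :: real)"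
proof -
  have "map_poly of_rat (p - q) = (map_poly of_rat p - map_poly of_rat q :: real poly)"
    by (rule poly_eqI) (simp add: coeff_map_poly of_rat_diff)
  then show ?thesis by simp
qed

lemma poly_of_rat_smult:
  "poly (map_poly of_rat (Polynomial.smult c p)) x = of_rat c * poly (map_poly of_rat p) (x :: real)"
proof -
  have "map_poly of_rat (Polynomial.smult c p) = (Polynomial.smult (of_rat c) (map_poly of_rat p) :: real poly)"
    by (rule poly_eqI) (simp add: coeff_map_poly of_rat_mult)
  then show ?thesis by simp
qed

text \<open>The \<open>THE\<close> needs uniqueness: the difference of two monic annihilating
  polynomials of the same minimal degree has smaller degree and the same root, so it is 0.\<close>

lemma min_poly_properties:
  assumes "algebraic_int x"
  shows "lead_coeff (min_poly x) = 1" "poly (map_poly of_rat (min_poly x)) x = 0"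
    "\<And>q. q \<noteq> 0 \<Longrightarrow> poly (map_poly of_rat q) x = 0 \<Longrightarrow> Polynomial.degree (min_poly x) \<le> Polynomial.degree q"
proof -
  let ?root = "\<lambda>p. poly (map_poly of_rat p) x = 0"
  let ?P = "\<lambda>p. lead_coeff p = 1 \<and> ?root p \<and> (\<forall>q. q \<noteq> 0 \<and> ?root q \<longrightarrow> Polynomial.degree p \<le> Polynomial.degree q)"
  obtain p0 :: "int poly" where p0: "poly (map_poly of_int p0) x = 0" "lead_coeff p0 = 1"
    using assms by (auto simp: algebraic_int_altdef_ipoly)
  define r where "r = (map_poly of_int p0 :: rat poly)"
  have "map_poly of_rat r = (map_poly of_int p0 :: real poly)"
    by (simp add: r_def map_poly_map_poly o_def)
  moreover have "r \<noteq> 0"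
    using p0(2) by (metis coeff_map_poly leading_coeff_0_iff of_int_0 of_int_1 r_def zero_neq_one coeff_0)
  ultimately have "r \<noteq> 0 \<and> ?root r"
    using p0(1) by simp
  then obtain q where q: "q \<noteq> 0" "?root q" "\<And>q'. q' \<noteq> 0 \<Longrightarrow> ?root q' \<Longrightarrow> Polynomial.degree q \<le> Polynomial.degree q'"
    using ex_has_least_nat[of "\<lambda>q. q \<noteq> 0 \<and> ?root q" r Polynomial.degree] by blast
  define p where "p = Polynomial.smult (inverse (lead_coeff q)) q"
  have "?P p"
    using q by (simp add: p_def poly_of_rat_smult)
  moreover have "p' = p" if "?P p'" for p'
  proof (rule ccontr)
    assume "p' \<noteq> p"
    have "p \<noteq> 0" "p' \<noteq> 0"
      using \<open>?P p\<close> that by auto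
    then have deg: "Polynomial.degree p' = Polynomial.degree p"
      using \<open>?P p\<close> that by (metis le_antisym)
    have "Polynomial.degree (p' - p) < Polynomial.degree p"
    proof (rule ccontr)
      assume "\<not> ?thesis"
      then have "Polynomial.degree (p' - p) = Polynomial.degree p"
        using degree_diff_le_max[of p' p] deg by simp
      moreover have "coeff p' (Polynomial.degree p) = 1" "coeff p (Polynomial.degree p) = 1"
        using \<open>?P p\<close> that deg by auto
      ultimately have "lead_coeff (p' - p) = 0"
        by simp
      then show False
        using \<open>p' \<noteq> p\<close> by (simp only: leading_coeff_0_iff right_minus_eq)
    qed
    moreover have "?root (p' - p)"
      using \<open>?P p\<close> that by (simp add: poly_of_rat_diff)
    ultimately show False
      using \<open>?P p\<close> \<open>p' \<noteq> p\<close> by (metis not_le right_minus_eq)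
  qed
  ultimately have "?P (min_poly x)"
    unfolding min_poly_def by (rule theI)
  then show "lead_coeff (min_poly x) = 1" "?root (min_poly x)"
    "\<And>q. q \<noteq> 0 \<Longrightarrow> ?root q \<Longrightarrow> Polynomial.degree (min_poly x) \<le> Polynomial.degree q"
    by blast+
qed

text \<open>Otherwise the derivative would be a nonzero rational polynomial of smaller degree with
  the same root.\<close>

lemma min_poly_simple_root:
  assumes "algebraic_int x"
  shows "poly (pderiv (map_poly of_rat (min_poly x))) x \<noteq> 0"
proof
  assume zero: "poly (pderiv (map_poly of_rat (min_poly x))) x = 0"
  have deg: "Polynomial.degree (min_poly x) > 0"
  proof (rule ccontr)
    assume "\<not> ?thesis"
    then have "min_poly x = [:1:]"
      using min_poly_properties(1)[OF assms] by (metis degree_eq_zeroE coeff_pCons_0 gr0I)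
    then show False
      using min_poly_properties(2)[OF assms] by (simp add: map_poly_pCons)
  qed
  have "pderiv (map_poly of_rat (min_poly x)) = (map_poly of_rat (pderiv (min_poly x)) :: real poly)"
    by (rule poly_eqI) (simp add: coeff_pderiv coeff_map_poly of_rat_mult of_rat_add)
  moreover have "pderiv (min_poly x) \<noteq> 0"
    using deg by (simp add: pderiv_eq_0_iff)
  ultimately have "Polynomial.degree (min_poly x) \<le> Polynomial.degree (pderiv (min_poly x))"
    using zero by (intro min_poly_properties(3)[OF assms]) auto
  then show False
    using deg by (simp add: degree_pderiv)
qed

text \<open>Integrality of the minimal polynomial is taken from its recurrence form, which replaces
  an appeal to Gauss's lemma.\<close>

lemma recurrence_poly_of_int: "\<exists>p :: int poly. recurrence_poly m k = map_poly of_int p"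
  by (rule exI[of _ "monom 1 m - (\<Sum>j=1..m. monom (k j) (m - j))"], rule poly_eqI)
     (auto simp: recurrence_poly_def coeff_map_poly coeff_sum intro!: sum.cong)

lemma pisot_unit_imp_pisot_recurrence:
  assumes "pisot_unit \<beta>" and gi: "min_poly \<beta> = map_poly of_int gi"
  shows "pisot_recurrence \<beta> gi"
proof
  have alg: "algebraic_int \<beta>"
    using assms(1) by (simp add: pisot_unit_def)
  have real: "map_poly of_rat (min_poly \<beta>) = (map_poly of_int gi :: real poly)"
    and complex: "map_poly of_rat (min_poly \<beta>) = (map_poly of_int gi :: complex poly)"
    by (simp_all add: gi map_poly_map_poly o_def)
  show "\<beta> > 1"
    using assms(1) by (simp add: pisot_unit_def)
  show "lead_coeff gi = 1"
    using min_poly_properties(1)[OF alg] by (simp add: gi degree_map_poly coeff_map_poly)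
  have "of_int (coeff gi 0) \<in> {1 :: rat, -1}"
    using assms(1) by (simp add: pisot_unit_def gi coeff_map_poly)
  then show "coeff gi 0 \<in> {1, -1}"
    by (metis insert_iff of_int_1 of_int_eq_iff of_int_minus singleton_iff)
  show "poly (map_poly of_int gi) \<beta> = 0"
    using min_poly_properties(2)[OF alg] by (simp add: real)
  show "poly (pderiv (map_poly of_int gi)) \<beta> \<noteq> 0"
    using min_poly_simple_root[OF alg] by (simp add: real)
  show "cmod z < 1" if "poly (map_poly of_int gi) z = 0" "z \<noteq> of_real \<beta>" for z :: complex
    using assms(1) that by (simp add: pisot_unit_def complex)
qed

theorem theorem3p1:
  fixes \<beta> :: real and m :: nat and k :: "nat \<Rightarrow> int"
    and T :: "real vec set \<Rightarrow> real vec set"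
  assumes "pisot_unit \<beta>"
    and "finitary \<beta>"
    and "Polynomial.degree (min_poly \<beta>) = m"
    and "min_poly \<beta> = recurrence_poly m k"
    and "T = companion_torus_map m k"
  shows "(\<forall>\<epsilon>\<in>beta_compactum \<beta>. \<forall>\<epsilon>'\<in>beta_compactum \<beta>.
            phi0 m \<beta> \<epsilon> = phi0 m \<beta> \<epsilon>' \<longrightarrow> phi m \<beta> \<epsilon> = phi m \<beta> \<epsilon>') \<and>
         group_hom (quotient_compactum m \<beta>) (torus m) (phi_induced m \<beta>) \<and>
         kernel (quotient_compactum m \<beta>) (torus m) (phi_induced m \<beta>) = tail_classes \<beta> \<and>
         (\<forall>\<epsilon>\<in>beta_compactum \<beta>. phi m \<beta> \<epsilon> = \<one>\<^bsub>torus m\<^esub> \<longleftrightarrow>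
            (\<exists>C\<in>pisot_classes \<beta>. \<epsilon> \<in> periodic_tails \<beta> C))"
proof -
  obtain gi :: "int poly" where gi: "min_poly \<beta> = map_poly of_int gi"
    using recurrence_poly_of_int[of m k] unfolding assms(4)[symmetric] by (rule exE)
  interpret pisot_recurrence \<beta> gi
    by (rule pisot_unit_imp_pisot_recurrence[OF assms(1) gi])
  interpret finitary_pisot \<beta> gi
    by unfold_locales (rule finitary_imp_finite_expansion_1[OF beta_gt_1 assms(2)])
  have m: "pisot_recurrence.m gi = m"
    using assms(3) by (simp add: m_def gi degree_map_poly)
  have "xi0 \<beta> = \<xi>"
    by (simp add: xi0_def \<xi>_def poly_h g_def gi map_poly_map_poly o_def)
  then have phi0: "phi0 m \<beta> \<epsilon> = \<phi>0 \<epsilon>" if "\<epsilon> \<in> X" for \<epsilon>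
    using torus_lim_partial_value[OF that integer_approx_H] by (simp add: phi0_def \<phi>0_def m)
  have phi: "phi m \<beta> \<epsilon> = \<phi> \<epsilon>" if "\<epsilon> \<in> X" for \<epsilon>
    using torus_lim_partial_value[OF that integer_approx_A] by (simp add: phi_def \<phi>_def m)
  have surj: "phi0 m \<beta> ` X = carrier (torus m)"
    using \<phi>0_surj by (simp add: phi0 m cong: image_cong_simp)
  have phi_carrier: "phi m \<beta> \<epsilon> \<in> carrier (torus m)" if "\<epsilon> \<in> X" for \<epsilon>
    using that coding_vec_simps(1)[of 1 A \<epsilon>] by (simp add: phi \<phi>_def carrier_torus m)
  have const: "phi m \<beta> \<epsilon> = phi m \<beta> \<epsilon>'" if "\<epsilon> \<in> X" "\<epsilon>' \<in> X" "phi0 m \<beta> \<epsilon> = phi0 m \<beta> \<epsilon>'" for \<epsilon> \<epsilon>'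
    using \<phi>0_eq_imp_\<phi>_eq[OF that(1,2)] that by (simp add: phi0 phi)
  have mult: "phi m \<beta> \<epsilon> = phi m \<beta> \<epsilon>1 \<otimes>\<^bsub>torus m\<^esub> phi m \<beta> \<epsilon>2"
    if "\<epsilon> \<in> X" "\<epsilon>1 \<in> X" "\<epsilon>2 \<in> X" "phi0 m \<beta> \<epsilon> = phi0 m \<beta> \<epsilon>1 \<otimes>\<^bsub>torus m\<^esub> phi0 m \<beta> \<epsilon>2" for \<epsilon> \<epsilon>1 \<epsilon>2
    using \<phi>0_mult_imp_\<phi>_mult[OF that(1-3)] that by (simp add: phi0 phi m)
  have Q: "quotient_compactum m \<beta> = \<lparr>carrier = X // {(a, b). a \<in> X \<and> b \<in> X \<and> phi0 m \<beta> a = phi0 m \<beta> b},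
      monoid.mult = (\<lambda>A B. {e \<in> X. \<exists>a\<in>A. \<exists>b\<in>B. phi0 m \<beta> e = phi0 m \<beta> a \<otimes>\<^bsub>torus m\<^esub> phi0 m \<beta> b}),
      one = {e \<in> X. phi0 m \<beta> e = \<one>\<^bsub>torus m\<^esub>}\<rparr>"
    by (simp add: quotient_compactum_def phi0_rel_def)
  have induced: "phi_induced m \<beta> = (\<lambda>A. the_elem (phi m \<beta> ` A))"
    by (simp add: phi_induced_def fun_eq_iff)
  have hom: "group_hom (quotient_compactum m \<beta>) (torus m) (phi_induced m \<beta>)"
    unfolding induced
    by (rule group_hom_quotient_by_surjection(1)[OF group_torus group_torus surj _ _ _ Q])
       (fact phi_carrier const mult)+
  have carrier: "carrier (quotient_compactum m \<beta>) = (\<lambda>\<epsilon>. {\<epsilon>' \<in> X. phi0 m \<beta> \<epsilon>' = phi0 m \<beta> \<epsilon>}) ` X"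
    by (rule group_hom_quotient_by_surjection(2)[where \<phi> = "phi m \<beta>",
          OF group_torus group_torus surj _ _ _ Q])
       (fact phi_carrier const mult)+
  have eval: "the_elem (phi m \<beta> ` {\<epsilon>' \<in> X. phi0 m \<beta> \<epsilon>' = phi0 m \<beta> \<epsilon>}) = phi m \<beta> \<epsilon>"
    if "\<epsilon> \<in> X" for \<epsilon>
    by (rule group_hom_quotient_by_surjection(3)[OF group_torus group_torus surj _ _ _ Q])
       (fact phi_carrier const mult that)+
  have classes: "{\<epsilon>' \<in> X. phi0 m \<beta> \<epsilon>' = phi0 m \<beta> \<epsilon>} = periodic_tails \<beta> ((+) (tail \<epsilon> 1) ` int_ring_ext \<beta>)"
    if "\<epsilon> \<in> X" "phi m \<beta> \<epsilon> = \<one>\<^bsub>torus m\<^esub>" for \<epsilon>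
  proof -
    have "{\<epsilon>' \<in> X. phi0 m \<beta> \<epsilon>' = phi0 m \<beta> \<epsilon>} = {\<epsilon>' \<in> X. \<phi>0 \<epsilon>' = \<phi>0 \<epsilon>}"
      using that(1) phi0 by auto
    then show ?thesis
      using \<phi>0_class_eq_periodic_tails[OF that(1)] that by (simp add: phi m)
  qed
  have one_iff: "phi m \<beta> \<epsilon> = \<one>\<^bsub>torus m\<^esub> \<longleftrightarrow> periodic \<epsilon> \<and> tail \<epsilon> 1 \<in> pisot_set \<beta>" if "\<epsilon> \<in> X" for \<epsilon>
    using \<phi>_eq_one_iff_periodic[OF that] that by (simp add: phi m)
  \<comment> \<open>Any member of a set of tails provides a new representative of the coset, namely
    its own remainder at 1; \<open>classes\<close> then identifies the set with the class of that
    member.\<close>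
  have mem_class: "\<epsilon> \<in> X \<and> phi m \<beta> \<epsilon> = \<one>\<^bsub>torus m\<^esub> \<and>
      periodic_tails \<beta> ((+) x ` int_ring_ext \<beta>) = periodic_tails \<beta> ((+) (tail \<epsilon> 1) ` int_ring_ext \<beta>)"
    if x: "x \<in> pisot_set \<beta>" and \<epsilon>: "\<epsilon> \<in> periodic_tails \<beta> ((+) x ` int_ring_ext \<beta>)" for \<epsilon> x
  proof -
    have *: "\<epsilon> \<in> X" "periodic \<epsilon>" "tail \<epsilon> 1 - x \<in> int_ring_ext \<beta>"
      using \<epsilon> by (auto simp: periodic_tails_eq)
    have "tail \<epsilon> 1 \<in> pisot_set \<beta>"
      using pisot_set_add[OF pisot_set_mult[OF one_in_pisot_set *(3)] x] by simp
    moreover have "y - x \<in> int_ring_ext \<beta> \<longleftrightarrow> y - tail \<epsilon> 1 \<in> int_ring_ext \<beta>" for y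
      using int_ring_ext_diff[OF _ *(3), of "y - x"] int_ring_ext_add[OF _ *(3), of "y - tail \<epsilon> 1"] by auto
    then have "periodic_tails \<beta> ((+) x ` int_ring_ext \<beta>) = periodic_tails \<beta> ((+) (tail \<epsilon> 1) ` int_ring_ext \<beta>)"
      unfolding periodic_tails_eq by auto
    ultimately show ?thesis
      using * one_iff by blast
  qed
  have kernel: "kernel (quotient_compactum m \<beta>) (torus m) (phi_induced m \<beta>) = tail_classes \<beta>"
  proof (rule equalityI; rule subsetI)
    fix A assume "A \<in> kernel (quotient_compactum m \<beta>) (torus m) (phi_induced m \<beta>)"
    then have A: "A \<in> carrier (quotient_compactum m \<beta>)" "the_elem (phi m \<beta> ` A) = \<one>\<^bsub>torus m\<^esub>"
      by (simp_all add: kernel_def induced)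
    then obtain \<epsilon> where \<epsilon>: "\<epsilon> \<in> X" "A = {\<epsilon>' \<in> X. phi0 m \<beta> \<epsilon>' = phi0 m \<beta> \<epsilon>}"
      unfolding carrier by blast
    have one: "phi m \<beta> \<epsilon> = \<one>\<^bsub>torus m\<^esub>"
      using A(2) unfolding \<epsilon>(2) eval[OF \<epsilon>(1)] .
    then have "tail \<epsilon> 1 \<in> pisot_set \<beta>"
      using one_iff[OF \<epsilon>(1)] by blast
    moreover have "A = periodic_tails \<beta> ((+) (tail \<epsilon> 1) ` int_ring_ext \<beta>)"
      unfolding \<epsilon>(2) by (rule classes[OF \<epsilon>(1) one])
    ultimately show "A \<in> tail_classes \<beta>"
      unfolding tail_classes_def pisot_classes_def by blast
  next
    fix A assume "A \<in> tail_classes \<beta>"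
    then obtain x where x: "x \<in> pisot_set \<beta>" "A = periodic_tails \<beta> ((+) x ` int_ring_ext \<beta>)"
      unfolding tail_classes_def pisot_classes_def by blast
    \<comment> \<open>A member exists by \<open>ex_periodic_tail\<close>; it is what makes
      \<open>A\<close> an element of the quotient.\<close>
    obtain \<epsilon> where "\<epsilon> \<in> periodic_tails \<beta> ((+) x ` int_ring_ext \<beta>)"
      using ex_periodic_tail[OF x(1)] unfolding periodic_tails_eq by blast
    from mem_class[OF x(1) this] have \<epsilon>: "\<epsilon> \<in> X" "phi m \<beta> \<epsilon> = \<one>\<^bsub>torus m\<^esub>"
      and A: "A = periodic_tails \<beta> ((+) (tail \<epsilon> 1) ` int_ring_ext \<beta>)"
      unfolding x(2) by blast+
    have A: "A = {\<epsilon>' \<in> X. phi0 m \<beta> \<epsilon>' = phi0 m \<beta> \<epsilon>}"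
      unfolding A by (rule classes[OF \<epsilon>, symmetric])
    then have "A \<in> carrier (quotient_compactum m \<beta>)"
      unfolding carrier using \<epsilon>(1) by blast
    moreover have "the_elem (phi m \<beta> ` A) = \<one>\<^bsub>torus m\<^esub>"
      unfolding A eval[OF \<epsilon>(1)] by (rule \<epsilon>(2))
    ultimately show "A \<in> kernel (quotient_compactum m \<beta>) (torus m) (phi_induced m \<beta>)"
      by (simp add: kernel_def induced)
  qed
  have "phi m \<beta> \<epsilon> = \<one>\<^bsub>torus m\<^esub> \<longleftrightarrow> (\<exists>C\<in>pisot_classes \<beta>. \<epsilon> \<in> periodic_tails \<beta> C)" if "\<epsilon> \<in> X" for \<epsilon>
  proof
    assume one: "phi m \<beta> \<epsilon> = \<one>\<^bsub>torus m\<^esub>"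
    then have "\<epsilon> \<in> periodic_tails \<beta> ((+) (tail \<epsilon> 1) ` int_ring_ext \<beta>)"
      using classes[OF that one] that by blast
    then show "\<exists>C\<in>pisot_classes \<beta>. \<epsilon> \<in> periodic_tails \<beta> C"
      using one one_iff[OF that] unfolding pisot_classes_def by blast
  next
    assume "\<exists>C\<in>pisot_classes \<beta>. \<epsilon> \<in> periodic_tails \<beta> C"
    then show "phi m \<beta> \<epsilon> = \<one>\<^bsub>torus m\<^esub>"
      unfolding pisot_classes_def using mem_class by blast
  qed
  then show ?thesis
    using const hom kernel by (intro conjI ballI impI)
qed

end
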